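(* There exists a voting rule $\mathcal{E}$ such that $\mathcal{E}$-Control by Replacing Voters is $\mathrm{NP}$-complete (under polynomial-time many-one reductions), but $\mathcal{E}$-Conformant Bribery is in $\mathrm{P}$.
   Context: An election $(C,V)$ consists of a finite set of candidates $C$ and a finite collection (multiset, listed explicitly) of voters $V$; each voter has a vote, which is a strict total order over $C$. A voting rule $\mathcal{E}$ maps each election to a (possibly empty) subset of its candidate set, the $\mathcal{E}$-winners. $\mathcal{E}$-Control by Replacing Voters. Given: an election $(C,V)$ ($V$ are the registered voters), a collection $U$ of unregistered voters with votes over $C$, an integer $k\ge 0$, and a preferred candidate $p\in C$. Question: do there exist subcollections $V'\subseteq V$ and $U'\subseteq U$ with $\|V'\|=\|U'\|\le k$ such that $p$ is an $\mathcal{E}$-winner of $(C,(V\setminus V')\cup U')$? $\mathcal{E}$-Conformant Bribery. Given: an election $(C,V)$, a bribe limit $k\ge 0$, and a preferred candidate $p\in C$. Question: does there exist a way to set the votes of a subcollection of at most $k$ voters in $V$ to votes that occur in (the original) $V$ such that $p$ is an $\mathcal{E}$-winner of the resulting election? *)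

theory Defs
  imports
    "HOL-Computational_Algebra.Polynomial"
    "HOL-Combinatorics.Multiset_Permutations"
begin

section \<open>Deterministic multi-tape Turing machines\<close>

text \<open>
  Tapes are infinite in both directions and a tape is given with its head position. States are
  \<open>0, \<dots>, num_states M\<close>; the machine starts in state \<open>0\<close> and \<open>num_states M\<close> is the halting state.
  Tape symbols are \<open>0, \<dots>, num_syms M - 1\<close>, where \<open>0\<close> is the blank and \<open>1\<close>, \<open>2\<close> stand for the two
  bits. In state \<open>q\<close>, reading the symbols \<open>gs\<close> (one per tape), \<open>trans M q gs\<close> gives the next state
  and, for each tape, the symbol to write and the head movement.
\<close>

type_synonym tape = "(int \<Rightarrow> nat) \<times> int"
type_synonym config = "nat \<times> tape list"

record tm =
  num_tapes :: nat
  num_syms :: nat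
  num_states :: nat
  trans :: "nat \<Rightarrow> nat list \<Rightarrow> nat \<times> (nat \<times> int) list"

definition turing_machine :: "tm \<Rightarrow> bool" where
  "turing_machine M \<longleftrightarrow> num_tapes M \<ge> 2 \<and> num_syms M \<ge> 3 \<and>
    (\<forall>q gs. q < num_states M \<longrightarrow> length gs = num_tapes M \<longrightarrow> set gs \<subseteq> {..<num_syms M} \<longrightarrow>
      (case trans M q gs of (q', as) \<Rightarrow>
        q' \<le> num_states M \<and> length as = num_tapes M \<and>
        set as \<subseteq> {..<num_syms M} \<times> {-1, 0, 1}))"

definition read_tape :: "tape \<Rightarrow> nat" where
  "read_tape t = fst t (snd t)"

definition act :: "nat \<times> int \<Rightarrow> tape \<Rightarrow> tape" where
  "act a t = ((fst t)(snd t := fst a), snd t + snd a)"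

definition step :: "tm \<Rightarrow> config \<Rightarrow> config" where
  "step M c = (case c of (q, ts) \<Rightarrow>
     if q = num_states M then (q, ts)
     else (case trans M q (map read_tape ts) of (q', as) \<Rightarrow> (q', map2 act as ts)))"

definition contents :: "bool list \<Rightarrow> int \<Rightarrow> nat" where
  "contents x i = (if 0 \<le> i \<and> i < int (length x) then (if x ! nat i then 2 else 1) else 0)"

definition start_config :: "tm \<Rightarrow> bool list \<Rightarrow> config" where
  "start_config M x = (0, (contents x, 0) # replicate (num_tapes M - 1) (contents [], 0))"

text \<open>
  The input is on tape \<open>0\<close>, the output is left on tape \<open>1\<close>. As halting configurations are fixed
  points of \<^const>\<open>step\<close>, the condition says that \<open>M\<close> halts after at most \<open>poly b (length x)\<close> steps.
\<close>

definition polytime :: "(bool list \<Rightarrow> bool list) \<Rightarrow> bool" where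
  "polytime f \<longleftrightarrow> (\<exists>M (b :: nat poly). turing_machine M \<and>
    (\<forall>x. case (step M ^^ poly b (length x)) (start_config M x) of (q, ts) \<Rightarrow>
      q = num_states M \<and> fst (ts ! 1) = contents (f x)))"


section \<open>Encodings\<close>

text \<open>
  The encoding of a list is self-delimiting: every element is preceded by \<open>True\<close>, and \<open>False\<close> marks
  the end. Hence tuples can be encoded by concatenation.
\<close>

definition enc_list :: "('a \<Rightarrow> bool list) \<Rightarrow> 'a list \<Rightarrow> bool list" where
  "enc_list e xs = concat (map (\<lambda>x. True # e x) xs) @ [False]"

definition enc_string :: "bool list \<Rightarrow> bool list" where
  "enc_string = enc_list (\<lambda>b. [b])"

text \<open>Binary representation, least significant bit first, without superfluous zeros.\<close>

fun bin_of_nat :: "nat \<Rightarrow> bool list" where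
  "bin_of_nat n = (if n = 0 then [] else odd n # bin_of_nat (n div 2))"

declare bin_of_nat.simps [simp del]

definition enc_nat :: "nat \<Rightarrow> bool list" where
  "enc_nat n = enc_string (bin_of_nat n)"


section \<open>Complexity classes\<close>

type_synonym lang = "bool list set"

definition class_P :: "lang set" where
  "class_P = {A. polytime (\<lambda>x. [x \<in> A])}"

definition class_NP :: "lang set" where
  "class_NP = {A. \<exists>B \<in> class_P. \<exists>b :: nat poly. \<forall>x.
     x \<in> A \<longleftrightarrow> (\<exists>y. length y \<le> poly b (length x) \<and> enc_string x @ enc_string y \<in> B)}"

definition poly_many_one_reducible :: "lang \<Rightarrow> lang \<Rightarrow> bool" where
  "poly_many_one_reducible A B \<longleftrightarrow> (\<exists>f. polytime f \<and> (\<forall>x. x \<in> A \<longleftrightarrow> f x \<in> B))"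

definition NP_complete :: "lang \<Rightarrow> bool" where
  "NP_complete B \<longleftrightarrow> B \<in> class_NP \<and> (\<forall>A \<in> class_NP. poly_many_one_reducible A B)"


section \<open>Elections\<close>

text \<open>
  Candidates are named by bit strings. A strict total order over a finite candidate set is given by
  the list of the candidates from most to least preferred.
\<close>

type_synonym cand = "bool list"
type_synonym vote = "cand list"
type_synonym rule = "cand set \<Rightarrow> vote multiset \<Rightarrow> cand set"

definition election :: "cand set \<Rightarrow> vote multiset \<Rightarrow> bool" where
  "election C V \<longleftrightarrow> finite C \<and> set_mset V \<subseteq> permutations_of_set C"

definition voting_rule :: "rule \<Rightarrow> bool" where
  "voting_rule E \<longleftrightarrow> (\<forall>C V. election C V \<longrightarrow> E C V \<subseteq> C)"

definition replacing_possible ::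
    "rule \<Rightarrow> cand set \<Rightarrow> vote multiset \<Rightarrow> vote multiset \<Rightarrow> nat \<Rightarrow> cand \<Rightarrow> bool" where
  "replacing_possible E C V U k p \<longleftrightarrow>
    (\<exists>V' U'. V' \<subseteq># V \<and> U' \<subseteq># U \<and> size V' = size U' \<and> size U' \<le> k \<and> p \<in> E C ((V - V') + U'))"

text \<open>The votes \<open>V'\<close> of the bribed voters are changed to the votes \<open>B\<close>.\<close>

definition conformant_bribery_possible ::
    "rule \<Rightarrow> cand set \<Rightarrow> vote multiset \<Rightarrow> nat \<Rightarrow> cand \<Rightarrow> bool" where
  "conformant_bribery_possible E C V k p \<longleftrightarrow>
    (\<exists>V' B. V' \<subseteq># V \<and> set_mset B \<subseteq> set_mset V \<and> size V' = size B \<and> size V' \<le> k \<and>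
      p \<in> E C ((V - V') + B))"


section \<open>The decision problems\<close>

text \<open>
  In an instance, the candidates and the voters are listed explicitly, in any order; the limit \<open>k\<close>
  is in binary.
\<close>

definition enc_votes :: "vote list \<Rightarrow> bool list" where
  "enc_votes = enc_list (enc_list enc_string)"

definition control_by_replacing_voters :: "rule \<Rightarrow> lang" where
  "control_by_replacing_voters E =
    {enc_list enc_string cs @ enc_votes vs @ enc_votes us @ enc_nat k @ enc_string p | cs vs us k p.
      distinct cs \<and> election (set cs) (mset vs) \<and> election (set cs) (mset us) \<and> p \<in> set cs \<and>
      replacing_possible E (set cs) (mset vs) (mset us) k p}"

definition conformant_bribery :: "rule \<Rightarrow> lang" where
  "conformant_bribery E =
    {enc_list enc_string cs @ enc_votes vs @ enc_nat k @ enc_string p | cs vs k p.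
      distinct cs \<and> election (set cs) (mset vs) \<and> p \<in> set cs \<and>
      conformant_bribery_possible E (set cs) (mset vs) k p}"

end

theory Submission
  imports Defs "HOL-Library.Countable"
begin

text \<open>
  The voting rule makes everybody win iff the top choices of the voters, read as sets of bit positions,
  are nonempty and pairwise disjoint. Conformant bribery is then useless: the
  top choices after a successful bribery occurred before it and are pairwise distinct, so the bribery
  has not changed them. Control by replacing voters, when the registered voters all have the empty set
  as their top choice, has to select as many pairwise disjoint sets as there are voters.

  Set packing is NP-hard since it expresses tilings: a tile in a cell is a set that contains an element
  for the cell and is disjoint from the sets of exactly those tiles in the neighbouring cells whose
  colours match. Tilings of a grid express the computations of a Turing machine: the column of a cell
  is a position on the tapes, and the row \<open>0\<close> guesses the certificate.

  Polynomial time bounds are obtained from a small language whose variables range over the positions of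
  the input, so that programs have polynomially many configurations. Since such a program cannot count
  beyond the length of its input, the reduction first pads its input by repeated squaring.
\<close>

section \<open>Machines with an arbitrary finite control\<close>

text \<open>The problems are sets of bit strings and polynomial time means multi-tape Turing
  machines, so every algorithm has to become a machine. Running times are nevertheless never
  analysed: a deterministic program that halts cannot repeat a configuration, so the number of its
  configurations bounds its time.

  Hardness starts from the verifier of an arbitrary language in NP. The obstacle is that a step of a
  machine with several tapes depends on symbols under heads that may be far apart, whereas a tile
  sees only its neighbours. Each row therefore carries one guess of all symbols read, passed along
  as part of the horizontal colours, and the cell where a head stands checks the entry of its tape.

  One registered voter per cell, together with an element shared by all sets of the same cell,
  forces exactly one tile into every cell.\<close>

type_synonym 'q program = "'q \<Rightarrow> nat list \<Rightarrow> 'q \<times> (nat \<times> int) list"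

definition mstep :: "'q program \<Rightarrow> 'q \<Rightarrow> 'q \<times> tape list \<Rightarrow> 'q \<times> tape list" where
  "mstep \<delta> h c = (case c of (q, ts) \<Rightarrow>
     if q = h then (q, ts)
     else (case \<delta> q (map read_tape ts) of (q', as) \<Rightarrow> (q', map2 act as ts)))"

definition valid_tapes :: "nat \<Rightarrow> nat \<Rightarrow> tape list \<Rightarrow> bool" where
  "valid_tapes k g ts \<longleftrightarrow> length ts = k \<and> (\<forall>t\<in>set ts. \<forall>i. fst t i < g)"

definition valid_move :: "'q set \<Rightarrow> nat \<Rightarrow> nat \<Rightarrow> 'q \<times> (nat \<times> int) list \<Rightarrow> bool" where
  "valid_move Q k g m \<longleftrightarrow> fst m \<in> Q \<and> length (snd m) = k \<and> set (snd m) \<subseteq> {..<g} \<times> {-1, 0, 1}"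

lemma step_eq_mstep: "step M = mstep (trans M) (num_states M)"
  by (rule ext) (simp add: step_def mstep_def)

lemma mstep_halted [simp]: "mstep \<delta> h (h, ts) = (h, ts)"
  by (simp add: mstep_def)

lemma mstep_pow_halted [simp]: "(mstep \<delta> h ^^ n) (h, ts) = (h, ts)"
  by (induction n) auto

lemma mstep_pow_mono:
  assumes "(mstep \<delta> h ^^ m) c = (h, ts)" "m \<le> n"
  shows "(mstep \<delta> h ^^ n) c = (h, ts)"
proof -
  have "(mstep \<delta> h ^^ n) c = (mstep \<delta> h ^^ (n - m)) ((mstep \<delta> h ^^ m) c)"
    using assms(2) by (metis comp_apply funpow_add le_add_diff_inverse2)
  thus ?thesis by (simp add: assms(1))
qed

lemma valid_reads:
  assumes "valid_tapes k g ts"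
  shows "length (map read_tape ts) = k" "set (map read_tape ts) \<subseteq> {..<g}"
  using assms by (auto simp: valid_tapes_def read_tape_def)

lemma valid_tapes_act:
  assumes "valid_tapes k g ts" "length as = k" "set as \<subseteq> {..<g} \<times> D"
  shows "valid_tapes k g (map2 act as ts)"
  using assms unfolding valid_tapes_def
  by (fastforce simp: act_def dest: set_zip_leftD set_zip_rightD)

lemma valid_mstep:
  assumes "\<And>q gs. q \<in> Q \<Longrightarrow> q \<noteq> h \<Longrightarrow> length gs = k \<Longrightarrow> set gs \<subseteq> {..<g} \<Longrightarrow> valid_move Q k g (\<delta> q gs)"
    and "valid_tapes k g ts" "q \<in> Q"
  shows "fst (mstep \<delta> h (q, ts)) \<in> Q \<and> valid_tapes k g (snd (mstep \<delta> h (q, ts)))"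
proof (cases "q = h")
  case True
  thus ?thesis using assms by simp
next
  case False
  obtain q' as where d: "\<delta> q (map read_tape ts) = (q', as)" by fastforce
  have "valid_move Q k g (q', as)"
    using assms(1)[OF assms(3) False valid_reads[OF assms(2)]] d by simp
  thus ?thesis
    using False d valid_tapes_act[OF assms(2)] by (auto simp: mstep_def valid_move_def)
qed

lemma valid_trans:
  assumes "turing_machine M" "q \<in> {..num_states M}" "q \<noteq> num_states M"
    "length gs = num_tapes M" "set gs \<subseteq> {..<num_syms M}"
  shows "valid_move {..num_states M} (num_tapes M) (num_syms M) (trans M q gs)"
proof -
  have "q < num_states M" using assms(2,3) by simp
  thus ?thesis
    using assms by (simp add: turing_machine_def valid_move_def case_prod_beta)
qed

lemma valid_steps:
  assumes "turing_machine M" "valid_tapes (num_tapes M) (num_syms M) ts" "q \<le> num_states M"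
  shows "fst ((step M ^^ n) (q, ts)) \<le> num_states M \<and>
    valid_tapes (num_tapes M) (num_syms M) (snd ((step M ^^ n) (q, ts)))"
proof (induction n)
  case 0
  thus ?case using assms by simp
next
  case (Suc n)
  obtain q' ts' where c: "(step M ^^ n) (q, ts) = (q', ts')" by fastforce
  show ?case
    using valid_mstep[of "{..num_states M}" "num_states M" "num_tapes M" "num_syms M" "trans M" ts' q']
      valid_trans[OF assms(1)] Suc c by (simp add: step_eq_mstep)
qed

lemma valid_start:
  assumes "turing_machine M"
  shows "valid_tapes (num_tapes M) (num_syms M) (snd (start_config M x))"
  using assms by (auto simp: valid_tapes_def start_config_def turing_machine_def contents_def)

text \<open>The states of a \<open>tm\<close> are numbers, the start state being the first and the
  halting state the last. The numbering \<open>f\<close> puts \<open>q0\<close> and \<open>h\<close>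
  there and the rest of \<open>Q\<close> in between. As \<open>valid_move\<close> keeps a run inside
  \<open>Q\<close>, where \<open>f\<close> is injective, the two runs correspond step by
  step.\<close>

lemma ex_turing_machine:
  fixes \<delta> :: "'q program"
  assumes "finite Q" "q0 \<in> Q" "h \<in> Q" "q0 \<noteq> h" "k \<ge> 2" "g \<ge> 3"
    and \<delta>: "\<And>q gs. q \<in> Q \<Longrightarrow> q \<noteq> h \<Longrightarrow> length gs = k \<Longrightarrow> set gs \<subseteq> {..<g} \<Longrightarrow> valid_move Q k g (\<delta> q gs)"
  shows "\<exists>M. turing_machine M \<and> num_tapes M = k \<and>
    (\<forall>n ts ts'. valid_tapes k g ts \<longrightarrow> (mstep \<delta> h ^^ n) (q0, ts) = (h, ts') \<longrightarrow>
       (step M ^^ n) (0, ts) = (num_states M, ts'))"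
proof -
  define N where "N = card (Q - {q0, h})"
  have "finite (Q - {q0, h})" using assms(1) by simp
  then obtain f0 where f0: "bij_betw f0 (Q - {q0, h}) {0..<N}"
    unfolding N_def using ex_bij_betw_finite_nat by blast
  define f where "f = (\<lambda>q. if q = q0 then 0 else if q = h then Suc N else Suc (f0 q))"
  have f0_lt: "f0 q < N" if "q \<in> Q" "q \<noteq> q0" "q \<noteq> h" for q
    using f0 that by (force simp: bij_betw_def)
  have f_le: "f q \<le> Suc N" if "q \<in> Q" for q
    using f0_lt[OF that] by (auto simp: f_def less_imp_le)
  have f_h: "f q = Suc N \<longleftrightarrow> q = h" if "q \<in> Q" for q
    using f0_lt[OF that] assms(4) by (auto simp: f_def)
  have inj: "inj_on f Q"
  proof (rule inj_onI)
    fix a b assume ab: "a \<in> Q" "b \<in> Q" "f a = f b"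
    show "a = b"
    proof (cases "a \<in> {q0, h} \<or> b \<in> {q0, h}")
      case True
      thus ?thesis using ab assms(4) f0_lt[OF ab(1)] f0_lt[OF ab(2)]
        by (auto simp: f_def split: if_splits)
    next
      case False
      hence "f0 a = f0 b" using ab by (auto simp: f_def)
      thus ?thesis using False ab f0 by (auto simp: bij_betw_def dest!: inj_onD)
    qed
  qed
  have range: "\<exists>q\<in>Q. f q = m" if "m \<le> Suc N" for m
  proof -
    consider "m = 0" | "m = Suc N" | i where "m = Suc i" "i < N"
      using \<open>m \<le> Suc N\<close> by (metis le_neq_implies_less less_Suc_eq_0_disj Suc_less_eq)
    thus ?thesis
    proof cases
      case 3
      then obtain q where "q \<in> Q - {q0, h}" "f0 q = i"
        using f0 by (metis atLeastLessThan_iff bij_betw_iff_bijections zero_le)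
      thus ?thesis using 3 by (auto simp: f_def intro!: bexI[of _ q])
    qed (use assms in \<open>auto simp: f_def\<close>)
  qed
  define M :: tm where "M = \<lparr>num_tapes = k, num_syms = g, num_states = Suc N,
    trans = (\<lambda>m gs. apfst f (\<delta> (inv_into Q f m) gs))\<rparr>"
  have "turing_machine M"
    unfolding turing_machine_def
  proof (intro conjI allI impI)
    fix m gs assume *: "m < num_states M" "length gs = num_tapes M" "set gs \<subseteq> {..<num_syms M}"
    obtain q where q: "q \<in> Q" "f q = m" using range[of m] * by (auto simp: M_def)
    have "q \<noteq> h" using q f_h[of q] * by (auto simp: M_def)
    have "valid_move Q k g (\<delta> q gs)" using \<delta>[OF q(1) \<open>q \<noteq> h\<close>, of gs] * by (simp add: M_def)
    moreover have "inv_into Q f m = q" using q inj by auto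
    ultimately show "case trans M m gs of (q', as) \<Rightarrow> q' \<le> num_states M \<and>
        length as = num_tapes M \<and> set as \<subseteq> {..<num_syms M} \<times> {-1, 0, 1}"
      using f_le by (simp add: M_def valid_move_def case_prod_beta)
  qed (use assms in \<open>auto simp: M_def\<close>)
  have sim1: "step M (apfst f c) = apfst f (mstep \<delta> h c)" if "fst c \<in> Q" for c
  proof -
    obtain q ts where c: "c = (q, ts)" by fastforce
    have "inv_into Q f (f q) = q" using that inj c by auto
    thus ?thesis using f_h[of q] that c
      by (auto simp: step_def mstep_def M_def split: prod.splits)
  qed
  have sim: "(step M ^^ n) (0, ts) = apfst f ((mstep \<delta> h ^^ n) (q0, ts)) \<and>
      fst ((mstep \<delta> h ^^ n) (q0, ts)) \<in> Q \<and> valid_tapes k g (snd ((mstep \<delta> h ^^ n) (q0, ts)))"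
    if "valid_tapes k g ts" for n ts
  proof (induction n)
    case 0
    thus ?case using that assms(2) by (simp add: f_def)
  next
    case (Suc n)
    obtain q' ts' where c: "(mstep \<delta> h ^^ n) (q0, ts) = (q', ts')" by fastforce
    have c': "q' \<in> Q" "valid_tapes k g ts'" "(step M ^^ n) (0, ts) = apfst f (q', ts')"
      using Suc c by simp_all
    have "fst (mstep \<delta> h (q', ts')) \<in> Q \<and> valid_tapes k g (snd (mstep \<delta> h (q', ts')))"
      by (rule valid_mstep[OF \<delta> c'(2,1)])
    thus ?case using c c' sim1[of "(q', ts')"] by simp
  qed
  show ?thesis
  proof (intro exI conjI allI impI)
    fix n ts ts' assume "valid_tapes k g ts" "(mstep \<delta> h ^^ n) (q0, ts) = (h, ts')"
    thus "(step M ^^ n) (0, ts) = (num_states M, ts')"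
      using sim[of ts n] assms(4) by (simp add: M_def f_def)
  qed (use \<open>turing_machine M\<close> in \<open>auto simp: M_def\<close>)
qed

lemma contents_less: "g \<ge> 3 \<Longrightarrow> contents x i < g"
  by (simp add: contents_def)

lemma funpow_add_apply: "(f ^^ (m + n)) x = (f ^^ n) ((f ^^ m) x)"
  by (metis add.commute comp_apply funpow_add)

section \<open>Register programs and the bound on their running time\<close>

text \<open>
  Register programs read the input \<open>x\<close> through their registers: register \<open>r\<close> is a head on a read-only
  tape holding an end marker \<open>3\<close> at position \<open>0\<close> followed by \<open>x\<close>. Registers stay in the range
  \<open>0, \<dots>, length x + 1\<close>, so there are only polynomially many configurations, and a program that halts
  does so in polynomial time.
\<close>

datatype com = Skip | Inc nat | Dec nat | Emit bool | Seq com com | Test nat nat com com | Until nat nat com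

text \<open>Reading doubles as testing: within the range of a register, \<open>3\<close> is read
  exactly at the value \<open>0\<close> and the blank exactly at the largest value
  \<open>length x + 1\<close>.\<close>

definition rd :: "bool list \<Rightarrow> nat \<Rightarrow> nat" where
  "rd x v = (if v = 0 then 3 else if v \<le> length x then (if x ! (v - 1) then 2 else 1) else 0)"

fun next_coms :: "com \<Rightarrow> com list \<Rightarrow> (nat \<Rightarrow> nat) \<Rightarrow> com list" where
  "next_coms (Seq a b) K g = a # b # K"
| "next_coms (Test r e a b) K g = (if g r = e then a else b) # K"
| "next_coms (Until r e a) K g = (if g r = e then K else a # Until r e a # K)"
| "next_coms _ K g = K"

fun next_regs :: "bool list \<Rightarrow> com \<Rightarrow> (nat \<Rightarrow> nat) \<Rightarrow> nat \<Rightarrow> nat" where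
  "next_regs x (Inc r) s = s(r := if s r \<le> length x then s r + 1 else s r)"
| "next_regs x (Dec r) s = s(r := s r - 1)"
| "next_regs x _ s = s"

fun emitted :: "com \<Rightarrow> bool list" where
  "emitted (Emit b) = [b]"
| "emitted _ = []"

fun cstep :: "bool list \<Rightarrow> com list \<times> (nat \<Rightarrow> nat) \<times> bool list \<Rightarrow> com list \<times> (nat \<Rightarrow> nat) \<times> bool list" where
  "cstep x ([], s, ob) = ([], s, ob)"
| "cstep x (c # K, s, ob) = (next_coms c K (\<lambda>r. rd x (s r)), next_regs x c s, ob @ emitted c)"

text \<open>Quantifying over the remaining commands \<open>K\<close> and the earlier output makes
  executions composable. The number of steps is left open; it is bounded afterwards by counting
  configurations.\<close>

definition runs :: "bool list \<Rightarrow> com \<Rightarrow> (nat \<Rightarrow> nat) \<Rightarrow> bool list \<Rightarrow> (nat \<Rightarrow> nat) \<Rightarrow> bool" where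
  "runs x c s ob s' \<longleftrightarrow> (\<forall>K ob0. \<exists>n. (cstep x ^^ n) (c # K, s, ob0) = (K, s', ob0 @ ob))"

lemma runs_basic:
  "runs x Skip s [] s"
  "runs x (Inc r) s [] (s(r := if s r \<le> length x then s r + 1 else s r))"
  "runs x (Dec r) s [] (s(r := s r - 1))"
  "runs x (Emit b) s [b] s"
  unfolding runs_def by (auto intro!: exI[of _ "Suc 0"])

lemma runs_Seq:
  assumes "runs x a s o1 s1" "runs x b s1 o2 s2"
  shows "runs x (Seq a b) s (o1 @ o2) s2"
  unfolding runs_def
proof (intro allI)
  fix K ob0
  obtain m n where "(cstep x ^^ m) (a # b # K, s, ob0) = (b # K, s1, ob0 @ o1)"
    "(cstep x ^^ n) (b # K, s1, ob0 @ o1) = (K, s2, (ob0 @ o1) @ o2)"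
    using assms unfolding runs_def by blast
  hence "(cstep x ^^ (1 + m + n)) (Seq a b # K, s, ob0) = (K, s2, ob0 @ o1 @ o2)"
    by (simp only: funpow_add_apply) simp
  thus "\<exists>n. (cstep x ^^ n) (Seq a b # K, s, ob0) = (K, s2, ob0 @ o1 @ o2)" by blast
qed

lemma runs_Test:
  assumes "runs x (if rd x (s r) = e then a else b) s ob s'"
  shows "runs x (Test r e a b) s ob s'"
  unfolding runs_def
proof (intro allI)
  fix K ob0
  obtain m where "(cstep x ^^ m) ((if rd x (s r) = e then a else b) # K, s, ob0) = (K, s', ob0 @ ob)"
    using assms unfolding runs_def by blast
  hence "(cstep x ^^ (1 + m)) (Test r e a b # K, s, ob0) = (K, s', ob0 @ ob)"
    by (simp only: funpow_add_apply) simp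
  thus "\<exists>n. (cstep x ^^ n) (Test r e a b # K, s, ob0) = (K, s', ob0 @ ob)" by blast
qed

lemma runs_Until_stop:
  assumes "rd x (s r) = e"
  shows "runs x (Until r e a) s [] s"
  unfolding runs_def using assms by (auto intro!: exI[of _ "Suc 0"])

lemma runs_Until_step:
  assumes "rd x (s r) \<noteq> e" "runs x a s o1 s1" "runs x (Until r e a) s1 o2 s2"
  shows "runs x (Until r e a) s (o1 @ o2) s2"
  unfolding runs_def
proof (intro allI)
  fix K ob0
  obtain m n where "(cstep x ^^ m) (a # Until r e a # K, s, ob0) = (Until r e a # K, s1, ob0 @ o1)"
    "(cstep x ^^ n) (Until r e a # K, s1, ob0 @ o1) = (K, s2, (ob0 @ o1) @ o2)"
    using assms unfolding runs_def by blast
  hence "(cstep x ^^ (1 + m + n)) (Until r e a # K, s, ob0) = (K, s2, ob0 @ o1 @ o2)"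
    using assms(1) by (simp only: funpow_add_apply) simp
  thus "\<exists>n. (cstep x ^^ n) (Until r e a # K, s, ob0) = (K, s2, ob0 @ o1 @ o2)" by blast
qed

lemma runs_Until:
  assumes "\<And>i. i < n \<Longrightarrow> rd x (f i r) \<noteq> e" "rd x (f n r) = e"
    and "\<And>i. i < n \<Longrightarrow> runs x a (f i) (g i) (f (Suc i))"
  shows "runs x (Until r e a) (f 0) (concat (map g [0..<n])) (f n)"
  using assms
proof (induction n arbitrary: f g)
  case 0
  thus ?case using runs_Until_stop by simp
next
  case (Suc n)
  have "runs x (Until r e a) (f (Suc 0)) (concat (map (g \<circ> Suc) [0..<n])) (f (Suc n))"
    using Suc.IH[of "\<lambda>i. f (Suc i)" "g \<circ> Suc"] Suc.prems by (simp add: comp_def)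
  hence "runs x (Until r e a) (f 0) (g 0 @ concat (map (g \<circ> Suc) [0..<n])) (f (Suc n))"
    using Suc.prems by (intro runs_Until_step) auto
  moreover have "map g [0..<Suc n] = g 0 # map (g \<circ> Suc) [0..<n]"
    by (metis list.simps(9) map_Suc_upt map_map upt_conv_Cons zero_less_Suc)
  ultimately show ?case by simp
qed

fun com_regs :: "com \<Rightarrow> nat set" where
  "com_regs Skip = {}"
| "com_regs (Inc r) = {r}"
| "com_regs (Dec r) = {r}"
| "com_regs (Emit b) = {}"
| "com_regs (Seq a b) = com_regs a \<union> com_regs b"
| "com_regs (Test r e a b) = insert r (com_regs a \<union> com_regs b)"
| "com_regs (Until r e a) = insert r (com_regs a)"

lemma finite_com_regs: "finite (com_regs c)"
  by (induction c) auto

text \<open>The stacks of commands that can arise while \<open>c\<close> runs on top of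
  \<open>K\<close>. They form a finite set although loops are unbounded, because
  \<open>Until\<close> puts itself back onto the same stack. They become the states of the compiled
  machine.\<close>

fun conts :: "com \<Rightarrow> com list \<Rightarrow> com list set" where
  "conts (Seq a b) K = insert (Seq a b # K) (conts a (b # K) \<union> conts b K)"
| "conts (Test r e a b) K = insert (Test r e a b # K) (conts a K \<union> conts b K)"
| "conts (Until r e a) K = insert (Until r e a # K) (conts a (Until r e a # K))"
| "conts c K = {c # K}"

lemma finite_conts: "finite (conts c K)"
  by (induction c arbitrary: K) auto

lemma conts_self: "c # K \<in> conts c K"
  by (cases c) auto

lemma conts_closed: "a # L \<in> conts c K \<Longrightarrow> next_coms a L g \<in> insert K (conts c K)"
proof (induction c arbitrary: K)
  case (Seq c1 c2)
  show ?case using Seq.prems Seq.IH(1)[of "c2 # K"] Seq.IH(2)[of K] by (auto simp: conts_self)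
next
  case (Until r e c)
  show ?case using Until.prems Until.IH[of "Until r e c # K"]
    by (cases "g r = e") (auto simp: conts_self)
qed (auto simp: conts_self)

lemma conts_regs:
  assumes "L \<in> conts c K" "com_regs c \<subseteq> A" "\<Union> (com_regs ` set K) \<subseteq> A"
  shows "\<Union> (com_regs ` set L) \<subseteq> A"
  using assms
proof (induction c arbitrary: K)
  case (Seq c1 c2)
  have A: "com_regs c1 \<subseteq> A" "com_regs c2 \<subseteq> A" "\<Union> (com_regs ` set (c2 # K)) \<subseteq> A"
    using Seq.prems by auto
  show ?case
    using Seq.prems(1) Seq.IH(1)[OF _ A(1,3)] Seq.IH(2)[OF _ A(2) Seq.prems(3)] A
    unfolding conts.simps by (elim insertE UnE) simp_all
next
  case (Test r e c1 c2)
  have A: "com_regs c1 \<subseteq> A" "com_regs c2 \<subseteq> A" "r \<in> A" using Test.prems by auto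
  show ?case
    using Test.prems(1,3) Test.IH(1)[OF _ A(1) Test.prems(3)] Test.IH(2)[OF _ A(2) Test.prems(3)] A
    unfolding conts.simps by (elim insertE UnE) simp_all
next
  case (Until r e c)
  have A: "com_regs c \<subseteq> A" "\<Union> (com_regs ` set (Until r e c # K)) \<subseteq> A" using Until.prems by auto
  show ?case
    using Until.prems(1) Until.IH[OF _ A] A unfolding conts.simps by (elim insertE) simp_all
qed auto

text \<open>Pigeonhole: before the fixed point is first reached all values are different, for a
  repetition at times \<open>i < j\<close> would bring the fixed point forward by
  \<open>j - i\<close> steps.\<close>

lemma funpow_fixpoint_within_card:
  assumes "finite S" "c \<in> S" "\<And>a. a \<in> S \<Longrightarrow> f a \<in> S" "(f ^^ m) c = d" "f d = d"
  shows "(f ^^ card S) c = d"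
proof -
  define k where "k = (LEAST k. (f ^^ k) c = d)"
  have k: "(f ^^ k) c = d" unfolding k_def using assms(4) by (rule LeastI)
  have least: "(f ^^ i) c \<noteq> d" if "i < k" for i using that not_less_Least unfolding k_def by blast
  have "inj_on (\<lambda>i. (f ^^ i) c) {..<k}"
  proof (rule linorder_inj_onI)
    fix i j :: nat assume ij: "i < j" "i \<in> {..<k}" "j \<in> {..<k}"
    show "(f ^^ i) c \<noteq> (f ^^ j) c"
    proof
      assume "(f ^^ i) c = (f ^^ j) c"
      hence "(f ^^ (i + (k - j))) c = (f ^^ (j + (k - j))) c" by (simp only: funpow_add_apply)
      thus False using ij k least[of "i + (k - j)"] by simp
    qed
  qed auto
  moreover have "(f ^^ i) c \<in> S" for i using assms(2,3) by (induction i) auto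
  ultimately have "k \<le> card S" using card_inj_on_le[OF _ _ assms(1), of "\<lambda>i. (f ^^ i) c" "{..<k}"] by auto
  moreover have "(f ^^ i) d = d" for i using assms(5) by (induction i) auto
  ultimately show ?thesis using k funpow_add_apply[of k "card S - k" f c] by simp
qed

definition register_states :: "nat \<Rightarrow> nat \<Rightarrow> (nat \<Rightarrow> nat) set" where
  "register_states R B = {s. (\<forall>r<R. s r \<le> B) \<and> (\<forall>r\<ge>R. s r = 0)}"

lemma register_states_bound: "finite (register_states R B)" "card (register_states R B) \<le> (B + 1) ^ R"
proof -
  have inj: "inj_on (\<lambda>s. restrict s {..<R}) (register_states R B)"
  proof (rule inj_onI)
    fix s t assume st: "s \<in> register_states R B" "t \<in> register_states R B" "restrict s {..<R} = restrict t {..<R}"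
    have "s r = t r" for r
      using st(1,2) fun_cong[OF st(3), of r] by (cases "r < R") (auto simp: register_states_def)
    thus "s = t" by blast
  qed
  have sub: "(\<lambda>s. restrict s {..<R}) ` register_states R B \<subseteq> {..<R} \<rightarrow>\<^sub>E {..B}"
    by (auto simp: register_states_def PiE_iff split: if_splits)
  have fin: "finite ({..<R} \<rightarrow>\<^sub>E {..B})" by (simp add: finite_PiE)
  show "finite (register_states R B)" using inj sub fin by (meson finite_imageD finite_subset)
  have "card (register_states R B) \<le> card ({..<R} \<rightarrow>\<^sub>E {..B})"
    using card_inj_on_le[OF inj sub fin] .
  thus "card (register_states R B) \<le> (B + 1) ^ R" by (simp add: card_PiE)
qed

lemma cstep_done: "(cstep x ^^ n) ([], s, ob) = ([], s, ob)"
  by (induction n) auto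

text \<open>Output is written but never read, so the projection \<open>p\<close> to stack and
  registers evolves on its own within the finite set \<open>S\<close>. Once it has halted nothing
  more is emitted; so the size of \<open>S\<close> bounds the whole run, however long the output
  is.\<close>

lemma cstep_halts_within:
  assumes "(cstep x ^^ m) ([c], \<lambda>_. 0, []) = ([], s', ob)" "com_regs c \<subseteq> {..<R}"
    "card (insert [] (conts c [])) * (length x + 2) ^ R \<le> N"
  shows "(cstep x ^^ N) ([c], \<lambda>_. 0, []) = ([], s', ob)"
proof -
  define S where "S = insert [] (conts c []) \<times> register_states R (length x + 1)"
  define f where "f = (\<lambda>(K, s). case K of [] \<Rightarrow> (K, s)
    | a # L \<Rightarrow> (next_coms a L (\<lambda>r. rd x (s r)), next_regs x a s))"
  define p where "p = (\<lambda>(K :: com list, s :: nat \<Rightarrow> nat, ob :: bool list). (K, s))"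
  have "p (cstep x C) = f (p C)" for C
    by (cases "(x, C)" rule: cstep.cases) (auto simp: p_def f_def)
  hence pf: "p ((cstep x ^^ i) C) = (f ^^ i) (p C)" for i C by (induction i) auto
  have fin: "finite S" unfolding S_def by (simp add: finite_conts register_states_bound)
  have card: "card S \<le> N"
    using order_trans[OF mult_le_mono2[OF register_states_bound(2)[of R "length x + 1"]], of "card (insert [] (conts c []))" N]
      assms(3) unfolding S_def card_cartesian_product by simp
  have start: "([c], \<lambda>_. 0) \<in> S" by (auto simp: S_def conts_self register_states_def)
  have closed: "f C \<in> S" if "C \<in> S" for C
  proof (cases "fst C")
    case Nil
    thus ?thesis using that by (auto simp: f_def split: prod.splits)
  next
    case (Cons a L)
    then obtain s where C: "C = (a # L, s)" by (cases C) auto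
    have aL: "a # L \<in> conts c []" using that by (auto simp: S_def C)
    have "com_regs a \<subseteq> {..<R}" using conts_regs[OF aL assms(2)] by auto
    hence "next_regs x a s \<in> register_states R (length x + 1)"
      using that by (cases a) (auto simp: S_def C register_states_def)
    thus ?thesis using conts_closed[OF aL] by (auto simp: S_def f_def C)
  qed
  have "(f ^^ m) ([c], \<lambda>_. 0) = ([], s')"
    using pf[of m "([c], \<lambda>_. 0, [])"] assms(1) by (simp add: p_def)
  hence "(f ^^ card S) ([c], \<lambda>_. 0) = ([], s')"
    using closed by (intro funpow_fixpoint_within_card[OF fin start]) (auto simp: f_def)
  hence "p ((cstep x ^^ card S) ([c], \<lambda>_. 0, [])) = ([], s')" by (simp add: pf) (simp add: p_def)
  then obtain ob' where ob': "(cstep x ^^ card S) ([c], \<lambda>_. 0, []) = ([], s', ob')"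
    by (cases "(cstep x ^^ card S) ([c], \<lambda>_. 0, [])") (auto simp: p_def)
  hence late: "(cstep x ^^ k) ([c], \<lambda>_. 0, []) = ([], s', ob')" if "card S \<le> k" for k
    using funpow_add_apply[of "card S" "k - card S" "cstep x" "([c], \<lambda>_. 0, [])"] that ob'
    by (simp add: cstep_done)
  have "(cstep x ^^ (m + card S)) ([c], \<lambda>_. 0, []) = ([], s', ob)"
    unfolding funpow_add_apply assms(1) cstep_done ..
  hence "ob' = ob" using late[of "m + card S"] by simp
  thus ?thesis using late[OF card] by simp
qed

text \<open>
  Besides the output itself, the final position of the output head is prescribed: it is what makes
  such functions composable.
\<close>

definition polytime_app :: "(bool list \<Rightarrow> bool list) \<Rightarrow> bool" where
  "polytime_app f \<longleftrightarrow> (\<exists>M (b :: nat poly). turing_machine M \<and>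
    (\<forall>x. \<exists>ts. (step M ^^ poly b (length x)) (start_config M x) = (num_states M, ts) \<and>
      ts ! 1 = (contents (f x), int (length (f x)))))"

lemma polytime_app_polytime:
  assumes "polytime_app f"
  shows "polytime f"
proof -
  obtain M and b :: "nat poly" where M: "turing_machine M"
    "\<And>x. \<exists>ts. (step M ^^ poly b (length x)) (start_config M x) = (num_states M, ts) \<and>
      ts ! 1 = (contents (f x), int (length (f x)))"
    using assms unfolding polytime_app_def by blast
  have "case (step M ^^ poly b (length x)) (start_config M x) of (q, ts) \<Rightarrow>
      q = num_states M \<and> fst (ts ! 1) = contents (f x)" for x
    using M(2)[of x] by auto
  thus ?thesis unfolding polytime_def using M(1) by blast
qed

lemma polytime_appI:
  fixes \<delta> :: "'q program" and b :: "nat poly"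
  assumes "finite Q" "q0 \<in> Q" "h \<in> Q" "q0 \<noteq> h" "k \<ge> 2" "g \<ge> 3"
    and "\<And>q gs. q \<in> Q \<Longrightarrow> q \<noteq> h \<Longrightarrow> length gs = k \<Longrightarrow> set gs \<subseteq> {..<g} \<Longrightarrow> valid_move Q k g (\<delta> q gs)"
    and run: "\<And>x. \<exists>n ts. n \<le> poly b (length x) \<and>
      (mstep \<delta> h ^^ n) (q0, (contents x, 0) # replicate (k - 1) (contents [], 0)) = (h, ts) \<and>
      ts ! 1 = (contents (f x), int (length (f x)))"
  shows "polytime_app f"
proof -
  obtain M where M: "turing_machine M" "num_tapes M = k"
    "\<And>n ts ts'. valid_tapes k g ts \<Longrightarrow> (mstep \<delta> h ^^ n) (q0, ts) = (h, ts') \<Longrightarrow>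
       (step M ^^ n) (0, ts) = (num_states M, ts')"
    using ex_turing_machine[of Q q0 h k g \<delta>, OF assms(1-7)] by blast
  have "\<exists>ts. (step M ^^ poly b (length x)) (start_config M x) = (num_states M, ts) \<and>
      ts ! 1 = (contents (f x), int (length (f x)))" for x
  proof -
    define ts0 where "ts0 = (contents x, 0) # replicate (k - 1) (contents [], 0 :: int)"
    have start: "start_config M x = (0, ts0)" by (simp add: start_config_def M(2) ts0_def)
    have valid: "valid_tapes k g ts0"
      using assms(5,6) by (auto simp: valid_tapes_def ts0_def contents_less)
    obtain n ts where n: "n \<le> poly b (length x)" "(mstep \<delta> h ^^ n) (q0, ts0) = (h, ts)"
      "ts ! 1 = (contents (f x), int (length (f x)))" using run[of x] unfolding ts0_def by blast
    show ?thesis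
      using M(3)[OF valid mstep_pow_mono[OF n(2,1)]] n(3) start by auto
  qed
  thus ?thesis unfolding polytime_app_def using M(1) by blast
qed

definition hold :: "nat list \<Rightarrow> (nat \<times> int) list" where
  "hold gs = map (\<lambda>g. (g, 0)) gs"

lemma act_hold [simp]: "act (read_tape t, 0) t = t"
  by (cases t) (simp add: act_def read_tape_def)

lemma act_hold_list [simp]: "map2 act (hold (map read_tape ts)) ts = ts"
  by (induction ts) (auto simp: hold_def)

lemma act_hold_update:
  "map2 act ((hold (map read_tape ts))[i := a]) ts = (if i < length ts then ts[i := act a (ts ! i)] else ts)"
proof (cases "i < length ts")
  case True
  thus ?thesis by (intro nth_equalityI) (auto simp: hold_def nth_list_update)
next
  case False
  hence "(hold (map read_tape ts))[i := a] = hold (map read_tape ts)"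
    by (intro list_update_beyond) (simp add: hold_def)
  thus ?thesis using False by simp
qed

lemma length_hold [simp]: "length (hold gs) = length gs"
  by (simp add: hold_def)


subsection \<open>Compiling register programs\<close>

datatype control = Begin | Copy | Rewind | Run "com list"

text \<open>Register \<open>r\<close> lives on tape \<open>r + 2\<close>, behind the input and the
  output tape. A head that reads the blank stands at \<open>length x + 1\<close>, one that reads
  \<open>3\<close> at \<open>0\<close>; there \<open>Inc\<close> and \<open>Dec\<close> leave it in
  place, as \<open>next_regs\<close> demands.\<close>

fun com_moves :: "com \<Rightarrow> nat list \<Rightarrow> (nat \<times> int) list" where
  "com_moves (Inc r) gs = (hold gs)[r + 2 := (gs ! (r + 2), if gs ! (r + 2) = 0 then 0 else 1)]"
| "com_moves (Dec r) gs = (hold gs)[r + 2 := (gs ! (r + 2), if gs ! (r + 2) = 3 then 0 else -1)]"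
| "com_moves (Emit b) gs = (hold gs)[1 := (if b then 2 else 1, 1)]"
| "com_moves _ gs = hold gs"

text \<open>The registers move independently, so each of them first gets its own copy of the input.
  \<open>Rewind\<close> then takes all register heads back to the marker, that is, to the value
  \<open>0\<close>; as they move together, it is enough to watch tape \<open>2\<close>.\<close>

fun com_program :: "com \<Rightarrow> nat \<Rightarrow> control program" where
  "com_program c R Begin gs = (Copy, (gs ! 0, 0) # (gs ! 1, 0) # replicate R (3, 1))"
| "com_program c R Copy gs = (if gs ! 0 = 0
     then (Rewind, (gs ! 0, 0) # (gs ! 1, 0) # map (\<lambda>g. (g, -1)) (drop 2 gs))
     else (Copy, (gs ! 0, 1) # (gs ! 1, 0) # replicate R (gs ! 0, 1)))"
| "com_program c R Rewind gs = (if gs ! 2 = 3 then (Run [c], hold gs)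
     else (Rewind, (gs ! 0, 0) # (gs ! 1, 0) # map (\<lambda>g. (g, -1)) (drop 2 gs)))"
| "com_program c R (Run []) gs = (Run [], hold gs)"
| "com_program c R (Run (a # K)) gs = (Run (next_coms a K (\<lambda>r. gs ! (r + 2))), com_moves a gs)"

definition com_controls :: "com \<Rightarrow> control set" where
  "com_controls c = {Begin, Copy, Rewind} \<union> Run ` insert [] (conts c [])"

lemma set_list_update_subset: "set xs \<subseteq> A \<Longrightarrow> a \<in> A \<Longrightarrow> set (xs[i := a]) \<subseteq> A"
  using set_update_subset_insert[of xs i a] by auto

lemma com_moves_valid:
  assumes "length gs = R + 2" "set gs \<subseteq> {..<4}" "com_regs a \<subseteq> {..<R}"
  shows "length (com_moves a gs) = R + 2" "set (com_moves a gs) \<subseteq> {..<4} \<times> {-1, 0, 1}"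
proof -
  have nth: "gs ! i < 4" if "i < R + 2" for i using assms(1,2) that by (metis lessThan_iff nth_mem subsetD)
  have hold: "set (hold gs) \<subseteq> {..<4} \<times> {-1, 0, 1}" using assms(2) by (auto simp: hold_def)
  show "length (com_moves a gs) = R + 2" using assms(1) by (cases a) auto
  show "set (com_moves a gs) \<subseteq> {..<4} \<times> {-1, 0, 1}"
    using assms(3) nth by (cases a) (simp_all add: hold set_list_update_subset[OF hold])
qed

lemma com_program_valid:
  assumes "com_regs c \<subseteq> {..<R}" "q \<in> com_controls c" "q \<noteq> Run []" "length gs = R + 2" "set gs \<subseteq> {..<4}"
  shows "valid_move (com_controls c) (R + 2) 4 (com_program c R q gs)"
proof -
  have nth: "gs ! 0 < 4" "gs ! 1 < 4"
    using assms(4,5) nth_mem[of 0 gs] nth_mem[of 1 gs] by (simp_all add: subset_iff)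
  have drop: "g < 4" if "g \<in> set (drop 2 gs)" for g using assms(5) that by (auto dest: in_set_dropD)
  have hold: "set (hold gs) \<subseteq> {..<4} \<times> {-1, 0, 1}" using assms(5) by (auto simp: hold_def)
  show ?thesis
  proof (cases q)
    case (Run L)
    then obtain a K where L: "L = a # K" "a # K \<in> conts c []"
      using assms(2,3) by (cases L) (auto simp: com_controls_def)
    have "com_regs a \<subseteq> {..<R}" using conts_regs[OF L(2) assms(1)] by auto
    thus ?thesis
      using com_moves_valid[OF assms(4,5), of a] conts_closed[OF L(2)]
      by (auto simp: valid_move_def Run L com_controls_def)
  qed (use nth drop hold assms(4) in \<open>auto simp: valid_move_def com_controls_def conts_self\<close>)
qed

text \<open>The parameter \<open>n\<close> is the number of symbols copied so far, so that the
  unfinished tapes of the copying phase are covered as well.\<close>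

definition reg_tape :: "bool list \<Rightarrow> nat \<Rightarrow> int \<Rightarrow> nat" where
  "reg_tape x n i = (if 0 \<le> i \<and> i \<le> int n then rd x (nat i) else 0)"

definition com_tapes :: "nat \<Rightarrow> bool list \<Rightarrow> (nat \<Rightarrow> nat) \<Rightarrow> bool list \<Rightarrow> tape list" where
  "com_tapes R x s ob = (contents x, int (length x)) # (contents ob, int (length ob)) #
     map (\<lambda>r. (reg_tape x (length x), int (s r))) [0..<R]"

lemma contents_append:
  "(contents ob)(int (length ob) := if b then 2 else 1) = contents (ob @ [b])"
  by (rule ext) (auto simp: contents_def nth_append)

lemma rd_zero: "rd x v = 0 \<longleftrightarrow> length x < v"
  by (auto simp: rd_def)

lemma rd_three: "rd x v = 3 \<longleftrightarrow> v = 0"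
  by (auto simp: rd_def)

lemma com_tapes_reads:
  assumes "r < R"
  shows "map read_tape (com_tapes R x s ob) ! (r + 2) = rd x (s r)"
  using assms by (simp add: com_tapes_def read_tape_def reg_tape_def rd_def)

lemma com_tapes_update:
  assumes "r < R"
  shows "(com_tapes R x s ob)[Suc (Suc r) := (reg_tape x (length x), int v)] = com_tapes R x (s(r := v)) ob"
  using assms by (simp add: com_tapes_def) (auto intro!: nth_equalityI simp: nth_list_update)

lemma com_program_sim:
  assumes "com_regs a \<subseteq> {..<R}"
  shows "mstep (com_program c R) (Run []) (Run (a # K), com_tapes R x s ob) =
    (case cstep x (a # K, s, ob) of (K', s', ob') \<Rightarrow> (Run K', com_tapes R x s' ob'))"
proof -
  let ?ts = "com_tapes R x s ob"
  let ?gs = "map read_tape ?ts"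
  have len: "length ?ts = R + 2" by (simp add: com_tapes_def)
  have reads: "?gs ! (r + 2) = rd x (s r)" if "r < R" for r by (rule com_tapes_reads[OF that])
  have "next_coms a K (\<lambda>r. ?gs ! (r + 2)) = next_coms a K (\<lambda>r. rd x (s r))"
    using assms reads by (cases a) auto
  moreover have "map2 act (com_moves a ?gs) ?ts = com_tapes R x (next_regs x a s) (ob @ emitted a)"
  proof (cases a)
    case (Inc r)
    hence "r < R" using assms by simp
    moreover have "act (rd x (s r), d) (?ts ! Suc (Suc r)) = (reg_tape x (length x), int (s r) + d)" for d
      using \<open>r < R\<close> by (auto simp: com_tapes_def act_def reg_tape_def rd_def)
    ultimately show ?thesis
      using reads[of r] len com_tapes_update[of r R x s ob "s r"] com_tapes_update[of r R x s ob "Suc (s r)"]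
      by (auto simp: Inc act_hold_update rd_zero algebra_simps)
  next
    case (Dec r)
    hence "r < R" using assms by simp
    moreover have "act (rd x (s r), d) (?ts ! Suc (Suc r)) = (reg_tape x (length x), int (s r) + d)" for d
      using \<open>r < R\<close> by (auto simp: com_tapes_def act_def reg_tape_def rd_def)
    ultimately show ?thesis
      using reads[of r] len com_tapes_update[of r R x s ob "s r"] com_tapes_update[of r R x s ob "s r - 1"]
      by (auto simp: Dec act_hold_update rd_three of_nat_diff Suc_le_eq)
  next
    case (Emit b)
    have "act (if b then 2 else 1, 1) (?ts ! 1) = (contents (ob @ [b]), int (length (ob @ [b])))"
      using contents_append[of ob b] by (simp add: com_tapes_def act_def)
    moreover have "?ts[1 := (contents (ob @ [b]), int (length (ob @ [b])))] = com_tapes R x s (ob @ [b])"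
      by (simp add: com_tapes_def)
    ultimately show ?thesis using len by (simp add: Emit act_hold_update)
  qed auto
  ultimately show ?thesis by (simp add: mstep_def)
qed

lemma com_program_run:
  assumes "com_regs c \<subseteq> {..<R}" "(cstep x ^^ n) ([c], s, []) = (K, s', ob)"
  shows "(mstep (com_program c R) (Run []) ^^ n) (Run [c], com_tapes R x s []) = (Run K, com_tapes R x s' ob)
    \<and> K \<in> insert [] (conts c [])"
  using assms(2)
proof (induction n arbitrary: K s' ob)
  case 0
  thus ?case by (auto simp: conts_self)
next
  case (Suc n)
  obtain L t ob1 where L: "(cstep x ^^ n) ([c], s, []) = (L, t, ob1)" using prod_cases3 by blast
  note IH = Suc.IH[OF L]
  show ?case
  proof (cases L)
    case Nil
    thus ?thesis using IH Suc.prems L by simp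
  next
    case (Cons a L')
    hence mem: "a # L' \<in> conts c []" using IH by simp
    have "com_regs a \<subseteq> {..<R}" using conts_regs[OF mem assms(1)] by auto
    thus ?thesis using IH Suc.prems L Cons com_program_sim[of a R c L' x t ob1] conts_closed[OF mem] by auto
  qed
qed

lemma com_setup:
  assumes "R \<ge> 1"
  shows "(mstep (com_program c R) (Run []) ^^ (2 * length x + 3))
      (Begin, (contents x, 0) # replicate (R + 1) (contents [], 0)) = (Run [c], com_tapes R x (\<lambda>_. 0) [])"
proof -
  let ?m = "mstep (com_program c R) (Run [])"
  let ?n = "length x"
  define A where "A = (\<lambda>i j. (contents x, int i) # (contents [], 0) # replicate R (reg_tape x i, j :: int))"
  have upd: "(reg_tape x i)(int i + 1 := rd x (Suc i)) = reg_tape x (Suc i)" for i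
    by (rule ext) (auto simp: reg_tape_def nat_add_distrib intro: arg_cong[where f = "rd x"])
  have same: "(reg_tape x i)(j := reg_tape x i j) = reg_tape x i" for i j by auto
  have 1: "?m (Begin, (contents x, 0) # replicate (R + 1) (contents [], 0)) = (Copy, A 0 1)"
  proof -
    have "(contents [])(0 := 3) = reg_tape x 0" by (rule ext) (auto simp: contents_def reg_tape_def rd_def)
    thus ?thesis by (simp add: mstep_def A_def act_def read_tape_def zip_replicate)
  qed
  have copy: "?m (Copy, A i (int i + 1)) = (Copy, A (Suc i) (int (Suc i) + 1))" if "i < ?n" for i
  proof -
    have "contents x (int i) = rd x (Suc i)" "rd x (Suc i) \<noteq> 0" using that by (auto simp: contents_def rd_def)
    moreover from this have "(contents x)(int i := rd x (Suc i)) = contents x" by (metis fun_upd_triv)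
    ultimately show ?thesis using upd[of i]
      by (simp add: mstep_def A_def act_def read_tape_def zip_replicate algebra_simps)
  qed
  have 2: "(?m ^^ i) (Copy, A 0 1) = (Copy, A i (int i + 1))" if "i \<le> ?n" for i
    using that by (induction i) (auto simp: copy[simplified])
  have 3: "?m (Copy, A ?n (int ?n + 1)) = (Rewind, A ?n (int ?n))"
  proof -
    have "contents x (int ?n) = 0" by (simp add: contents_def)
    moreover from this have "(contents x)(int ?n := 0) = contents x" by (metis fun_upd_triv)
    moreover have "contents [] 0 = 0" "(contents [])(0 := 0) = contents []" by (auto simp: contents_def)
    ultimately show ?thesis
      using same[of ?n] by (simp add: mstep_def A_def act_def read_tape_def zip_replicate)
  qed
  have rew: "?m (Rewind, A ?n (int (Suc j))) = (Rewind, A ?n (int j))" for j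
  proof -
    have "reg_tape x ?n (int (Suc j)) \<noteq> 3" by (auto simp: reg_tape_def rd_def)
    thus ?thesis using assms same[of ?n "int (Suc j)"]
      by (simp add: mstep_def A_def act_def read_tape_def zip_replicate)
  qed
  have 4: "(?m ^^ i) (Rewind, A ?n (int (i + j))) = (Rewind, A ?n (int j))" for i j
  proof (induction i arbitrary: j)
    case (Suc i)
    show ?case using Suc[of "Suc j"] rew[of j] by simp
  qed simp
  have "reg_tape x ?n 0 = 3" by (simp add: reg_tape_def rd_def)
  hence "?m (Rewind, A ?n 0) = (Run [c], A ?n 0)"
    using assms same[of ?n 0] by (simp add: mstep_def A_def read_tape_def)
      (simp add: hold_def zip_replicate act_def)
  moreover have "A ?n 0 = com_tapes R x (\<lambda>_. 0) []"
    by (simp add: A_def com_tapes_def map_replicate_const)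
  \<comment> \<open>One step writes the markers, \<open>?n\<close> steps copy, one turns around,
    \<open>?n\<close> steps go back, and one enters the program.\<close>
  moreover have "2 * ?n + 3 = 1 + ?n + 1 + ?n + 1" by simp
  ultimately show ?thesis
    using 1 2[of ?n] 3 4[of ?n 0] by (simp only: funpow_add_apply One_nat_def funpow.simps comp_apply id_apply add_0_right of_nat_0)
qed

theorem polytime_app_com:
  assumes "\<And>x. \<exists>s. runs x c (\<lambda>_. 0) (f x) s"
  shows "polytime_app f"
proof -
  obtain R where R: "R \<ge> 1" "com_regs c \<subseteq> {..<R}"
    using finite_com_regs[of c] finite_nat_bounded
    by (metis One_nat_def le_add1 lessThan_subset_iff max.cobounded1 max.cobounded2 order_trans)
  define C where "C = card (insert [] (conts c []))"
  \<comment> \<open>After \<open>2 * n + 3\<close> steps of preparation there are at most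
    \<open>C * (n + 2) ^ R\<close> configurations: \<open>C\<close> stacks, and \<open>n + 2\<close>
    values for each of \<open>R\<close> registers.\<close>
  define b :: "nat poly" where "b = [:3, 2:] + smult C ([:2, 1:] ^ R)"
  have b: "poly b n = 2 * n + 3 + C * (n + 2) ^ R" for n
    by (simp add: b_def algebra_simps)
  show ?thesis
  proof (rule polytime_appI[where Q = "com_controls c" and \<delta> = "com_program c R" and k = "R + 2" and g = 4
        and h = "Run []" and ?q0.0 = Begin and b = b])
    fix x
    obtain s where "runs x c (\<lambda>_. 0) (f x) s" using assms by blast
    then obtain m where "(cstep x ^^ m) ([c], \<lambda>_. 0, []) = ([], s, f x)"
      unfolding runs_def by (metis append_Nil)
    hence "(cstep x ^^ (C * (length x + 2) ^ R)) ([c], \<lambda>_. 0, []) = ([], s, f x)"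
      by (rule cstep_halts_within[OF _ R(2)]) (simp only: C_def order_refl)
    hence "(mstep (com_program c R) (Run []) ^^ (2 * length x + 3 + C * (length x + 2) ^ R))
        (Begin, (contents x, 0) # replicate (R + 1) (contents [], 0)) = (Run [], com_tapes R x s (f x))"
      using com_setup[OF R(1), of x c] com_program_run[OF R(2), where x = x and s = "\<lambda>_. 0"]
      by (simp only: funpow_add_apply)
    thus "\<exists>n ts. n \<le> poly b (length x) \<and> (mstep (com_program c R) (Run []) ^^ n)
        (Begin, (contents x, 0) # replicate (R + 2 - 1) (contents [], 0)) = (Run [], ts) \<and>
        ts ! 1 = (contents (f x), int (length (f x)))"
      by (intro exI conjI[rotated]) (auto simp: b com_tapes_def)
  next
    show "finite (com_controls c)" by (simp add: com_controls_def finite_conts)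
  qed (use R com_program_valid in \<open>auto simp: com_controls_def\<close>)
qed

subsection \<open>Composition\<close>

lemma poly_nat_mono: "x \<le> y \<Longrightarrow> poly p x \<le> poly p (y :: nat)"
  by (induction p) (auto intro: add_mono mult_mono)

text \<open>A head moves by at most one cell per step. This bounds the length of an output by the
  running time, and later keeps the heads inside a grid of bounded width.\<close>

lemma head_bound:
  assumes "turing_machine M" "t < num_tapes M"
  shows "\<bar>snd (snd ((step M ^^ n) (start_config M x)) ! t)\<bar> \<le> int n"
proof (induction n)
  case 0
  thus ?case using assms(2) by (cases t) (auto simp: start_config_def)
next
  case (Suc n)
  obtain q ts where c: "(step M ^^ n) (start_config M x) = (q, ts)" by fastforce
  have v: "q \<le> num_states M" "valid_tapes (num_tapes M) (num_syms M) ts"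
    using valid_steps[OF assms(1) valid_start[OF assms(1), of x], of 0 n] c
    by (simp_all add: start_config_def)
  show ?case
  proof (cases "q = num_states M")
    case True
    hence "step M (q, ts) = (q, ts)" by (simp add: step_def)
    thus ?thesis using Suc c by simp
  next
    case False
    obtain q' as where d: "trans M q (map read_tape ts) = (q', as)" by fastforce
    have as: "length as = num_tapes M" "set as \<subseteq> {..<num_syms M} \<times> {-1, 0, 1}"
      using valid_trans[OF assms(1) _ False valid_reads[OF v(2)]] v(1) d by (auto simp: valid_move_def)
    hence "as ! t \<in> {..<num_syms M} \<times> {-1, 0, 1}" using assms(2) subsetD[OF as(2) nth_mem[of t as]] by simp
    hence "\<bar>snd (as ! t)\<bar> \<le> 1" by auto
    moreover have "snd (snd (step M (q, ts)) ! t) = snd (ts ! t) + snd (as ! t)"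
      using False d as(1) v(2) assms(2) by (simp add: step_def act_def valid_tapes_def)
    ultimately show ?thesis using Suc c by simp
  qed
qed

datatype comp_control = First nat | Back | Second nat

text \<open>
  Tape \<open>2\<close> is the output tape of the first and the input tape of the second machine; tape \<open>1\<close> is the
  output tape of the second one. The remaining tapes of both machines follow.
\<close>

definition comp_reads1 :: "nat \<Rightarrow> nat list \<Rightarrow> nat list" where
  "comp_reads1 k gs = gs ! 0 # gs ! 2 # take (k - 2) (drop 3 gs)"

definition comp_reads2 :: "nat \<Rightarrow> nat list \<Rightarrow> nat list" where
  "comp_reads2 k gs = gs ! 2 # gs ! 1 # drop (k + 1) gs"

text \<open>The common alphabet is the larger of the two, and nothing is known about
  \<open>trans M1\<close> or \<open>trans M2\<close> on foreign symbols. The guards replace such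
  transitions by arbitrary legal ones, which the simulated runs never use. In \<open>Back\<close>,
  the middle head looks for the blank to the left of the intermediate result.\<close>

definition comp_program :: "tm \<Rightarrow> tm \<Rightarrow> comp_control program" where
  "comp_program M1 M2 q gs = (let k = num_tapes M1 in case q of
     First i \<Rightarrow>
       if i = num_states M1 \<or> \<not> set (comp_reads1 k gs) \<subseteq> {..<num_syms M1}
       then (Back, (hold gs)[2 := (gs ! 2, -1)])
       else (case trans M1 i (comp_reads1 k gs) of (i', as) \<Rightarrow>
         (First i', as ! 0 # (gs ! 1, 0) # as ! 1 # drop 2 as @ hold (drop (k + 1) gs)))
   | Back \<Rightarrow>
       if gs ! 2 = 0 then (Second 0, (hold gs)[2 := (gs ! 2, 1)])
       else (Back, (hold gs)[2 := (gs ! 2, -1)])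
   | Second i \<Rightarrow>
       if i = num_states M2 \<or> \<not> set (comp_reads2 k gs) \<subseteq> {..<num_syms M2}
       then (Second (num_states M2), hold gs)
       else (case trans M2 i (comp_reads2 k gs) of (i', as) \<Rightarrow>
         (Second i', (gs ! 0, 0) # as ! 1 # as ! 0 # hold (take (k - 2) (drop 3 gs)) @ drop 2 as)))"

definition comp_controls :: "tm \<Rightarrow> tm \<Rightarrow> comp_control set" where
  "comp_controls M1 M2 = insert Back (First ` {..num_states M1} \<union> Second ` {..num_states M2})"

lemma comp_program_valid:
  assumes "turing_machine M1" "turing_machine M2" "q \<in> comp_controls M1 M2"
    "length gs = num_tapes M1 + num_tapes M2 - 1" "set gs \<subseteq> {..<max (num_syms M1) (num_syms M2)}"
  shows "valid_move (comp_controls M1 M2) (num_tapes M1 + num_tapes M2 - 1)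
    (max (num_syms M1) (num_syms M2)) (comp_program M1 M2 q gs)"
proof -
  let ?k1 = "num_tapes M1" and ?k2 = "num_tapes M2"
  let ?g = "max (num_syms M1) (num_syms M2)"
  have k: "?k1 \<ge> 2" "?k2 \<ge> 2" "num_syms M1 \<ge> 3" using assms(1,2) by (auto simp: turing_machine_def)
  have nth: "gs ! i < ?g" if "i < ?k1 + ?k2 - 1" for i
    using assms(4,5) that by (metis lessThan_iff nth_mem subsetD)
  have hold: "set (hold gs') \<subseteq> {..<?g} \<times> {-1, 0, 1}" if "set gs' \<subseteq> set gs" for gs'
    using assms(5) that by (auto simp: hold_def)
  show ?thesis
  proof (cases q)
    case (First i)
    show ?thesis
    proof (cases "i = num_states M1 \<or> \<not> set (comp_reads1 ?k1 gs) \<subseteq> {..<num_syms M1}")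
      case True
      thus ?thesis using First assms(4) nth k
        by (simp add: comp_program_def valid_move_def comp_controls_def set_list_update_subset[OF hold])
    next
      case False
      obtain i' as where t: "trans M1 i (comp_reads1 ?k1 gs) = (i', as)" by fastforce
      have "valid_move {..num_states M1} ?k1 (num_syms M1) (i', as)"
        unfolding t[symmetric] using assms(3,4) First False k
        by (intro valid_trans[OF assms(1)]) (auto simp: comp_controls_def comp_reads1_def)
      hence as: "i' \<le> num_states M1" "length as = ?k1" "set as \<subseteq> {..<num_syms M1} \<times> {-1, 0, 1}"
        by (auto simp: valid_move_def)
      hence as': "set as \<subseteq> {..<?g} \<times> {-1, 0, 1}" by fastforce
      hence as01: "as ! 0 \<in> {..<?g} \<times> {-1, 0, 1}" "as ! 1 \<in> {..<?g} \<times> {-1, 0, 1}"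
        using subsetD[OF as' nth_mem[of 0 as]] subsetD[OF as' nth_mem[of 1 as]] as(2) k by simp_all
      have "set (drop 2 as) \<subseteq> {..<?g} \<times> {-1, 0, 1}" by (rule order_trans[OF set_drop_subset as'])
      moreover have "set (hold (drop (?k1 + 1) gs)) \<subseteq> {..<?g} \<times> {-1, 0, 1}"
        by (intro hold set_drop_subset)
      ultimately show ?thesis
        using First False t as as01 nth[of 1] assms(4) k
        by (simp add: comp_program_def Let_def valid_move_def comp_controls_def)
    qed
  next
    case Back
    thus ?thesis using assms(4) nth k
      by (cases "gs ! 2 = 0")
        (simp_all add: comp_program_def valid_move_def comp_controls_def set_list_update_subset[OF hold])
  next
    case (Second i)
    show ?thesis
    proof (cases "i = num_states M2 \<or> \<not> set (comp_reads2 ?k1 gs) \<subseteq> {..<num_syms M2}")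
      case True
      thus ?thesis using Second assms(4) nth k
        by (simp add: comp_program_def valid_move_def comp_controls_def hold)
    next
      case False
      obtain i' as where t: "trans M2 i (comp_reads2 ?k1 gs) = (i', as)" by fastforce
      have "valid_move {..num_states M2} ?k2 (num_syms M2) (i', as)"
        unfolding t[symmetric] using assms(3,4) Second False k
        by (intro valid_trans[OF assms(2)]) (auto simp: comp_controls_def comp_reads2_def)
      hence as: "i' \<le> num_states M2" "length as = ?k2" "set as \<subseteq> {..<num_syms M2} \<times> {-1, 0, 1}"
        by (auto simp: valid_move_def)
      hence as': "set as \<subseteq> {..<?g} \<times> {-1, 0, 1}" by fastforce
      hence as01: "as ! 0 \<in> {..<?g} \<times> {-1, 0, 1}" "as ! 1 \<in> {..<?g} \<times> {-1, 0, 1}"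
        using subsetD[OF as' nth_mem[of 0 as]] subsetD[OF as' nth_mem[of 1 as]] as(2) k by simp_all
      have "set (drop 2 as) \<subseteq> {..<?g} \<times> {-1, 0, 1}" by (rule order_trans[OF set_drop_subset as'])
      moreover have "set (hold (take (?k1 - 2) (drop 3 gs))) \<subseteq> {..<?g} \<times> {-1, 0, 1}"
        by (intro hold) (meson order_trans set_drop_subset set_take_subset)
      ultimately show ?thesis
        using Second False t as as01 nth[of 0] assms(4) k
        by (simp add: comp_program_def Let_def valid_move_def comp_controls_def)
    qed
  qed
qed

text \<open>A halted machine stands still, whereas the simulating program goes on to its next phase.
  Hence \<open>n\<close> steps of the machine correspond to some \<open>j \<le> n\<close> steps of
  the program.\<close>

lemma steps_simulation:
  assumes "\<And>c d. sim c d \<Longrightarrow> fst c \<noteq> num_states M \<Longrightarrow> sim (step M c) (f d)" "sim c d"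
  shows "\<exists>j\<le>n. sim ((step M ^^ n) c) ((f ^^ j) d)"
proof (induction n)
  case (Suc n)
  then obtain j where j: "j \<le> n" "sim ((step M ^^ n) c) ((f ^^ j) d)" by blast
  show ?case
  proof (cases "fst ((step M ^^ n) c) = num_states M")
    case True
    hence "step M ((step M ^^ n) c) = (step M ^^ n) c" by (auto simp: step_def split: prod.splits)
    thus ?thesis using j by (auto intro!: exI[of _ j])
  next
    case False
    thus ?thesis using j assms(1)[OF j(2) False] by (auto intro!: exI[of _ "Suc j"])
  qed
qed (use assms in auto)

lemma comp_sim1:
  assumes M: "turing_machine M1" and v: "valid_tapes (num_tapes M1) (num_syms M1) (t # m # A)"
    and i: "i < num_states M1"
  obtains i' t' m' A' where "step M1 (i, t # m # A) = (i', t' # m' # A')" "i' \<le> num_states M1"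
    "valid_tapes (num_tapes M1) (num_syms M1) (t' # m' # A')"
    "mstep (comp_program M1 M2) h (First i, t # u # m # A @ B) =
      (if h = First i then (First i, t # u # m # A @ B) else (First i', t' # u # m' # A' @ B))"
proof -
  let ?k = "num_tapes M1"
  have k: "length A = ?k - 2" "?k \<ge> 2" using v by (auto simp: valid_tapes_def)
  let ?gs = "map read_tape (t # m # A)"
  have reads: "comp_reads1 ?k (map read_tape (t # u # m # A @ B)) = ?gs"
    using k by (simp add: comp_reads1_def)
  obtain i' as where tr: "trans M1 i ?gs = (i', as)" by fastforce
  have gs: "length ?gs = ?k" "set ?gs \<subseteq> {..<num_syms M1}" using valid_reads[OF v] by auto
  have vm: "valid_move {..num_states M1} ?k (num_syms M1) (i', as)"
    unfolding tr[symmetric] using i gs by (intro valid_trans[OF M]) auto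
  then obtain a b as' where as: "as = a # b # as'" "length as' = length A"
    using k by (cases as; cases "tl as") (auto simp: valid_move_def)
  have step: "step M1 (i, t # m # A) = (i', act a t # act b m # map2 act as' A)"
    using i tr as by (simp add: step_def)
  show thesis
  proof (rule that[OF step])
    show "i' \<le> num_states M1" using vm by (simp add: valid_move_def)
    show "valid_tapes ?k (num_syms M1) (act a t # act b m # map2 act as' A)"
      using valid_steps[OF M v, of i 1] i step by simp
    have "drop (?k + 1) (map read_tape (t # u # m # A @ B)) = map read_tape B"
      using k by (simp add: drop_Cons' drop_map)
    thus "mstep (comp_program M1 M2) h (First i, t # u # m # A @ B) =
      (if h = First i then (First i, t # u # m # A @ B)
       else (First i', act a t # u # act b m # map2 act as' A @ B))"
      using i gs reads tr as by (simp add: mstep_def comp_program_def)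
  qed
qed

lemma comp_sim2:
  assumes M: "turing_machine M2" and v: "valid_tapes (num_tapes M2) (num_syms M2) (m # u # B)"
    and i: "i < num_states M2" and k: "length A = num_tapes M1 - 2" "num_tapes M1 \<ge> 2"
  obtains i' m' u' B' where "step M2 (i, m # u # B) = (i', m' # u' # B')" "i' \<le> num_states M2"
    "valid_tapes (num_tapes M2) (num_syms M2) (m' # u' # B')"
    "mstep (comp_program M1 M2) (Second (num_states M2)) (Second i, t # u # m # A @ B) =
      (Second i', t # u' # m' # A @ B')"
proof -
  let ?k = "num_tapes M1"
  have l: "length B = num_tapes M2 - 2" "num_tapes M2 \<ge> 2" using v by (auto simp: valid_tapes_def)
  let ?gs = "map read_tape (m # u # B)"
  have reads: "comp_reads2 ?k (map read_tape (t # u # m # A @ B)) = ?gs"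
    using k by (simp add: comp_reads2_def drop_Cons' drop_map)
  obtain i' as where tr: "trans M2 i ?gs = (i', as)" by fastforce
  have gs: "length ?gs = num_tapes M2" "set ?gs \<subseteq> {..<num_syms M2}" using valid_reads[OF v] by auto
  have vm: "valid_move {..num_states M2} (num_tapes M2) (num_syms M2) (i', as)"
    unfolding tr[symmetric] using i gs by (intro valid_trans[OF M]) auto
  then obtain a b as' where as: "as = a # b # as'" "length as' = length B"
    using l by (cases as; cases "tl as") (auto simp: valid_move_def)
  have step: "step M2 (i, m # u # B) = (i', act a m # act b u # map2 act as' B)"
    using i tr as by (simp add: step_def)
  show thesis
  proof (rule that[OF step])
    show "i' \<le> num_states M2" using vm by (simp add: valid_move_def)
    show "valid_tapes (num_tapes M2) (num_syms M2) (act a m # act b u # map2 act as' B)"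
      using valid_steps[OF M v, of i 1] i step by simp
    have "take (?k - 2) (drop 3 (map read_tape (t # u # m # A @ B))) = map read_tape A"
      using k by (simp add: take_map)
    moreover have "map2 act (hold (map read_tape A) @ as') (A @ B) = A @ map2 act as' B"
      by simp
    ultimately show "mstep (comp_program M1 M2) (Second (num_states M2)) (Second i, t # u # m # A @ B) =
      (Second i', t # act b u # act a m # A @ map2 act as' B)"
      using i gs reads tr as by (simp add: mstep_def comp_program_def del: zip_append)
  qed
qed

lemma act_hold_move:
  assumes "i < length ts"
  shows "map2 act ((hold (map read_tape ts))[i := (map read_tape ts ! i, d)]) ts =
    ts[i := (fst (ts ! i), snd (ts ! i) + d)]"
  using assms by (simp add: act_hold_update) (simp add: act_def read_tape_def)

text \<open>Here the prescribed final position of the output head matters. Starting behind the last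
  bit, the head crosses nonblank cells only, so the first blank it meets is at \<open>-1\<close>.
  One step left, \<open>length y\<close> steps of walking and one step right make
  \<open>length y + 2\<close>.\<close>

lemma comp_rewind:
  fixes M1 M2 :: tm and y :: "bool list"
  defines "m \<equiv> mstep (comp_program M1 M2) (Second (num_states M2))"
  shows "(m ^^ (length y + 2)) (First (num_states M1), t # u # (contents y, int (length y)) # C) =
    (Second 0, t # u # (contents y, 0) # C)"
proof -
  let ?T = "\<lambda>p. t # u # (contents y, p :: int) # C"
  have move: "map2 act ((hold (map read_tape (?T p)))[2 := (contents y p, d)]) (?T p) = ?T (p + d)" for p d
    using act_hold_move[of 2 "?T p" d] by (simp add: read_tape_def)
  have read: "map read_tape (?T p) ! 2 = contents y p" for p by (simp add: read_tape_def)
  have 1: "m (First (num_states M1), ?T p) = (Back, ?T (p - 1))" for p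
    using move[of p "-1"] read[of p] by (simp add: m_def mstep_def comp_program_def)
  have 2: "m (Back, ?T (int j)) = (Back, ?T (int j - 1))" if "j < length y" for j
    using move[of "int j" "-1"] read[of "int j"] that
    by (simp add: m_def mstep_def comp_program_def contents_def)
  have "(m ^^ j) (Back, ?T (int j - 1)) = (Back, ?T (-1))" if "j \<le> length y" for j
    using that
  proof (induction j)
    case (Suc j)
    thus ?case using 2[of j] by (simp add: funpow_swap1)
  qed simp
  moreover have "m (Back, ?T (-1)) = (Second 0, ?T 0)"
    using move[of "-1" 1] read[of "-1"] by (simp add: m_def mstep_def comp_program_def contents_def)
  moreover have "length y + 2 = 1 + length y + 1" by simp
  ultimately show ?thesis
    using 1 by (simp only: funpow_add_apply One_nat_def funpow.simps comp_apply id_apply order_refl)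
qed

theorem polytime_app_comp:
  assumes "polytime_app f" "polytime_app g"
  shows "polytime_app (g \<circ> f)"
proof -
  obtain M1 and b1 :: "nat poly" where M1: "turing_machine M1"
    "\<And>x. \<exists>ts. (step M1 ^^ poly b1 (length x)) (start_config M1 x) = (num_states M1, ts) \<and>
      ts ! 1 = (contents (f x), int (length (f x)))"
    using assms(1) unfolding polytime_app_def by blast
  obtain M2 and b2 :: "nat poly" where M2: "turing_machine M2"
    "\<And>x. \<exists>ts. (step M2 ^^ poly b2 (length x)) (start_config M2 x) = (num_states M2, ts) \<and>
      ts ! 1 = (contents (g x), int (length (g x)))"
    using assms(2) unfolding polytime_app_def by blast
  let ?k1 = "num_tapes M1" and ?k2 = "num_tapes M2"
  have k: "?k1 \<ge> 2" "?k2 \<ge> 2" "num_syms M1 \<ge> 3" using M1(1) M2(1) by (auto simp: turing_machine_def)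
  have len: "length (f x) \<le> poly b1 (length x)" for x
  proof -
    obtain ts where "(step M1 ^^ poly b1 (length x)) (start_config M1 x) = (num_states M1, ts)"
      "ts ! 1 = (contents (f x), int (length (f x)))" using M1(2) by blast
    thus ?thesis using head_bound[OF M1(1), of 1 "poly b1 (length x)" x] k by simp
  qed
  \<comment> \<open>The time of the first machine, the way back over its output with two extra
    steps, and the time of the second machine on that output, whose length \<open>len\<close> bounds
    by \<open>b1\<close>.\<close>
  define b where "b = b1 + [:2:] + b1 + pcompose b2 b1"
  let ?h = "Second (num_states M2)"
  let ?m = "mstep (comp_program M1 M2) ?h"
  show ?thesis
  proof (rule polytime_appI[where Q = "comp_controls M1 M2" and \<delta> = "comp_program M1 M2" and
        k = "?k1 + ?k2 - 1" and g = "max (num_syms M1) (num_syms M2)" and h = ?h and ?q0.0 = "First 0" and b = b])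
    fix x
    let ?y = "f x"
    define e :: tape where "e = (contents [], 0)"
    define A0 where "A0 = replicate (?k1 - 2) e"
    define B0 where "B0 = replicate (?k2 - 2) e"
    have start1: "start_config M1 x = (0, (contents x, 0) # e # A0)"
      using k by (simp add: start_config_def e_def A0_def replicate_Suc[symmetric] numeral_2_eq_2 Suc_diff_Suc)
    have start2: "start_config M2 ?y = (0, (contents ?y, 0) # e # B0)"
      using k by (simp add: start_config_def e_def B0_def replicate_Suc[symmetric] numeral_2_eq_2 Suc_diff_Suc)
    have e_rep: "replicate (?k1 + ?k2 - 1 - 1) e = e # e # A0 @ B0"
    proof -
      have "?k1 + ?k2 - 1 - 1 = Suc (Suc ((?k1 - 2) + (?k2 - 2)))" using k by simp
      thus ?thesis by (simp only: replicate_Suc replicate_add A0_def B0_def)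
    qed
    define sim1 where "sim1 = (\<lambda>c d. \<exists>i t m A. c = (i, t # m # A) \<and> d = (First i, t # e # m # A @ B0) \<and>
      i \<le> num_states M1 \<and> valid_tapes ?k1 (num_syms M1) (t # m # A))"
    have "\<exists>j\<le>poly b1 (length x). sim1 ((step M1 ^^ poly b1 (length x)) (start_config M1 x))
        ((?m ^^ j) (First 0, (contents x, 0) # e # e # A0 @ B0))"
    proof (rule steps_simulation)
      fix c d assume cd: "sim1 c d" "fst c \<noteq> num_states M1"
      then obtain i t m A where c: "c = (i, t # m # A)" "d = (First i, t # e # m # A @ B0)"
        "i < num_states M1" "valid_tapes ?k1 (num_syms M1) (t # m # A)" unfolding sim1_def by auto
      show "sim1 (step M1 c) (?m d)"
        by (rule comp_sim1[OF M1(1) c(4,3), where h = ?h and ?M2.0 = M2 and u = e and B = B0])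
          (auto simp: sim1_def c)
    next
      show "sim1 (start_config M1 x) (First 0, (contents x, 0) # e # e # A0 @ B0)"
        unfolding sim1_def start1 using valid_start[OF M1(1), of x] start1 by auto
    qed
    then obtain j1 t m A where j1: "j1 \<le> poly b1 (length x)"
      "(?m ^^ j1) (First 0, (contents x, 0) # e # e # A0 @ B0) = (First (num_states M1), t # e # m # A @ B0)"
      "m = (contents ?y, int (length ?y))" "length A = ?k1 - 2"
      using M1(2)[of x] by (auto simp: sim1_def valid_tapes_def)
    define sim2 where "sim2 = (\<lambda>c d. \<exists>i m u B. c = (i, m # u # B) \<and> d = (Second i, t # u # m # A @ B) \<and>
      i \<le> num_states M2 \<and> valid_tapes ?k2 (num_syms M2) (m # u # B))"
    have "\<exists>j\<le>poly b2 (length ?y). sim2 ((step M2 ^^ poly b2 (length ?y)) (start_config M2 ?y))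
        ((?m ^^ j) (Second 0, t # e # (contents ?y, 0) # A @ B0))"
    proof (rule steps_simulation)
      fix c d assume cd: "sim2 c d" "fst c \<noteq> num_states M2"
      then obtain i m u B where c: "c = (i, m # u # B)" "d = (Second i, t # u # m # A @ B)"
        "i < num_states M2" "valid_tapes ?k2 (num_syms M2) (m # u # B)" unfolding sim2_def by auto
      show "sim2 (step M2 c) (?m d)"
        by (rule comp_sim2[OF M2(1) c(4,3) j1(4) k(1), where t = t]) (auto simp: sim2_def c)
    next
      show "sim2 (start_config M2 ?y) (Second 0, t # e # (contents ?y, 0) # A @ B0)"
        unfolding sim2_def start2 using valid_start[OF M2(1), of ?y] start2 by auto
    qed
    then obtain j2 m' u' B where j2: "j2 \<le> poly b2 (length ?y)"
      "(?m ^^ j2) (Second 0, t # e # (contents ?y, 0) # A @ B0) = (?h, t # u' # m' # A @ B)"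
      "u' = (contents (g ?y), int (length (g ?y)))"
      using M2(2)[of ?y] by (auto simp: sim2_def)
    define r where "r = length ?y + 2"
    have "(?m ^^ r) (First (num_states M1), t # e # m # A @ B0) = (Second 0, t # e # (contents ?y, 0) # A @ B0)"
      unfolding r_def j1(3) by (rule comp_rewind)
    hence "(?m ^^ (j1 + r + j2)) (First 0, (contents x, 0) # e # e # A0 @ B0) = (?h, t # u' # m' # A @ B)"
      by (simp only: funpow_add_apply j1(2) j2(2))
    moreover have "j1 + r + j2 \<le> poly b (length x)"
      using j1(1) j2(1) len[of x] poly_nat_mono[OF len[of x], of b2]
      by (simp add: b_def r_def poly_pcompose)
    ultimately show "\<exists>n ts. n \<le> poly b (length x) \<and>
        (?m ^^ n) (First 0, (contents x, 0) # replicate (?k1 + ?k2 - 1 - 1) (contents [], 0)) = (?h, ts) \<and>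
        ts ! 1 = (contents ((g \<circ> f) x), int (length ((g \<circ> f) x)))"
      unfolding e_def[symmetric] e_rep using j2(3) by (intro exI conjI) auto
  next
    show "finite (comp_controls M1 M2)" by (simp add: comp_controls_def)
  qed (use k comp_program_valid[OF M1(1) M2(1)] in \<open>auto simp: comp_controls_def\<close>)
qed

section \<open>A programming language for polynomial time\<close>

text \<open>
  Values are positions in the input, so incrementing saturates at \<open>length x + 1\<close>; the body of an
  iteration over the variable \<open>v\<close> finds the number of the round in the variable \<open>Suc v\<close>. As values
  are polynomially bounded, every program of this language runs in polynomial time.
\<close>

datatype ex = EV nat | EZ | ETop | ES ex | EP ex | EIf ex nat ex ex | ELet nat ex ex | EIter nat ex ex ex

primrec iterate :: "(nat \<Rightarrow> nat \<Rightarrow> nat) \<Rightarrow> nat \<Rightarrow> nat \<Rightarrow> nat" where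
  "iterate f a 0 = a"
| "iterate f a (Suc n) = f n (iterate f a n)"

fun ev :: "bool list \<Rightarrow> (nat \<Rightarrow> nat) \<Rightarrow> ex \<Rightarrow> nat" where
  "ev x s (EV i) = s i"
| "ev x s EZ = 0"
| "ev x s ETop = length x + 1"
| "ev x s (ES e) = min (Suc (ev x s e)) (length x + 1)"
| "ev x s (EP e) = ev x s e - 1"
| "ev x s (EIf e c a b) = (if rd x (ev x s e) = c then ev x s a else ev x s b)"
| "ev x s (ELet v a b) = ev x (s(v := ev x s a)) b"
| "ev x s (EIter v n a b) = iterate (\<lambda>i u. ev x (s(v := u, Suc v := i)) b) (ev x s a) (ev x s n)"

datatype out = OConst "bool list" | OSeq out out | OIf ex out out | OLet nat ex out | OFor nat ex out

fun oev :: "bool list \<Rightarrow> (nat \<Rightarrow> nat) \<Rightarrow> out \<Rightarrow> bool list" where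
  "oev x s (OConst bs) = bs"
| "oev x s (OSeq p q) = oev x s p @ oev x s q"
| "oev x s (OIf e p q) = (if ev x s e \<noteq> 0 then oev x s p else oev x s q)"
| "oev x s (OLet v e p) = oev x (s(v := ev x s e)) p"
| "oev x s (OFor v e p) = concat (map (\<lambda>i. oev x (s(v := i)) p) [0..<ev x s e])"

fun ex_vars :: "ex \<Rightarrow> nat" where
  "ex_vars (EV i) = Suc i"
| "ex_vars EZ = 0"
| "ex_vars ETop = 0"
| "ex_vars (ES e) = ex_vars e"
| "ex_vars (EP e) = ex_vars e"
| "ex_vars (EIf e c a b) = max (ex_vars e) (max (ex_vars a) (ex_vars b))"
| "ex_vars (ELet v a b) = max (Suc v) (max (ex_vars a) (ex_vars b))"
| "ex_vars (EIter v n a b) = max (Suc (Suc v)) (max (ex_vars n) (max (ex_vars a) (ex_vars b)))"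

fun out_vars :: "out \<Rightarrow> nat" where
  "out_vars (OConst bs) = 0"
| "out_vars (OSeq p q) = max (out_vars p) (out_vars q)"
| "out_vars (OIf e p q) = max (ex_vars e) (max (out_vars p) (out_vars q))"
| "out_vars (OLet v e p) = max (Suc v) (max (ex_vars e) (out_vars p))"
| "out_vars (OFor v e p) = max (Suc v) (max (ex_vars e) (out_vars p))"

section \<open>Compiling expressions and output programs to register programs\<close>

definition cmove :: "nat \<Rightarrow> nat \<Rightarrow> com" where
  "cmove r r' = Until r 3 (Seq (Dec r) (Inc r'))"

definition cclear :: "nat \<Rightarrow> com" where
  "cclear r = Until r 3 (Dec r)"

text \<open>A register can be read only by counting it down. So \<open>r\<close> is emptied into two
  registers at once and then restored from the second.\<close>

definition ccopy :: "nat \<Rightarrow> nat \<Rightarrow> com" where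
  "ccopy r t = Seq (Until r 3 (Seq (Dec r) (Seq (Inc t) (Inc (Suc t))))) (cmove (Suc t) r)"

text \<open>Variable \<open>i\<close> is register \<open>i\<close>. The registers from
  \<open>t\<close> on are free and hold \<open>0\<close>; the value is left in \<open>t\<close> and
  everything else is restored. Binders may rebind a variable that is in use, so they park its old
  value in a free register while the body runs.\<close>

fun ccode :: "nat \<Rightarrow> ex \<Rightarrow> com" where
  "ccode t (EV i) = ccopy i t"
| "ccode t EZ = Skip"
| "ccode t ETop = Until t 0 (Inc t)"
| "ccode t (ES e) = Seq (ccode t e) (Inc t)"
| "ccode t (EP e) = Seq (ccode t e) (Dec t)"
| "ccode t (EIf e c a b) = Seq (ccode t e)
     (Test t c (Seq (cclear t) (ccode t a)) (Seq (cclear t) (ccode t b)))"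
| "ccode t (ELet v a b) = Seq (ccode t a) (Seq (cmove v (t + 1)) (Seq (cmove t v) (Seq (ccode (t + 2) b)
     (Seq (cclear v) (Seq (cmove (t + 1) v) (cmove (t + 2) t))))))"
| "ccode t (EIter v n a b) = Seq (ccode t n) (Seq (ccode (t + 1) a) (Seq (cmove (Suc v) (t + 2))
     (Seq (cmove v (t + 3)) (Seq (cmove (t + 1) v) (Seq
     (Until t 3 (Seq (Dec t) (Seq (ccode (t + 4) b) (Seq (cclear v) (Seq (cmove (t + 4) v) (Inc (Suc v)))))))
     (Seq (cclear (Suc v)) (Seq (cmove v t) (Seq (cmove (t + 2) (Suc v)) (cmove (t + 3) v)))))))))"

fun ocode :: "nat \<Rightarrow> out \<Rightarrow> com" where
  "ocode t (OConst bs) = foldr (\<lambda>b. Seq (Emit b)) bs Skip"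
| "ocode t (OSeq p q) = Seq (ocode t p) (ocode t q)"
| "ocode t (OIf e p q) = Seq (ccode t e) (Test t 3 (ocode t q) (Seq (cclear t) (ocode t p)))"
| "ocode t (OLet v e p) = Seq (ccode t e) (Seq (cmove v (t + 1)) (Seq (cmove t v) (Seq (ocode (t + 2) p)
     (Seq (cclear v) (cmove (t + 1) v)))))"
| "ocode t (OFor v e p) = Seq (ccode t e) (Seq (cmove v (t + 1)) (Seq
     (Until t 3 (Seq (Dec t) (Seq (ocode (t + 2) p) (Inc v))))
     (Seq (cclear v) (cmove (t + 1) v))))"

lemma runs_Seq': "runs x a s o1 s1 \<Longrightarrow> runs x b s1 o2 s2 \<Longrightarrow> ob = o1 @ o2 \<Longrightarrow> runs x (Seq a b) s ob s2"
  using runs_Seq by blast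

lemma runs_Seq0: "runs x a s [] s1 \<Longrightarrow> runs x b s1 ob s2 \<Longrightarrow> runs x (Seq a b) s ob s2"
  using runs_Seq[of x a s "[]" s1 b ob s2] by simp

lemma runs_Seq1: "runs x a s ob s1 \<Longrightarrow> runs x b s1 [] s2 \<Longrightarrow> runs x (Seq a b) s ob s2"
  using runs_Seq[of x a s ob s1 b "[]" s2] by simp

lemma runs_Inc: "s r \<le> length x \<Longrightarrow> s' = s(r := s r + 1) \<Longrightarrow> runs x (Inc r) s [] s'"
  using runs_basic(2)[of x r s] by simp

lemma runs_Dec: "s' = s(r := s r - 1) \<Longrightarrow> runs x (Dec r) s [] s'"
  using runs_basic(3)[of x r s] by simp

lemma runs_Until_zero:
  assumes "\<And>i. i \<le> s r \<Longrightarrow> f i r = s r - i" "f 0 = s"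
    and "\<And>i. i < s r \<Longrightarrow> runs x a (f i) (g i) (f (Suc i))" "s' = f (s r)" "ob = concat (map g [0..<s r])"
  shows "runs x (Until r 3 a) s ob s'"
  using runs_Until[of "s r" x f r 3 a g] assms by (simp add: rd_three)

lemma runs_cmove:
  assumes "s r' = 0" "r \<noteq> r'" "s r \<le> length x + 1" "s' = s(r' := s r, r := 0)"
  shows "runs x (cmove r r') s [] s'"
  unfolding cmove_def
proof (rule runs_Until_zero[where f = "\<lambda>i. s(r' := i, r := s r - i)" and g = "\<lambda>_. []"])
  fix i assume i: "i < s r"
  show "runs x (Seq (Dec r) (Inc r')) (s(r' := i, r := s r - i)) [] (s(r' := Suc i, r := s r - Suc i))"
    using i assms by (intro runs_Seq0[OF runs_Dec[OF refl] runs_Inc]) (auto simp: fun_eq_iff)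
qed (use assms in \<open>auto simp: fun_eq_iff\<close>)

lemma runs_cclear:
  assumes "s' = s(r := 0)"
  shows "runs x (cclear r) s [] s'"
  unfolding cclear_def
  by (rule runs_Until_zero[where f = "\<lambda>i. s(r := s r - i)" and g = "\<lambda>_. []"])
    (auto simp: assms intro!: runs_Dec)

lemma runs_ccopy:
  assumes "s t = 0" "s (Suc t) = 0" "r < t" "s r \<le> length x + 1"
  shows "runs x (ccopy r t) s [] (s(t := s r))"
  unfolding ccopy_def
proof (rule runs_Seq')
  let ?f = "\<lambda>i. s(r := s r - i, t := i, Suc t := i)"
  show "runs x (Until r 3 (Seq (Dec r) (Seq (Inc t) (Inc (Suc t))))) s [] (?f (s r))"
  proof (rule runs_Until_zero[where f = ?f and g = "\<lambda>_. []"])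
    fix i assume i: "i < s r"
    show "runs x (Seq (Dec r) (Seq (Inc t) (Inc (Suc t)))) (?f i) [] (?f (Suc i))"
      using i assms
      by (intro runs_Seq0[OF runs_Dec[OF refl] runs_Seq0[OF runs_Inc[OF _ refl] runs_Inc]]) (auto simp: fun_eq_iff)
  qed (use assms in \<open>auto simp: fun_eq_iff\<close>)
  show "runs x (cmove (Suc t) r) (?f (s r)) [] (s(t := s r))"
    using assms by (intro runs_cmove) (auto simp: fun_eq_iff)
qed simp

text \<open>While a subexpression runs, the registers beyond its variables hold scratch values of
  the enclosing code; these must not influence its value.\<close>

lemma ev_cong: "(\<And>r. r < ex_vars e \<Longrightarrow> s r = s' r) \<Longrightarrow> ev x s e = ev x s' e"
proof (induction e arbitrary: s s')
  case (ELet v a b)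
  have "ev x s a = ev x s' a" using ELet.prems by (intro ELet.IH(1)) auto
  moreover have "ev x (s(v := u)) b = ev x (s'(v := u)) b" for u
    using ELet.prems by (intro ELet.IH(2)) auto
  ultimately show ?case by simp
next
  case (EIter v n a b)
  have "ev x s a = ev x s' a" "ev x s n = ev x s' n" using EIter.prems by (auto intro!: EIter.IH(1,2))
  moreover have "ev x (s(v := u, Suc v := i)) b = ev x (s'(v := u, Suc v := i)) b" for u i
    using EIter.prems by (intro EIter.IH(3)) auto
  ultimately show ?case by simp
next
  case (EIf e c a b)
  have "ev x s e = ev x s' e" "ev x s a = ev x s' a" "ev x s b = ev x s' b"
    using EIf.prems by (auto intro!: EIf.IH)
  thus ?case by simp
next
  case (ES e)
  have "ev x s e = ev x s' e" using ES.prems by (intro ES.IH) simp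
  thus ?case by simp
next
  case (EP e)
  have "ev x s e = ev x s' e" using EP.prems by (intro EP.IH) simp
  thus ?case by simp
qed simp_all

lemma oev_cong: "(\<And>r. r < out_vars p \<Longrightarrow> s r = s' r) \<Longrightarrow> oev x s p = oev x s' p"
proof (induction p arbitrary: s s')
  case (OLet v e p)
  have "ev x s e = ev x s' e" using OLet.prems by (intro ev_cong) auto
  moreover have "oev x (s(v := u)) p = oev x (s'(v := u)) p" for u
    using OLet.prems by (intro OLet.IH) auto
  ultimately show ?case by simp
next
  case (OFor v e p)
  have "ev x s e = ev x s' e" using OFor.prems by (intro ev_cong) auto
  moreover have "oev x (s(v := u)) p = oev x (s'(v := u)) p" for u
    using OFor.prems by (intro OFor.IH) auto
  ultimately show ?case by simp
next
  case (OIf e p q)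
  have "ev x s e = ev x s' e" using OIf.prems by (intro ev_cong) auto
  moreover have "oev x s p = oev x s' p" "oev x s q = oev x s' q"
    using OIf.prems by (auto intro!: OIf.IH)
  ultimately show ?case by simp
next
  case (OSeq p q)
  have "oev x s p = oev x s' p" "oev x s q = oev x s' q"
    using OSeq.prems by (auto intro!: OSeq.IH)
  thus ?case by simp
qed auto

lemma iterate_le: "a \<le> B \<Longrightarrow> (\<And>i u. i < n \<Longrightarrow> u \<le> B \<Longrightarrow> f i u \<le> B) \<Longrightarrow> iterate f a n \<le> (B :: nat)"
  by (induction n) auto

lemma ev_le: "(\<And>r. s r \<le> length x + 1) \<Longrightarrow> ev x s e \<le> length x + 1"
proof (induction e arbitrary: s)
  case (EP e)
  have "ev x s e \<le> length x + 1" using EP.prems by (rule EP.IH)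
  thus ?case by simp
next
  case (EIter v n a b)
  have "iterate (\<lambda>i u. ev x (s(v := u, Suc v := i)) b) (ev x s a) (ev x s n) \<le> length x + 1"
  proof (rule iterate_le)
    show "ev x s a \<le> length x + 1" using EIter.prems by (rule EIter.IH(2))
    fix i u assume "i < ev x s n" "u \<le> length x + 1"
    moreover have "ev x s n \<le> length x + 1" using EIter.prems by (rule EIter.IH(1))
    ultimately show "ev x (s(v := u, Suc v := i)) b \<le> length x + 1"
      using EIter.prems by (intro EIter.IH(3)) auto
  qed
  thus ?case by simp
qed auto

lemma runs_ccode:
  assumes "\<And>r. s r \<le> length x + 1" "\<And>r. t \<le> r \<Longrightarrow> s r = 0" "ex_vars e \<le> t"
  shows "runs x (ccode t e) s [] (s(t := ev x s e))"
  using assms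
proof (induction e arbitrary: s t)
  case (EV i)
  show ?case unfolding ccode.simps ev.simps by (rule runs_ccopy) (use EV.prems in auto)
next
  case EZ
  hence "s(t := 0) = s" using EZ.prems(2)[of t] by (simp add: fun_upd_idem)
  thus ?case by (simp only: ccode.simps ev.simps runs_basic)
next
  case ETop
  have "runs x (Until t 0 (Inc t)) (s(t := 0)) (concat (map (\<lambda>_. []) [0..<length x + 1])) (s(t := length x + 1))"
    by (rule runs_Until[where f = "\<lambda>i. s(t := i)"]) (auto simp: rd_zero intro!: runs_Inc)
  moreover have "s(t := 0) = s" using ETop.prems(2)[of t] by (simp add: fun_upd_idem)
  moreover have "concat (map (\<lambda>_. [] :: bool list) [0..<length x + 1]) = []" by simp
  ultimately show ?case by (simp only: ccode.simps ev.simps)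
next
  case (ES e)
  have "runs x (Inc t) (s(t := ev x s e)) [] (s(t := ev x s (ES e)))"
  proof (cases "ev x s e \<le> length x")
    case True
    thus ?thesis by (intro runs_Inc) simp_all
  next
    case False
    moreover have "ev x s e \<le> length x + 1" using ES.prems(1) by (rule ev_le)
    ultimately have "ev x s e = length x + 1" by simp
    thus ?thesis using runs_basic(2)[of x t "s(t := ev x s e)"] by simp
  qed
  moreover have "runs x (ccode t e) s [] (s(t := ev x s e))" using ES.prems by (intro ES.IH) simp_all
  ultimately show ?case by (simp only: ccode.simps runs_Seq0)
next
  case (EP e)
  have "runs x (ccode t e) s [] (s(t := ev x s e))" using EP.prems by (intro EP.IH) simp_all
  moreover have "runs x (Dec t) (s(t := ev x s e)) [] (s(t := ev x s (EP e)))" by (rule runs_Dec) simp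
  ultimately show ?case by (simp only: ccode.simps runs_Seq0)
next
  case (EIf e c a b)
  let ?s = "s(t := ev x s e)"
  have e: "runs x (ccode t e) s [] ?s" using EIf.prems by (intro EIf.IH(1)) simp_all
  have a: "runs x (ccode t a) s [] (s(t := ev x s a))" using EIf.prems by (intro EIf.IH(2)) simp_all
  have b: "runs x (ccode t b) s [] (s(t := ev x s b))" using EIf.prems by (intro EIf.IH(3)) simp_all
  have ab: "runs x (Seq (cclear t) (ccode t d)) ?s [] (s(t := ev x s d))"
    if "runs x (ccode t d) s [] (s(t := ev x s d))" for d
    using that by (intro runs_Seq0[OF runs_cclear[OF refl]]) (simp add: fun_upd_idem EIf.prems(2))
  have "runs x (Test t c (Seq (cclear t) (ccode t a)) (Seq (cclear t) (ccode t b))) ?s []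
      (s(t := ev x s (EIf e c a b)))"
    using ab[OF a] ab[OF b] by (intro runs_Test) simp
  thus ?case unfolding ccode.simps by (rule runs_Seq0[OF e])
next
  case (ELet v a b)
  have v: "v < t" "ex_vars a \<le> t" "ex_vars b \<le> t" using ELet.prems by auto
  define A where "A = ev x s a"
  define B where "B = ev x s (ELet v a b)"
  have le: "A \<le> length x + 1" "s v \<le> length x + 1" "B \<le> length x + 1"
    using ELet.prems(1) ev_le unfolding A_def B_def by blast+
  have z: "s t = 0" "s (Suc t) = 0" "s (Suc (Suc t)) = 0" using ELet.prems(2) by simp_all
  let ?s2 = "s(t := A, t + 1 := s v, v := 0)" and ?s3 = "s(t + 1 := s v, v := A)"
  let ?s5 = "s(t + 2 := B, t + 1 := s v, v := 0)" and ?s6 = "s(t + 2 := B)"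
  have 1: "runs x (ccode t a) s [] (s(t := A))"
    unfolding A_def using ELet.prems v by (intro ELet.IH(1)) auto
  have 2: "runs x (cmove v (t + 1)) (s(t := A)) [] ?s2"
    using v z le by (intro runs_cmove) (auto simp: fun_eq_iff)
  have 3: "runs x (cmove t v) ?s2 [] ?s3"
    using v z le by (intro runs_cmove) (auto simp: fun_eq_iff)
  have "ev x ?s3 b = B" unfolding B_def A_def using v by (auto intro!: ev_cong)
  moreover have "runs x (ccode (t + 2) b) ?s3 [] (?s3(t + 2 := ev x ?s3 b))"
    using ELet.prems v le by (intro ELet.IH(2)) auto
  ultimately have 4: "runs x (ccode (t + 2) b) ?s3 [] (?s3(t + 2 := B))" by simp
  have 5: "runs x (cclear v) (?s3(t + 2 := B)) [] ?s5"
    using v by (intro runs_cclear) (auto simp: fun_eq_iff)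
  have 6: "runs x (cmove (t + 1) v) ?s5 [] ?s6"
    using v z le by (intro runs_cmove) (auto simp: fun_eq_iff)
  have 7: "runs x (cmove (t + 2) t) ?s6 [] (s(t := B))"
    using v z le by (intro runs_cmove) (auto simp: fun_eq_iff)
  show ?case unfolding ccode.simps B_def[symmetric]
    by (rule runs_Seq0[OF 1 runs_Seq0[OF 2 runs_Seq0[OF 3 runs_Seq0[OF 4 runs_Seq0[OF 5 runs_Seq0[OF 6 7]]]]]])
next
  case (EIter v n a b)
  have v: "Suc v < t" "ex_vars n \<le> t" "ex_vars a \<le> t" "ex_vars b \<le> t" using EIter.prems by auto
  define N where "N = ev x s n"
  define A where "A = ev x s a"
  define B where "B = iterate (\<lambda>i u. ev x (s(v := u, Suc v := i)) b) A"
  have BN: "ev x s (EIter v n a b) = B N" by (simp add: B_def A_def N_def)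
  have z: "s t = 0" "s (t + 1) = 0" "s (t + 2) = 0" "s (t + 3) = 0" "s (t + 4) = 0"
    using EIter.prems(2) by simp_all
  have le: "N \<le> length x + 1" "A \<le> length x + 1" "s v \<le> length x + 1" "s (Suc v) \<le> length x + 1"
    using EIter.prems(1) ev_le unfolding A_def N_def by blast+
  have leB: "B i \<le> length x + 1" if "i \<le> N" for i
    unfolding B_def using that le EIter.prems(1) by (intro iterate_le ev_le) auto
  let ?s1 = "s(t := N, t + 1 := A)"
  let ?s2 = "s(t := N, t + 1 := A, t + 2 := s (Suc v), Suc v := 0)"
  let ?s3 = "s(t := N, t + 1 := A, t + 2 := s (Suc v), Suc v := 0, t + 3 := s v, v := 0)"
  \<comment> \<open>The loop invariant after \<open>i\<close> rounds: \<open>t\<close> counts the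
    rounds left, \<open>Suc v\<close> the rounds done and \<open>v\<close> holds the accumulator,
    while \<open>t + 2\<close> and \<open>t + 3\<close> keep the former values of
    \<open>Suc v\<close> and \<open>v\<close>.\<close>
  define f where "f = (\<lambda>i. s(t := N - i, t + 2 := s (Suc v), Suc v := i, t + 3 := s v, v := B i))"
  have 1: "runs x (ccode t n) s [] (s(t := N))"
    unfolding N_def using EIter.prems v by (intro EIter.IH(1)) auto
  have "ev x (s(t := N)) a = A" unfolding A_def using v by (auto intro!: ev_cong)
  moreover have "runs x (ccode (t + 1) a) (s(t := N)) [] (s(t := N, t + 1 := ev x (s(t := N)) a))"
    using EIter.prems v le by (intro EIter.IH(2)) auto
  ultimately have 2: "runs x (ccode (t + 1) a) (s(t := N)) [] ?s1" by simp
  have 3: "runs x (cmove (Suc v) (t + 2)) ?s1 [] ?s2"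
    using v z le by (intro runs_cmove) (auto simp: fun_eq_iff)
  have 4: "runs x (cmove v (t + 3)) ?s2 [] ?s3"
    using v z le by (intro runs_cmove) (auto simp: fun_eq_iff)
  have 5: "runs x (cmove (t + 1) v) ?s3 [] (f 0)"
    using v z le by (intro runs_cmove) (auto simp: fun_eq_iff f_def B_def)
  have body: "runs x (Seq (Dec t) (Seq (ccode (t + 4) b) (Seq (cclear v) (Seq (cmove (t + 4) v) (Inc (Suc v))))))
      (f i) [] (f (Suc i))" if i: "i < N" for i
  proof -
    let ?g = "(f i)(t := N - Suc i)"
    have "ev x ?g b = ev x (s(v := B i, Suc v := i)) b" using v by (auto simp: f_def intro!: ev_cong)
    also have "\<dots> = B (Suc i)" by (simp add: B_def)
    finally have B: "ev x ?g b = B (Suc i)" .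
    have "runs x (ccode (t + 4) b) ?g [] (?g(t + 4 := ev x ?g b))"
      using EIter.prems v le leB[of i] i by (intro EIter.IH(3)) (auto simp: f_def)
    hence b2: "runs x (ccode (t + 4) b) ?g [] (?g(t + 4 := B (Suc i)))" unfolding B .
    have b1: "runs x (Dec t) (f i) [] ?g" using v by (intro runs_Dec) (auto simp: f_def)
    have b3: "runs x (cclear v) (?g(t + 4 := B (Suc i))) [] (?g(t + 4 := B (Suc i), v := 0))"
      by (rule runs_cclear) simp
    have b4: "runs x (cmove (t + 4) v) (?g(t + 4 := B (Suc i), v := 0)) [] (?g(v := B (Suc i)))"
      using v z leB[of "Suc i"] i by (intro runs_cmove) (auto simp: fun_eq_iff f_def)
    have b5: "runs x (Inc (Suc v)) (?g(v := B (Suc i))) [] (f (Suc i))"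
      using v i le by (intro runs_Inc) (auto simp: fun_eq_iff f_def)
    show ?thesis by (rule runs_Seq0[OF b1 runs_Seq0[OF b2 runs_Seq0[OF b3 runs_Seq0[OF b4 b5]]]])
  qed
  have ft: "f i t = N - i" for i using v by (simp add: f_def)
  have 6: "runs x (Until t 3 (Seq (Dec t) (Seq (ccode (t + 4) b) (Seq (cclear v) (Seq (cmove (t + 4) v) (Inc (Suc v)))))))
      (f 0) [] (f N)"
    by (rule runs_Until_zero[where f = f and g = "\<lambda>_. []"]) (use body in \<open>simp_all add: ft\<close>)
  let ?s7 = "s(t + 2 := s (Suc v), Suc v := 0, t + 3 := s v, v := B N)"
  let ?s8 = "s(t := B N, t + 2 := s (Suc v), Suc v := 0, t + 3 := s v, v := 0)"
  let ?s9 = "s(t := B N, t + 3 := s v, v := 0)"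
  have 7: "runs x (cclear (Suc v)) (f N) [] ?s7"
    using v z by (intro runs_cclear) (auto simp: fun_eq_iff f_def)
  have 8: "runs x (cmove v t) ?s7 [] ?s8"
    using v z leB[of N] by (intro runs_cmove) (auto simp: fun_eq_iff)
  have 9: "runs x (cmove (t + 2) (Suc v)) ?s8 [] ?s9"
    using v z le by (intro runs_cmove) (auto simp: fun_eq_iff)
  have 10: "runs x (cmove (t + 3) v) ?s9 [] (s(t := B N))"
    using v z le by (intro runs_cmove) (auto simp: fun_eq_iff)
  show ?case unfolding ccode.simps BN
    by (rule runs_Seq0[OF 1 runs_Seq0[OF 2 runs_Seq0[OF 3 runs_Seq0[OF 4 runs_Seq0[OF 5 runs_Seq0[OF 6
          runs_Seq0[OF 7 runs_Seq0[OF 8 runs_Seq0[OF 9 10]]]]]]]]])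
qed

lemma runs_ocode:
  assumes "\<And>r. s r \<le> length x + 1" "\<And>r. t \<le> r \<Longrightarrow> s r = 0" "out_vars p \<le> t"
  shows "runs x (ocode t p) s (oev x s p) s"
  using assms
proof (induction p arbitrary: s t)
  case (OConst bs)
  show ?case
  proof (induction bs)
    case Nil
    show ?case by (simp add: runs_basic(1))
  next
    case (Cons b bs)
    thus ?case by (auto intro!: runs_Seq'[OF runs_basic(4)])
  qed
next
  case (OSeq p q)
  thus ?case by (auto intro!: runs_Seq)
next
  case (OIf e p q)
  let ?s = "s(t := ev x s e)"
  have s: "s(t := 0) = s" using OIf.prems by (simp add: fun_upd_idem)
  have e: "runs x (ccode t e) s [] ?s" using OIf.prems by (intro runs_ccode) auto
  have p: "runs x (Seq (cclear t) (ocode t p)) ?s (oev x s p) s"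
    using OIf s by (intro runs_Seq0[OF runs_cclear]) auto
  have q: "runs x (ocode t q) s (oev x s q) s" using OIf by auto
  have "runs x (Test t 3 (ocode t q) (Seq (cclear t) (ocode t p))) ?s (oev x s (OIf e p q)) s"
    using p q s by (intro runs_Test) (auto simp: rd_three)
  thus ?case unfolding ocode.simps by (rule runs_Seq0[OF e])
next
  case (OLet v e p)
  have v: "v < t" "ex_vars e \<le> t" "out_vars p \<le> t" using OLet.prems by auto
  define A where "A = ev x s e"
  have le: "A \<le> length x + 1" "s v \<le> length x + 1" using OLet.prems(1) ev_le unfolding A_def by blast+
  have z: "s t = 0" "s (Suc t) = 0" using OLet.prems(2) by simp_all
  let ?s2 = "s(t := A, t + 1 := s v, v := 0)" and ?s3 = "s(t + 1 := s v, v := A)"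
  let ?s5 = "s(t + 1 := s v, v := 0)"
  have 1: "runs x (ccode t e) s [] (s(t := A))"
    unfolding A_def using OLet.prems v by (intro runs_ccode) auto
  have 2: "runs x (cmove v (t + 1)) (s(t := A)) [] ?s2"
    using v z le by (intro runs_cmove) (auto simp: fun_eq_iff)
  have 3: "runs x (cmove t v) ?s2 [] ?s3"
    using v z le by (intro runs_cmove) (auto simp: fun_eq_iff)
  have "oev x ?s3 p = oev x s (OLet v e p)" using v by (auto simp: A_def intro!: oev_cong)
  moreover have "runs x (ocode (t + 2) p) ?s3 (oev x ?s3 p) ?s3"
    using OLet.prems v le by (intro OLet.IH) auto
  ultimately have 4: "runs x (ocode (t + 2) p) ?s3 (oev x s (OLet v e p)) ?s3" by simp
  have 5: "runs x (cclear v) ?s3 [] ?s5" using v by (intro runs_cclear) (auto simp: fun_eq_iff)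
  have 6: "runs x (cmove (t + 1) v) ?s5 [] s"
    using v z le by (intro runs_cmove) (auto simp: fun_eq_iff)
  show ?case unfolding ocode.simps
    by (rule runs_Seq0[OF 1 runs_Seq0[OF 2 runs_Seq0[OF 3 runs_Seq1[OF 4 runs_Seq0[OF 5 6]]]]])
next
  case (OFor v e p)
  have v: "v < t" "ex_vars e \<le> t" "out_vars p \<le> t" using OFor.prems by auto
  define N where "N = ev x s e"
  have le: "N \<le> length x + 1" "s v \<le> length x + 1" using OFor.prems(1) ev_le unfolding N_def by blast+
  have z: "s t = 0" "s (Suc t) = 0" using OFor.prems(2) by simp_all
  define f where "f = (\<lambda>i. s(t := N - i, t + 1 := s v, v := i))"
  let ?s4 = "s(t + 1 := s v, v := 0)"
  have 1: "runs x (ccode t e) s [] (s(t := N))"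
    unfolding N_def using OFor.prems v by (intro runs_ccode) auto
  have 2: "runs x (cmove v (t + 1)) (s(t := N)) [] (f 0)"
    using v z le by (intro runs_cmove) (auto simp: fun_eq_iff f_def)
  have body: "runs x (Seq (Dec t) (Seq (ocode (t + 2) p) (Inc v))) (f i) (oev x (s(v := i)) p) (f (Suc i))"
    if i: "i < N" for i
  proof -
    let ?g = "(f i)(t := N - Suc i)"
    have o: "oev x ?g p = oev x (s(v := i)) p" using v by (auto simp: f_def intro!: oev_cong)
    have "runs x (ocode (t + 2) p) ?g (oev x ?g p) ?g"
      using OFor.prems v le i by (intro OFor.IH) (auto simp: f_def)
    hence b2: "runs x (ocode (t + 2) p) ?g (oev x (s(v := i)) p) ?g" unfolding o .
    have b1: "runs x (Dec t) (f i) [] ?g" using v by (intro runs_Dec) (auto simp: f_def)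
    have b3: "runs x (Inc v) ?g [] (f (Suc i))"
      using v i le by (intro runs_Inc) (auto simp: fun_eq_iff f_def)
    show ?thesis by (rule runs_Seq0[OF b1 runs_Seq1[OF b2 b3]])
  qed
  have ft: "f i t = N - i" for i using v by (simp add: f_def)
  have 3: "runs x (Until t 3 (Seq (Dec t) (Seq (ocode (t + 2) p) (Inc v)))) (f 0) (oev x s (OFor v e p)) (f N)"
    by (rule runs_Until_zero[where f = f and g = "\<lambda>i. oev x (s(v := i)) p"])
      (use body in \<open>simp_all add: ft N_def[symmetric]\<close>)
  have 4: "runs x (cclear v) (f N) [] ?s4"
    using v z by (intro runs_cclear) (auto simp: fun_eq_iff f_def)
  have 5: "runs x (cmove (t + 1) v) ?s4 [] s"
    using v z le by (intro runs_cmove) (auto simp: fun_eq_iff)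
  show ?case unfolding ocode.simps
    by (rule runs_Seq0[OF 1 runs_Seq0[OF 2 runs_Seq1[OF 3 runs_Seq0[OF 4 5]]]])
qed

text \<open>The interface to machines: from now on a function is shown to be computable in
  polynomial time by writing it as an output program.\<close>

theorem polytime_app_out: "polytime_app (\<lambda>x. oev x (\<lambda>_. 0) p)"
proof (rule polytime_app_com)
  fix x
  show "\<exists>s. runs x (ocode (out_vars p) p) (\<lambda>_. 0) (oev x (\<lambda>_. 0) p) s"
    using runs_ocode[of "\<lambda>_. 0" x "out_vars p" p] by auto
qed

section \<open>The voting rule\<close>

definition conflict :: "bool list \<Rightarrow> bool list \<Rightarrow> bool" where
  "conflict a b \<longleftrightarrow> (\<exists>i. i < length a \<and> i < length b \<and> a ! i \<and> b ! i)"

text \<open>A single copy of \<open>v\<close> is taken out, so a repeated vote conflicts with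
  itself: no vote occurs twice in a winning election.\<close>

definition winning :: "vote multiset \<Rightarrow> bool" where
  "winning V \<longleftrightarrow> (\<forall>v\<in>#V. True \<in> set (hd v) \<and> (\<forall>w\<in># V - {#v#}. \<not> conflict (hd v) (hd w)))"

text \<open>
  A candidate is the characteristic vector of a finite set, and an election is won (by everybody) iff
  the top choices of the voters are nonempty and pairwise disjoint.
\<close>

definition packing_rule :: rule where
  "packing_rule C V = (if winning V then C else {})"

text \<open>The indexed form of \<open>winning\<close>. With voters as indices a subcollection is a
  set of positions, and equal top choices at different positions still exclude each other.\<close>

definition packed :: "'i set \<Rightarrow> ('i \<Rightarrow> bool list) \<Rightarrow> bool" where
  "packed I f \<longleftrightarrow> (\<forall>i\<in>I. True \<in> set (f i) \<and> (\<forall>j\<in>I. i \<noteq> j \<longrightarrow> \<not> conflict (f i) (f j)))"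

lemma voting_rule_packing_rule: "voting_rule packing_rule"
  by (simp add: voting_rule_def packing_rule_def)

lemma conflict_self: "True \<in> set a \<Longrightarrow> conflict a a"
  by (auto simp: conflict_def in_set_conv_nth)

lemma winning_image_mset:
  assumes "finite I"
  shows "winning (image_mset f (mset_set I)) \<longleftrightarrow> packed I (\<lambda>i. hd (f i))"
proof -
  have "set_mset (image_mset f (mset_set I) - {#f i#}) = f ` (I - {i})" if "i \<in> I" for i
    using assms that by (simp add: mset_set.remove)
  thus ?thesis unfolding winning_def packed_def using assms by fastforce
qed

lemma mset_eq_image_nth: "mset xs = image_mset (nth xs) (mset_set {..<length xs})"
  by (metis atLeast0LessThan map_nth mset_map mset_upt)

lemma winning_mset: "winning (mset vs) \<longleftrightarrow> packed {..<length vs} (\<lambda>i. hd (vs ! i))"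
  using winning_image_mset[of "{..<length vs}" "nth vs"] by (simp add: mset_eq_image_nth[of vs])

lemma winning_count:
  assumes "winning V" "v \<in># V"
  shows "count V v = 1"
proof (rule ccontr)
  assume "count V v \<noteq> 1"
  hence "2 \<le> count V v" using count_greater_zero_iff[THEN iffD2, OF assms(2)] by linarith
  hence "0 < count (V - {#v#}) v" by (simp only: count_diff count_single) simp
  hence "v \<in># V - {#v#}" by (simp only: count_greater_zero_iff)
  thus False using assms conflict_self unfolding winning_def by blast
qed

lemma conformant_bribery_iff:
  "conformant_bribery_possible packing_rule C V k p \<longleftrightarrow> p \<in> C \<and> winning V"
proof
  assume "p \<in> C \<and> winning V"
  thus "conformant_bribery_possible packing_rule C V k p"
    unfolding conformant_bribery_possible_def packing_rule_def
    by (intro exI[of _ "{#}"]) auto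
next
  assume "conformant_bribery_possible packing_rule C V k p"
  then obtain V' B where *: "V' \<subseteq># V" "set_mset B \<subseteq> set_mset V" "size V' = size B"
    "p \<in> packing_rule C (V - V' + B)" unfolding conformant_bribery_possible_def by blast
  define W where "W = V - V' + B"
  have win: "winning W" and p: "p \<in> C"
    using *(4) by (auto simp: packing_rule_def W_def split: if_splits)
  have "set_mset W \<subseteq> set_mset V" using *(2) by (auto simp: W_def dest: in_diffD)
  \<comment> \<open>Every vote of \<open>W\<close> occurs there once, and at least once in
    \<open>V\<close>. Then \<open>W\<close> is contained in \<open>V\<close> and, having the same
    size, equal to it.\<close>
  hence "count W v \<le> count V v" for v
    using winning_count[OF win, of v] by (cases "v \<in># W") (auto simp: not_in_iff Suc_le_eq)
  hence "W \<subseteq># V" by (rule mset_subset_eqI)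
  then obtain D where D: "V = W + D" by (metis mset_subset_eq_exists_conv)
  obtain D' where "V = V' + D'" using *(1) by (metis mset_subset_eq_exists_conv)
  hence "size W = size V" using *(3) by (simp add: W_def)
  hence "W = V" using D by simp
  thus "p \<in> C \<and> winning V" using win p by simp
qed

text \<open>Turns a subcollection of voters into a set of positions, which can be written down as a
  certificate.\<close>

lemma submset_image_msetD:
  assumes "A \<subseteq># image_mset f (mset_set J)"
  shows "\<exists>I\<subseteq>J. A = image_mset f (mset_set I)"
proof (cases "finite J")
  case True
  obtain D where "image_mset f (mset_set J) = A + D" using assms by (metis mset_subset_eq_exists_conv)
  then obtain A' D' where A': "mset_set J = A' + D'" "A = image_mset f A'"
    using image_mset_eq_plusD by blast
  have "count A' i \<le> count (mset_set J) i" for i using A'(1) by simp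
  hence "count A' i \<le> 1" for i by (metis count_mset_set(1,2,3) le_trans zero_le nle_le)
  hence "A' = mset_set (set_mset A')"
    by (intro multiset_eqI) (metis count_eq_zero_iff count_mset_set(1,3) finite_set_mset le_antisym not_less_eq_eq
        One_nat_def le_zero_eq)
  moreover have "set_mset A' \<subseteq> J" using A'(1) True by (metis finite_set_mset_mset_set set_mset_union Un_upper1)
  ultimately show ?thesis using A'(2) by metis
qed (use assms in auto)

lemma image_mset_mset_set_Un:
  "finite I \<Longrightarrow> finite J \<Longrightarrow> I \<inter> J = {} \<Longrightarrow>
    image_mset f (mset_set (I \<union> J)) = image_mset f (mset_set I) + image_mset f (mset_set J)"
  by (simp add: mset_set_Union)

lemma image_nth_append:
  "image_mset (nth (vs @ us)) (mset_set {..<length vs}) = mset vs"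
  "image_mset (nth (vs @ us)) (mset_set {length vs..<length vs + length us}) = mset us"
proof -
  show vs: "image_mset (nth (vs @ us)) (mset_set {..<length vs}) = mset vs"
    unfolding mset_eq_image_nth[of vs] by (intro image_mset_cong) (simp add: nth_append)
  let ?J = "{length vs..<length vs + length us}"
  have "{..<length (vs @ us)} = {..<length vs} \<union> ?J" by auto
  hence "mset (vs @ us) = image_mset (nth (vs @ us)) (mset_set ({..<length vs} \<union> ?J))"
    using mset_eq_image_nth[of "vs @ us"] by metis
  also have "\<dots> = mset vs + image_mset (nth (vs @ us)) (mset_set ?J)"
    unfolding vs[symmetric] by (rule image_mset_mset_set_Un) auto
  finally show "image_mset (nth (vs @ us)) (mset_set ?J) = mset us" by simp
qed

text \<open>The final electorate is a set \<open>I\<close> of positions in \<open>vs @ us\<close>.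
  That as many voters enter as leave means that \<open>I\<close> has the size of the original
  electorate; the voters who enter are the positions from \<open>length vs\<close> on.\<close>

lemma replacing_iff:
  "replacing_possible packing_rule C (mset vs) (mset us) k p \<longleftrightarrow> p \<in> C \<and>
    (\<exists>I\<subseteq>{..<length vs + length us}. card I = length vs \<and> card {i\<in>I. length vs \<le> i} \<le> k \<and>
       packed I (\<lambda>i. hd ((vs @ us) ! i)))"
proof -
  let ?m = "length vs" and ?l = "length us"
  let ?f = "\<lambda>I. image_mset (nth (vs @ us)) (mset_set I)"
  have f: "mset vs = ?f {..<?m}" "mset us = ?f {?m..<?m + ?l}" by (simp_all add: image_nth_append)
  have Un: "?f (I \<union> J) = ?f I + ?f J" if "finite I" "finite J" "I \<inter> J = {}" for I J
    using that by (rule image_mset_mset_set_Un)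
  show ?thesis
  proof
    assume "replacing_possible packing_rule C (mset vs) (mset us) k p"
    then obtain V' U' where *: "V' \<subseteq># mset vs" "U' \<subseteq># mset us" "size V' = size U'" "size U' \<le> k"
      "p \<in> packing_rule C (mset vs - V' + U')" unfolding replacing_possible_def by blast
    obtain J where J: "J \<subseteq> {..<?m}" "V' = ?f J" using *(1) submset_image_msetD f(1) by metis
    obtain K where K: "K \<subseteq> {?m..<?m + ?l}" "U' = ?f K" using *(2) submset_image_msetD f(2) by metis
    have fin: "finite J" "finite K" using J(1) K(1) finite_subset by blast+
    let ?I = "({..<?m} - J) \<union> K"
    have "({..<?m} - J) \<union> J = {..<?m}" using J(1) by auto
    hence "mset vs = ?f (({..<?m} - J) \<union> J)" by (simp only: f(1))
    also have "\<dots> = ?f ({..<?m} - J) + V'" using fin J by (subst Un) auto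
    finally have W: "mset vs - V' + U' = ?f ?I"
      using fin K by (subst Un) (auto)
    have "winning (?f ?I)" "p \<in> C" using *(5) unfolding W by (auto simp: packing_rule_def split: if_splits)
    moreover have "card ?I = ?m"
    proof -
      have "card ?I = card ({..<?m} - J) + card K" using fin K(1) by (intro card_Un_disjoint) auto
      also have "card ({..<?m} - J) = ?m - card J" using fin J(1) by (simp add: card_Diff_subset)
      also have "card J = card K" using *(3) by (simp add: J(2) K(2))
      finally show ?thesis using card_mono[OF _ J(1)] *(3) by (simp add: J(2) K(2))
    qed
    moreover have "{i\<in>?I. ?m \<le> i} = K" using K(1) by auto
    hence "card {i\<in>?I. ?m \<le> i} \<le> k" using *(4) by (simp add: K(2))
    moreover have "?I \<subseteq> {..<?m + ?l}" using K(1) by auto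
    ultimately show "p \<in> C \<and> (\<exists>I\<subseteq>{..<?m + ?l}. card I = ?m \<and> card {i\<in>I. ?m \<le> i} \<le> k \<and>
       packed I (\<lambda>i. hd ((vs @ us) ! i)))"
      using winning_image_mset[of ?I "nth (vs @ us)"] fin by blast
  next
    assume "p \<in> C \<and> (\<exists>I\<subseteq>{..<?m + ?l}. card I = ?m \<and> card {i\<in>I. ?m \<le> i} \<le> k \<and>
       packed I (\<lambda>i. hd ((vs @ us) ! i)))"
    then obtain I where I: "I \<subseteq> {..<?m + ?l}" "card I = ?m" "card {i\<in>I. ?m \<le> i} \<le> k"
      "packed I (\<lambda>i. hd ((vs @ us) ! i))" and p: "p \<in> C" by blast
    have fin: "finite I" using I(1) finite_subset by blast
    let ?A = "I \<inter> {..<?m}" and ?K = "{i\<in>I. ?m \<le> i}" and ?J = "{..<?m} - I"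
    have IAK: "I = ?A \<union> ?K" by auto
    have cI: "card ?A + card ?K = ?m" using I(2) fin by (subst card_Un_disjoint[symmetric]) (auto simp: IAK[symmetric])
    have "{..<?m} = ?A \<union> ?J" by auto
    hence vs: "mset vs = ?f ?A + ?f ?J" unfolding f(1) using fin by (subst Un[symmetric]) auto
    have us: "?f ?K \<subseteq># mset us" unfolding f(2) using I(1)
      by (intro image_mset_subseteq_mono subset_imp_msubset_mset_set) auto
    have cJ: "card ?J = card ?K"
    proof -
      have "size (mset vs) = card ?A + card ?J" unfolding vs by simp
      thus ?thesis using cI by simp
    qed
    have W: "mset vs - ?f ?J + ?f ?K = ?f I"
    proof -
      have "?f (?A \<union> ?K) = ?f ?A + ?f ?K" using fin by (intro Un) auto
      thus ?thesis unfolding vs IAK[symmetric] by simp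
    qed
    have "p \<in> packing_rule C (mset vs - ?f ?J + ?f ?K)"
      unfolding W packing_rule_def using winning_image_mset[OF fin, of "nth (vs @ us)"] I(4) p by simp
    moreover have "?f ?J \<subseteq># mset vs" unfolding vs by simp
    ultimately show "replacing_possible packing_rule C (mset vs) (mset us) k p"
      unfolding replacing_possible_def using us cJ I(3)
      by (intro exI[of _ "?f ?J"] exI[of _ "?f ?K"]) auto
  qed
qed

subsection \<open>Arithmetic and logic\<close>

definition tr :: "bool list \<Rightarrow> (nat \<Rightarrow> nat) \<Rightarrow> ex \<Rightarrow> bool" where
  "tr x s e \<longleftrightarrow> ev x s e \<noteq> 0"

definition eis :: "ex \<Rightarrow> nat \<Rightarrow> ex" where "eis e c = EIf e c (ES EZ) EZ"
definition enot :: "ex \<Rightarrow> ex" where "enot e = EIf e 3 (ES EZ) EZ"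
definition eand :: "ex \<Rightarrow> ex \<Rightarrow> ex" where "eand a b = EIf a 3 EZ b"
definition eor :: "ex \<Rightarrow> ex \<Rightarrow> ex" where "eor a b = EIf a 3 b (ES EZ)"
text \<open>\<open>v\<close> accumulates the conjunction and \<open>Suc v\<close> is the quantified
  variable. The \<open>length x + 1\<close> rounds cover \<open>0, \<dots>, length x\<close>, hence
  all indices into lists that are parsed from \<open>x\<close>.\<close>

definition eall :: "nat \<Rightarrow> ex \<Rightarrow> ex" where "eall v e = EIter v ETop (ES EZ) (eand (EV v) e)"
definition eex :: "nat \<Rightarrow> ex \<Rightarrow> ex" where "eex v e = enot (eall v (enot e))"
definition eadd :: "ex \<Rightarrow> ex \<Rightarrow> ex" where "eadd a b = EIter 0 b a (ES (EV 0))"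
definition esub :: "ex \<Rightarrow> ex \<Rightarrow> ex" where "esub a b = EIter 0 b a (EP (EV 0))"
definition ele :: "ex \<Rightarrow> ex \<Rightarrow> ex" where "ele a b = enot (esub a b)"
definition eeq :: "ex \<Rightarrow> ex \<Rightarrow> ex" where "eeq a b = eand (ele a b) (ele b a)"
text \<open>A symbol that is read can be tested against constants only, so two of them are compared
  by cases.\<close>

definition esame :: "ex \<Rightarrow> ex \<Rightarrow> ex" where
  "esame a b = EIf a 0 (eis b 0) (EIf a 1 (eis b 1) (EIf a 2 (eis b 2) (eis b 3)))"

lemma iterate_funpow: "iterate (\<lambda>i u. f u) a n = (f ^^ n) a"
  by (induction n) auto

lemma tr_eis [simp]: "tr x s (eis e c) \<longleftrightarrow> rd x (ev x s e) = c"
  by (simp add: tr_def eis_def)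

lemma tr_enot [simp]: "tr x s (enot e) \<longleftrightarrow> \<not> tr x s e"
  by (simp add: tr_def enot_def rd_three)

lemma tr_eand [simp]: "tr x s (eand a b) \<longleftrightarrow> tr x s a \<and> tr x s b"
  by (simp add: tr_def eand_def rd_three)

lemma tr_eor [simp]: "tr x s (eor a b) \<longleftrightarrow> tr x s a \<or> tr x s b"
  by (simp add: tr_def eor_def rd_three)

lemma tr_ELet [simp]: "tr x s (ELet v a b) \<longleftrightarrow> tr x (s(v := ev x s a)) b"
  by (simp add: tr_def)

lemma tr_EIf [simp]: "tr x s (EIf e c a b) \<longleftrightarrow> (if rd x (ev x s e) = c then tr x s a else tr x s b)"
  by (simp add: tr_def)

lemma tr_EV [simp]: "tr x s (EV v) \<longleftrightarrow> s v \<noteq> 0"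
  by (simp add: tr_def)

lemma tr_eall:
  assumes "\<And>u i. i \<le> length x \<Longrightarrow> tr x (s(v := u, Suc v := i)) e \<longleftrightarrow> P i"
  shows "tr x s (eall v e) \<longleftrightarrow> (\<forall>i\<le>length x. P i)"
proof -
  define f where "f = (\<lambda>i u. ev x (s(v := u, Suc v := i)) (eand (EV v) e))"
  have f: "0 < f i u \<longleftrightarrow> 0 < u \<and> P i" if "i \<le> length x" for i u
  proof -
    have "tr x (s(v := u, Suc v := i)) (eand (EV v) e) \<longleftrightarrow> u \<noteq> 0 \<and> P i"
      using assms[OF that, of u] by simp
    thus ?thesis by (simp only: tr_def f_def neq0_conv)
  qed
  have "n \<le> length x + 1 \<Longrightarrow> iterate f 1 n \<noteq> 0 \<longleftrightarrow> (\<forall>i<n. P i)" for n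
    by (induction n) (auto simp: f less_Suc_eq)
  from this[of "length x + 1"] show ?thesis
    by (simp add: tr_def eall_def f_def less_Suc_eq_le)
qed

lemma tr_eex:
  assumes "\<And>u i. i \<le> length x \<Longrightarrow> tr x (s(v := u, Suc v := i)) e \<longleftrightarrow> P i"
  shows "tr x s (eex v e) \<longleftrightarrow> (\<exists>i\<le>length x. P i)"
  unfolding eex_def tr_enot by (subst tr_eall[where P = "\<lambda>i. \<not> P i"]) (auto simp: assms)

lemma ev_eadd [simp]:
  assumes "ev x s a \<le> length x + 1"
  shows "ev x s (eadd a b) = min (ev x s a + ev x s b) (length x + 1)"
proof -
  have "((\<lambda>u. min (Suc u) (length x + 1)) ^^ n) (ev x s a) = min (ev x s a + n) (length x + 1)" for n
    using assms by (induction n) auto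
  thus ?thesis by (simp add: eadd_def iterate_funpow)
qed

lemma ev_esub [simp]: "ev x s (esub a b) = ev x s a - ev x s b"
proof -
  have "((\<lambda>u. u - 1) ^^ n) (ev x s a) = ev x s a - n" for n by (induction n) auto
  thus ?thesis by (simp add: esub_def iterate_funpow)
qed

lemma tr_esub [simp]: "tr x s (esub a b) \<longleftrightarrow> ev x s b < ev x s a"
  by (auto simp: tr_def)

lemma tr_ele [simp]: "tr x s (ele a b) \<longleftrightarrow> ev x s a \<le> ev x s b"
  by (auto simp: ele_def)

lemma tr_eeq [simp]: "tr x s (eeq a b) \<longleftrightarrow> ev x s a = ev x s b"
  by (auto simp: eeq_def)

lemma rd_cases: "rd x v \<in> {0, 1, 2, 3}"
  by (simp add: rd_def)

lemma tr_esame [simp]: "tr x s (esame a b) \<longleftrightarrow> rd x (ev x s a) = rd x (ev x s b)"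
  using rd_cases[of x "ev x s a"] by (auto simp: esame_def)

lemma rd_bit: "rd x v = 1 \<or> rd x v = 2 \<Longrightarrow> 1 \<le> v \<and> v \<le> length x"
  by (auto simp: rd_def split: if_splits)


subsection \<open>Parsing\<close>

text \<open>Positions count from \<open>1\<close>, as the cells behind the end marker do, which
  leaves \<open>0\<close> free to signal failure. What follows the encoded object is left
  open.\<close>

definition codes :: "bool list \<Rightarrow> ('a \<Rightarrow> bool list) \<Rightarrow> nat \<Rightarrow> 'a \<Rightarrow> bool" where
  "codes x e r u \<longleftrightarrow> 1 \<le> r \<and> r \<le> length x + 1 \<and> (\<exists>rest. drop (r - 1) x = e u @ rest)"

text \<open>
  \<open>sk\<close> maps the position of an encoded object to the position behind it, and all other positions to the
  invalid position \<open>0\<close>.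
\<close>

definition parses :: "bool list \<Rightarrow> ('a \<Rightarrow> bool list) \<Rightarrow> (nat \<Rightarrow> nat) \<Rightarrow> bool" where
  "parses x e sk \<longleftrightarrow> (\<forall>r u. codes x e r u \<longrightarrow> sk r = r + length (e u)) \<and>
    (\<forall>r. sk r \<noteq> 0 \<longrightarrow> (\<exists>u. codes x e r u))"

definition skip_bit :: "bool list \<Rightarrow> nat \<Rightarrow> nat" where
  "skip_bit x r = (if rd x r = 1 \<or> rd x r = 2 then r + 1 else 0)"

text \<open>Steps over one element of a list. At the end of the list, and at malformed input, it
  stays where it is, so iterating it too often is harmless and the number of elements need not be
  known.\<close>

definition adv :: "bool list \<Rightarrow> (nat \<Rightarrow> nat) \<Rightarrow> nat \<Rightarrow> nat" where
  "adv x sk v = (if rd x v = 2 \<and> sk (v + 1) \<noteq> 0 then sk (v + 1) else v)"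

definition skip_list :: "bool list \<Rightarrow> (nat \<Rightarrow> nat) \<Rightarrow> nat \<Rightarrow> nat" where
  "skip_list x sk r = (let q = (adv x sk ^^ (length x + 1)) r in if rd x q = 1 then q + 1 else 0)"

definition nthp :: "bool list \<Rightarrow> (nat \<Rightarrow> nat) \<Rightarrow> nat \<Rightarrow> nat \<Rightarrow> nat" where
  "nthp x sk r i = (let q = (adv x sk ^^ i) r in if rd x q = 2 then q + 1 else 0)"

lemma codes_next: "codes x e r u \<Longrightarrow> r + length (e u) \<le> length x + 1"
proof -
  assume "codes x e r u"
  then obtain rest where *: "1 \<le> r" "r \<le> length x + 1" "drop (r - 1) x = e u @ rest"
    by (auto simp: codes_def)
  have "length x - (r - 1) = length (e u) + length rest" using arg_cong[OF *(3), of length] by simp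
  thus ?thesis using *(1,2) by linarith
qed

lemma codes_bit: "codes x (\<lambda>b. [b]) r b \<longleftrightarrow> rd x r = (if b then 2 else 1)"
proof
  assume "codes x (\<lambda>b. [b]) r b"
  then obtain rest where r: "1 \<le> r" "drop (r - 1) x = b # rest" by (auto simp: codes_def)
  have "length x - (r - 1) = Suc (length rest)" using arg_cong[OF r(2), of length] by simp
  moreover have "x ! (r - 1) = b" using r(2) by (rule nth_via_drop)
  ultimately show "rd x r = (if b then 2 else 1)" using r by (auto simp: rd_def)
next
  assume a: "rd x r = (if b then 2 else 1)"
  hence r: "1 \<le> r \<and> r \<le> length x" using rd_bit[of x r] by (auto split: if_splits)
  have "rd x r = (if x ! (r - 1) then 2 else 1)" using r by (simp add: rd_def)
  hence "x ! (r - 1) = b" using a by (cases "x ! (r - 1)"; cases b) simp_all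
  moreover have "r - 1 < length x" using r by linarith
  ultimately have "drop (r - 1) x = [b] @ drop (Suc (r - 1)) x" using Cons_nth_drop_Suc[of "r - 1" x] by simp
  thus "codes x (\<lambda>b. [b]) r b" unfolding codes_def using r by (intro conjI exI) auto
qed

lemma codes_append:
  assumes "1 \<le> r" "r \<le> length x + 1"
  shows "(\<exists>rest. drop (r - 1) x = as @ bs @ rest) \<longleftrightarrow>
    (\<exists>rest. drop (r - 1) x = as @ rest) \<and> r + length as \<le> length x + 1 \<and>
    (\<exists>rest. drop (r + length as - 1) x = bs @ rest)"
proof -
  have d: "drop (r + length as - 1) x = drop (length as) (drop (r - 1) x)" using assms by (simp add: add.commute)
  show ?thesis
  proof
    assume "\<exists>rest. drop (r - 1) x = as @ bs @ rest"
    then obtain rest where *: "drop (r - 1) x = as @ bs @ rest" by blast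
    have "length x - (r - 1) = length as + length bs + length rest"
      using arg_cong[OF *, of length] by simp
    thus "(\<exists>rest. drop (r - 1) x = as @ rest) \<and> r + length as \<le> length x + 1 \<and>
        (\<exists>rest. drop (r + length as - 1) x = bs @ rest)"
      unfolding d using * assms by auto
  next
    assume "(\<exists>rest. drop (r - 1) x = as @ rest) \<and> r + length as \<le> length x + 1 \<and>
        (\<exists>rest. drop (r + length as - 1) x = bs @ rest)"
    then obtain r1 r2 where "drop (r - 1) x = as @ r1" "drop (length as) (drop (r - 1) x) = bs @ r2"
      unfolding d by blast
    thus "\<exists>rest. drop (r - 1) x = as @ bs @ rest" by auto
  qed
qed

lemma codes_list_Nil: "codes x (enc_list e) r [] \<longleftrightarrow> rd x r = 1"
  using codes_bit[of x r False] by (simp add: codes_def enc_list_def)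

lemma codes_list_Cons:
  "codes x (enc_list e) r (u # us) \<longleftrightarrow>
    rd x r = 2 \<and> codes x e (r + 1) u \<and> codes x (enc_list e) (r + 1 + length (e u)) us"
proof (cases "1 \<le> r \<and> r \<le> length x")
  case True
  have "codes x (enc_list e) r (u # us) \<longleftrightarrow>
      (\<exists>rest. drop (r - 1) x = [True] @ (e u @ enc_list e us) @ rest)"
    using True by (simp add: codes_def enc_list_def)
  also have "\<dots> \<longleftrightarrow> codes x (\<lambda>b. [b]) r True \<and> r + 1 \<le> length x + 1 \<and>
      (\<exists>rest. drop (r + 1 - 1) x = e u @ enc_list e us @ rest)"
    using True by (subst codes_append) (auto simp: codes_def)
  also have "(\<exists>rest. drop (r + 1 - 1) x = e u @ enc_list e us @ rest) \<longleftrightarrow>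
     codes x e (r + 1) u \<and> codes x (enc_list e) (r + 1 + length (e u)) us"
    using True by (subst codes_append) (auto simp: codes_def)
  finally show ?thesis using True by (auto simp: codes_bit)
next
  case False
  hence "\<not> codes x (enc_list e) r (u # us)" by (auto simp: codes_def enc_list_def)
  thus ?thesis using False rd_bit[of x r] by auto
qed

lemma parses_bit: "parses x (\<lambda>b. [b]) (skip_bit x)"
  unfolding parses_def codes_bit skip_bit_def
  by (auto intro: exI[of _ True] exI[of _ False] split: if_splits)

lemma parses_codes: "parses x e sk \<Longrightarrow> codes x e r u \<Longrightarrow> sk r = r + length (e u)"
  by (simp add: parses_def)

lemma parses_exists: "parses x e sk \<Longrightarrow> sk r \<noteq> 0 \<Longrightarrow> \<exists>u. codes x e r u"
  unfolding parses_def by blast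

lemma adv_pow:
  assumes "parses x e sk" "codes x (enc_list e) r us" "i \<le> length us"
  shows "codes x (enc_list e) ((adv x sk ^^ i) r) (drop i us)"
  using assms(2,3)
proof (induction i arbitrary: r us)
  case (Suc i)
  then obtain u us' where us: "us = u # us'" by (cases us) auto
  have c: "rd x r = 2" "codes x e (r + 1) u" "codes x (enc_list e) (r + 1 + length (e u)) us'"
    using Suc.prems(1) by (auto simp: us codes_list_Cons)
  have "adv x sk r = r + 1 + length (e u)"
    using c parses_codes[OF assms(1) c(2)] by (simp add: adv_def)
  thus ?case using Suc.IH[of "r + 1 + length (e u)" us'] c(3) Suc.prems(2) by (simp add: us funpow_swap1)
qed simp

lemma adv_pow_end:
  assumes "rd x r \<noteq> 2"
  shows "(adv x sk ^^ i) r = r"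
  using assms by (induction i) (auto simp: adv_def)

lemma adv_pow_stop:
  assumes "parses x e sk" "codes x (enc_list e) r us" "length us \<le> i"
  shows "rd x ((adv x sk ^^ i) r) = 1" "(adv x sk ^^ i) r = (adv x sk ^^ length us) r"
proof -
  have 1: "rd x ((adv x sk ^^ length us) r) = 1"
    using adv_pow[OF assms(1,2), of "length us"] by (simp add: codes_list_Nil)
  show 2: "(adv x sk ^^ i) r = (adv x sk ^^ length us) r"
    using funpow_add_apply[of "length us" "i - length us" "adv x sk" r] assms(3) 1
    by (simp add: adv_pow_end)
  show "rd x ((adv x sk ^^ i) r) = 1" unfolding 2 by (rule 1)
qed

lemma codes_list_length:
  assumes "codes x (enc_list e) r us"
  shows "length us \<le> length x"
proof -
  have "length us \<le> length (enc_list e us)" by (induction us) (auto simp: enc_list_def)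
  moreover have "length us < length (enc_list e us)" by (induction us) (auto simp: enc_list_def)
  ultimately show ?thesis using codes_next[OF assms] assms by (auto simp: codes_def)
qed

lemma adv_pow_value:
  assumes "parses x e sk" "codes x (enc_list e) r us"
  shows "(adv x sk ^^ length us) r = r + length (enc_list e us) - 1"
  using assms(2)
proof (induction us arbitrary: r)
  case Nil
  thus ?case by (simp add: enc_list_def)
next
  case (Cons u us)
  have c: "rd x r = 2" "codes x e (r + 1) u" "codes x (enc_list e) (r + 1 + length (e u)) us"
    using Cons.prems by (auto simp: codes_list_Cons)
  have "adv x sk r = r + 1 + length (e u)"
    using c parses_codes[OF assms(1) c(2)] by (simp add: adv_def)
  thus ?case using Cons.IH[OF c(3)] by (simp add: funpow_swap1) (simp add: enc_list_def)
qed

text \<open>A list has at most \<open>length x\<close> elements, so \<open>length x + 1\<close>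
  rounds of \<open>adv\<close> reach its end. Conversely, when the iteration ends at a
  \<open>False\<close>, the elements it has stepped over form the list.\<close>

lemma parses_list:
  assumes "parses x e sk"
  shows "parses x (enc_list e) (skip_list x sk)"
  unfolding parses_def
proof (intro conjI allI impI)
  fix r us assume c: "codes x (enc_list e) r us"
  have "length us \<le> length x + 1" using codes_list_length[OF c] by simp
  from adv_pow_stop[OF assms c this] show "skip_list x sk r = r + length (enc_list e us)"
    using adv_pow_value[OF assms c] by (simp add: skip_list_def Let_def enc_list_def)
next
  fix r assume "skip_list x sk r \<noteq> 0"
  hence "rd x ((adv x sk ^^ (length x + 1)) r) = 1" by (auto simp: skip_list_def Let_def split: if_splits)
  moreover have "rd x ((adv x sk ^^ i) r) = 1 \<Longrightarrow> \<exists>us. codes x (enc_list e) r us" for i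
  proof (induction i arbitrary: r)
    case 0
    thus ?case by (metis codes_list_Nil funpow_0)
  next
    case (Suc i)
    show ?case
    proof (cases "adv x sk r = r")
      case True
      thus ?thesis using Suc by (simp add: funpow_swap1)
    next
      case False
      hence a: "rd x r = 2" "sk (r + 1) \<noteq> 0" "adv x sk r = sk (r + 1)" by (auto simp: adv_def split: if_splits)
      then obtain u where u: "codes x e (r + 1) u" using parses_exists[OF assms] by blast
      obtain us where "codes x (enc_list e) (adv x sk r) us"
        using Suc.IH[of "adv x sk r"] Suc.prems by (auto simp: funpow_swap1)
      hence "codes x (enc_list e) r (u # us)"
        using a u parses_codes[OF assms u] by (simp add: codes_list_Cons)
      thus ?thesis by blast
    qed
  qed
  ultimately show "\<exists>us. codes x (enc_list e) r us" by blast
qed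

lemma nthp_codes:
  assumes "parses x e sk" "codes x (enc_list e) r us" "i < length us"
  shows "codes x e (nthp x sk r i) (us ! i)"
proof -
  have "codes x (enc_list e) ((adv x sk ^^ i) r) (us ! i # drop (Suc i) us)"
    using adv_pow[OF assms(1,2), of i] assms(3) by (simp add: Cons_nth_drop_Suc)
  thus ?thesis by (simp add: codes_list_Cons nthp_def Let_def)
qed

lemma nthp_zero:
  assumes "parses x e sk" "codes x (enc_list e) r us"
  shows "nthp x sk r i = 0 \<longleftrightarrow> length us \<le> i"
proof (cases "i < length us")
  case True
  thus ?thesis using nthp_codes[OF assms True] by (auto simp: codes_def)
next
  case False
  thus ?thesis using adv_pow_stop(1)[OF assms, of i] by (simp add: nthp_def)
qed

text \<open>Beyond the end of the string the position is \<open>0\<close>, which reads as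
  \<open>3\<close>. So comparing two strings symbol by symbol also compares their lengths.\<close>

lemma rd_nthp_bit:
  assumes "codes x enc_string r u"
  shows "rd x (nthp x (skip_bit x) r i) = (if i < length u then if u ! i then 2 else 1 else 3)"
proof (cases "i < length u")
  case True
  thus ?thesis using nthp_codes[OF parses_bit assms[unfolded enc_string_def] True] by (simp add: codes_bit)
next
  case False
  hence "nthp x (skip_bit x) r i = 0"
    using nthp_zero[OF parses_bit assms[unfolded enc_string_def]] by simp
  thus ?thesis using False by (simp add: rd_def)
qed

definition eskip_bit :: "nat \<Rightarrow> ex" where
  "eskip_bit i = EIf (EV i) 1 (ES (EV i)) (EIf (EV i) 2 (ES (EV i)) EZ)"

definition eadv :: "nat \<Rightarrow> (nat \<Rightarrow> ex) \<Rightarrow> ex" where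
  "eadv B sk = EIf (EV B) 2 (ELet (B + 2) (ES (EV B)) (ELet (B + 3) (sk (B + 2))
     (EIf (EV (B + 3)) 3 (EV B) (EV (B + 3))))) (EV B)"

definition eskip :: "nat \<Rightarrow> (nat \<Rightarrow> ex) \<Rightarrow> nat \<Rightarrow> ex" where
  "eskip B sk i = ELet (B + 2) (EIter B ETop (EV i) (eadv B sk))
     (EIf (EV (B + 2)) 1 (ES (EV (B + 2))) EZ)"

definition enth :: "nat \<Rightarrow> (nat \<Rightarrow> ex) \<Rightarrow> nat \<Rightarrow> nat \<Rightarrow> ex" where
  "enth B sk i j = ELet (B + 2) (EIter B (EV j) (EV i) (eadv B sk))
     (EIf (EV (B + 2)) 2 (ES (EV (B + 2))) EZ)"

text \<open>
  \<open>computes x B e f\<close>: the expression \<open>e i\<close> applies \<open>f\<close> to the variable \<open>i\<close>. It uses only variables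
  from \<open>B\<close> onwards for itself, so \<open>i\<close> must be smaller.
\<close>

definition computes :: "bool list \<Rightarrow> nat \<Rightarrow> (nat \<Rightarrow> ex) \<Rightarrow> (nat \<Rightarrow> nat) \<Rightarrow> bool" where
  "computes x B e f \<longleftrightarrow> (\<forall>s i. i < B \<longrightarrow> ev x s (e i) = f (s i))"

lemma ev_inc_bit: "rd x (ev x s e) = 1 \<or> rd x (ev x s e) = 2 \<Longrightarrow> ev x s (ES e) = ev x s e + 1"
  using rd_bit by fastforce

lemma computes_skip_bit: "computes x B eskip_bit (skip_bit x)"
  unfolding computes_def eskip_bit_def skip_bit_def
  using ev_inc_bit by (auto simp del: ev.simps(4))

lemma ev_eadv:
  assumes "computes x C e sk" "B + 4 \<le> C"
  shows "ev x s (eadv B e) = adv x sk (s B)"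
proof (cases "rd x (s B) = 2")
  case True
  hence "s B \<le> length x" using rd_bit by blast
  thus ?thesis using assms True
    by (simp add: eadv_def adv_def computes_def min_def rd_three)
next
  case False
  thus ?thesis by (simp add: eadv_def adv_def)
qed

lemma computes_skip:
  assumes "computes x C e sk" "B + 4 \<le> C"
  shows "computes x B (eskip B e) (skip_list x sk)"
proof -
  have inc: "rd x q = Suc 0 \<Longrightarrow> min q (length x) = q" for q using rd_bit[of x q] by simp
  show ?thesis unfolding computes_def eskip_def skip_list_def
    by (simp add: ev_eadv[OF assms] iterate_funpow Let_def inc)
qed

lemma ev_enth:
  assumes "computes x C e sk" "B + 4 \<le> C" "i < B" "j < B"
  shows "ev x s (enth B e i j) = nthp x sk (s i) (s j)"
proof -
  have inc: "rd x q = 2 \<Longrightarrow> min q (length x) = q" for q using rd_bit[of x q] by simp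
  show ?thesis unfolding enth_def nthp_def using assms(3,4)
    by (simp add: ev_eadv[OF assms(1,2)] iterate_funpow Let_def inc)
qed

subsection \<open>Predicates on encoded lists\<close>

definition "skip_string x = skip_list x (skip_bit x)"
definition "skip_strings x = skip_list x (skip_string x)"
definition "skip_votes x = skip_list x (skip_strings x)"

text \<open>A parser must use variables above those of the parsers that call it, since
  \<open>computes\<close> protects only smaller ones; hence the bases decrease from strings to lists
  of strings to votes. Every level needs four variables.\<close>

definition "estr = eskip 300 eskip_bit"
definition "estrs = eskip 280 estr"
definition "evotes = eskip 260 estrs"

lemma parses_string: "parses x enc_string (skip_string x)"
  unfolding enc_string_def skip_string_def by (intro parses_list parses_bit)

lemma parses_strings: "parses x (enc_list enc_string) (skip_strings x)"
  unfolding skip_strings_def by (intro parses_list parses_string)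

lemma parses_votes: "parses x enc_votes (skip_votes x)"
  unfolding skip_votes_def enc_votes_def by (intro parses_list parses_strings)

lemma computes_string: "computes x 300 estr (skip_string x)"
  unfolding estr_def skip_string_def by (rule computes_skip[OF computes_skip_bit[of x 304]]) simp

lemma computes_strings: "computes x 280 estrs (skip_strings x)"
  unfolding estrs_def skip_strings_def by (rule computes_skip[OF computes_string]) simp

lemma computes_votes: "computes x 260 evotes (skip_votes x)"
  unfolding evotes_def skip_votes_def by (rule computes_skip[OF computes_strings]) simp

lemma ev_skips [simp]:
  "i < 300 \<Longrightarrow> ev x s (estr i) = skip_string x (s i)"
  "i < 280 \<Longrightarrow> ev x s (estrs i) = skip_strings x (s i)"
  "i < 260 \<Longrightarrow> ev x s (evotes i) = skip_votes x (s i)"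
  using computes_string computes_strings computes_votes unfolding computes_def by blast+

definition "enth_bit = enth 320 eskip_bit"
definition "enth_str = enth 270 estr"
definition "enth_vote = enth 250 estrs"

lemma ev_nths [simp]:
  "i < 320 \<Longrightarrow> j < 320 \<Longrightarrow> ev x s (enth_bit i j) = nthp x (skip_bit x) (s i) (s j)"
  "i < 270 \<Longrightarrow> j < 270 \<Longrightarrow> ev x s (enth_str i j) = nthp x (skip_string x) (s i) (s j)"
  "i < 250 \<Longrightarrow> j < 250 \<Longrightarrow> ev x s (enth_vote i j) = nthp x (skip_strings x) (s i) (s j)"
  unfolding enth_bit_def enth_str_def enth_vote_def
  using ev_enth[OF computes_skip_bit[of x 324], of 320] ev_enth[OF computes_string, of 270]
    ev_enth[OF computes_strings, of 250] by simp_all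

text \<open>The predicates follow the same discipline: the loop variables of a predicate lie above
  all variables of the predicates that call it and below those of the parsers.\<close>

definition estreq :: "nat \<Rightarrow> nat \<Rightarrow> ex" where
  "estreq i j = eall 240 (esame (enth_bit i 241) (enth_bit j 241))"

text \<open>The quantifiers range over all indices up to \<open>length x\<close>. Those beyond the
  end of the list give the position \<open>0\<close>, which counts as false and filters them out;
  the predicates below use this too.\<close>

definition emem :: "nat \<Rightarrow> nat \<Rightarrow> ex" where
  "emem p q = eex 210 (ELet 212 (enth_str q 211) (eand (EV 212) (estreq p 212)))"

definition edistinct :: "nat \<Rightarrow> ex" where
  "edistinct q = eall 220 (eall 222 (eor (eeq (EV 221) (EV 223))
     (ELet 224 (enth_str q 221) (ELet 225 (enth_str q 223)
       (eor (enot (EV 224)) (eor (enot (EV 225)) (enot (estreq 224 225))))))))"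

definition esubset :: "nat \<Rightarrow> nat \<Rightarrow> ex" where
  "esubset q r = eall 200 (ELet 202 (enth_str q 201) (eor (enot (EV 202)) (emem 202 r)))"

definition eperm :: "nat \<Rightarrow> nat \<Rightarrow> ex" where
  "eperm q c = eand (edistinct q) (eand (esubset q c) (esubset c q))"

definition eelection :: "nat \<Rightarrow> nat \<Rightarrow> ex" where
  "eelection v c = eall 180 (ELet 182 (enth_vote v 181) (eor (enot (EV 182)) (eperm 182 c)))"

definition econf :: "nat \<Rightarrow> nat \<Rightarrow> ex" where
  "econf i j = eex 240 (eand (eis (enth_bit i 241) 2) (eis (enth_bit j 241) 2))"

definition enonempty :: "nat \<Rightarrow> ex" where
  "enonempty i = eex 240 (eis (enth_bit i 241) 2)"

definition ehd :: "nat \<Rightarrow> ex" where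
  "ehd i = ELet 230 EZ (enth_str i 230)"

text \<open>\<open>vp\<close> locates the vote with a given index and returns \<open>0\<close> if
  that vote does not take part. For bribery all votes take part, for control those that the
  certificate selects.\<close>

definition epacked :: "(nat \<Rightarrow> ex) \<Rightarrow> ex" where
  "epacked vp = eall 140 (ELet 142 (vp 141) (eor (enot (EV 142)) (ELet 143 (ehd 142)
     (eand (enonempty 143) (eall 144 (eor (eeq (EV 141) (EV 145)) (ELet 146 (vp 145) (eor (enot (EV 146))
       (ELet 147 (ehd 146) (enot (econf 143 147)))))))))))"

definition ecanonical :: "nat \<Rightarrow> nat \<Rightarrow> ex" where
  "ecanonical i j = eor (eis (EV i) 1) (eis (EP (EP (EV j))) 2)"

lemma codes_string_length: "codes x enc_string r u \<Longrightarrow> length u \<le> length x"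
  unfolding enc_string_def by (rule codes_list_length)

lemma tr_estreq:
  assumes "codes x enc_string (s i) u" "codes x enc_string (s j) v" "i < 240" "j < 240"
  shows "tr x s (estreq i j) \<longleftrightarrow> u = v"
proof -
  have "tr x s (estreq i j) \<longleftrightarrow>
      (\<forall>k\<le>length x. rd x (nthp x (skip_bit x) (s i) k) = rd x (nthp x (skip_bit x) (s j) k))"
    unfolding estreq_def using assms(3,4) by (intro tr_eall) simp
  also have "\<dots> \<longleftrightarrow> u = v"
  proof
    assume *: "\<forall>k\<le>length x. rd x (nthp x (skip_bit x) (s i) k) = rd x (nthp x (skip_bit x) (s j) k)"
    have eq: "(if k < length u then if u ! k then 2 else 1 else 3 :: nat) =
        (if k < length v then if v ! k then 2 else 1 else 3)" if "k \<le> length x" for k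
      using *[rule_format, OF that] unfolding rd_nthp_bit[OF assms(1)] rd_nthp_bit[OF assms(2)] .
    have "length u \<le> length v" "length v \<le> length u"
      using eq[of "length v"] eq[of "length u"] codes_string_length[OF assms(1)] codes_string_length[OF assms(2)]
      by (auto split: if_splits)
    moreover have "u ! k = v ! k" if "k < length u" "k < length v" for k
      using eq[of k] that codes_string_length[OF assms(1)] by (auto split: if_splits)
    ultimately show "u = v" by (simp add: list_eq_iff_nth_eq)
  next
    assume "u = v"
    thus "\<forall>k\<le>length x. rd x (nthp x (skip_bit x) (s i) k) = rd x (nthp x (skip_bit x) (s j) k)"
      by (simp only: rd_nthp_bit[OF assms(1)] rd_nthp_bit[OF assms(2)]) simp
  qed
  finally show ?thesis .
qed

lemma nthp_string:
  assumes "codes x (enc_list enc_string) r us"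
  shows "nthp x (skip_string x) r i = 0 \<longleftrightarrow> length us \<le> i"
    "i < length us \<Longrightarrow> codes x enc_string (nthp x (skip_string x) r i) (us ! i)"
  using nthp_zero[OF parses_string assms] nthp_codes[OF parses_string assms] by auto

lemma tr_emem:
  assumes p: "codes x enc_string (s p) u" and q: "codes x (enc_list enc_string) (s q) us" and "p < 210" "q < 210"
  shows "tr x s (emem p q) \<longleftrightarrow> u \<in> set us"
proof -
  have "tr x s (emem p q) \<longleftrightarrow> (\<exists>i\<le>length x. i < length us \<and> u = us ! i)"
    unfolding emem_def
  proof (rule tr_eex)
    fix n i
    let ?a = "nthp x (skip_string x) (s q) i"
    let ?s = "s(210 := n, Suc 210 := i, 212 := ?a)"
    have "tr x ?s (estreq p 212) \<longleftrightarrow> u = us ! i" if "i < length us"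
      using assms nthp_string(2)[OF q that] by (intro tr_estreq) auto
    thus "tr x (s(210 := n, Suc 210 := i)) (ELet 212 (enth_str q 211) (eand (EV 212) (estreq p 212))) \<longleftrightarrow>
        i < length us \<and> u = us ! i"
      using assms(4) nthp_string(1)[OF q, of i] by auto
  qed
  also have "\<dots> \<longleftrightarrow> u \<in> set us"
    using codes_list_length[OF q] by (auto simp: in_set_conv_nth intro: less_imp_le order.trans)
  finally show ?thesis .
qed

lemma tr_edistinct:
  assumes q: "codes x (enc_list enc_string) (s q) us" and "q < 220"
  shows "tr x s (edistinct q) \<longleftrightarrow> distinct us"
proof -
  have "tr x s (edistinct q) \<longleftrightarrow>
      (\<forall>i\<le>length x. \<forall>j\<le>length x. i = j \<or> length us \<le> i \<or> length us \<le> j \<or> us ! i \<noteq> us ! j)"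
    unfolding edistinct_def
  proof (intro tr_eall)
    fix n i m j
    let ?a = "\<lambda>i. nthp x (skip_string x) (s q) i"
    let ?s = "s(220 := n, Suc 220 := i, 222 := m, Suc 222 := j, 224 := ?a i, 225 := ?a j)"
    have "tr x ?s (estreq 224 225) \<longleftrightarrow> us ! i = us ! j" if "i < length us" "j < length us"
      using nthp_string(2)[OF q that(1)] nthp_string(2)[OF q that(2)] by (intro tr_estreq) auto
    thus "tr x (s(220 := n, Suc 220 := i, 222 := m, Suc 222 := j)) (eor (eeq (EV 221) (EV 223))
       (ELet 224 (enth_str q 221) (ELet 225 (enth_str q 223)
       (eor (enot (EV 224)) (eor (enot (EV 225)) (enot (estreq 224 225))))))) \<longleftrightarrow>
       i = j \<or> length us \<le> i \<or> length us \<le> j \<or> us ! i \<noteq> us ! j"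
      using assms(2) nthp_string(1)[OF q, of i] nthp_string(1)[OF q, of j] by auto
  qed
  also have "\<dots> \<longleftrightarrow> distinct us"
    using codes_list_length[OF q] unfolding distinct_conv_nth by (meson less_imp_le not_le order.trans)
  finally show ?thesis .
qed

lemma tr_esubset:
  assumes q: "codes x (enc_list enc_string) (s q) us" and r: "codes x (enc_list enc_string) (s r) vs"
    and "q < 200" "r < 200"
  shows "tr x s (esubset q r) \<longleftrightarrow> set us \<subseteq> set vs"
proof -
  have "tr x s (esubset q r) \<longleftrightarrow> (\<forall>i\<le>length x. length us \<le> i \<or> us ! i \<in> set vs)"
    unfolding esubset_def
  proof (rule tr_eall)
    fix n i
    let ?a = "nthp x (skip_string x) (s q) i"
    let ?s = "s(200 := n, Suc 200 := i, 202 := ?a)"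
    have "tr x ?s (emem 202 r) \<longleftrightarrow> us ! i \<in> set vs" if "i < length us"
      using assms nthp_string(2)[OF q that] by (intro tr_emem) auto
    thus "tr x (s(200 := n, Suc 200 := i)) (ELet 202 (enth_str q 201) (eor (enot (EV 202)) (emem 202 r))) \<longleftrightarrow>
        length us \<le> i \<or> us ! i \<in> set vs"
      using assms(3) nthp_string(1)[OF q, of i] by auto
  qed
  also have "\<dots> \<longleftrightarrow> set us \<subseteq> set vs"
    unfolding subset_eq all_set_conv_all_nth using codes_list_length[OF q] by (meson less_imp_le not_le order.trans)
  finally show ?thesis .
qed

lemma tr_eperm:
  assumes "codes x (enc_list enc_string) (s q) us" "codes x (enc_list enc_string) (s c) cs" "q < 200" "c < 200"
  shows "tr x s (eperm q c) \<longleftrightarrow> us \<in> permutations_of_set (set cs)"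
  unfolding eperm_def permutations_of_set_def
  using assms by (auto simp: tr_edistinct tr_esubset)

lemma nthp_vote:
  assumes "codes x enc_votes r vs"
  shows "nthp x (skip_strings x) r i = 0 \<longleftrightarrow> length vs \<le> i"
    "i < length vs \<Longrightarrow> codes x (enc_list enc_string) (nthp x (skip_strings x) r i) (vs ! i)"
  using nthp_zero[OF parses_strings assms[unfolded enc_votes_def]]
    nthp_codes[OF parses_strings assms[unfolded enc_votes_def]] by auto

lemma tr_eelection:
  assumes v: "codes x enc_votes (s v) vs" and c: "codes x (enc_list enc_string) (s c) cs" and "v < 180" "c < 180"
  shows "tr x s (eelection v c) \<longleftrightarrow> election (set cs) (mset vs)"
proof -
  have "tr x s (eelection v c) \<longleftrightarrow> (\<forall>i\<le>length x. length vs \<le> i \<or> vs ! i \<in> permutations_of_set (set cs))"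
    unfolding eelection_def
  proof (rule tr_eall)
    fix n i
    let ?a = "nthp x (skip_strings x) (s v) i"
    let ?s = "s(180 := n, Suc 180 := i, 182 := ?a)"
    have "tr x ?s (eperm 182 c) \<longleftrightarrow> vs ! i \<in> permutations_of_set (set cs)" if "i < length vs"
      using assms nthp_vote(2)[OF v that] by (intro tr_eperm) auto
    thus "tr x (s(180 := n, Suc 180 := i)) (ELet 182 (enth_vote v 181) (eor (enot (EV 182)) (eperm 182 c))) \<longleftrightarrow>
        length vs \<le> i \<or> vs ! i \<in> permutations_of_set (set cs)"
      using assms(3) nthp_vote(1)[OF v, of i] by auto
  qed
  also have "\<dots> \<longleftrightarrow> election (set cs) (mset vs)"
    using codes_list_length[OF v[unfolded enc_votes_def]]
    by (simp add: election_def subset_eq all_set_conv_all_nth) (meson less_imp_le not_le order.trans)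
  finally show ?thesis .
qed

lemma tr_econf:
  assumes "codes x enc_string (s i) u" "codes x enc_string (s j) v" "i < 240" "j < 240"
  shows "tr x s (econf i j) \<longleftrightarrow> conflict u v"
proof -
  have "tr x s (econf i j) \<longleftrightarrow>
      (\<exists>k\<le>length x. rd x (nthp x (skip_bit x) (s i) k) = 2 \<and> rd x (nthp x (skip_bit x) (s j) k) = 2)"
    unfolding econf_def using assms(3,4) by (intro tr_eex) simp
  also have "\<dots> \<longleftrightarrow> conflict u v"
    unfolding rd_nthp_bit[OF assms(1)] rd_nthp_bit[OF assms(2)] conflict_def
    using codes_string_length[OF assms(1)] by (auto split: if_splits intro: less_imp_le order.trans)
  finally show ?thesis .
qed

lemma tr_enonempty:
  assumes "codes x enc_string (s i) u" "i < 240"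
  shows "tr x s (enonempty i) \<longleftrightarrow> True \<in> set u"
proof -
  have "tr x s (enonempty i) \<longleftrightarrow> (\<exists>k\<le>length x. rd x (nthp x (skip_bit x) (s i) k) = 2)"
    unfolding enonempty_def using assms(2) by (intro tr_eex) simp
  also have "\<dots> \<longleftrightarrow> True \<in> set u"
    unfolding rd_nthp_bit[OF assms(1)]
    using codes_string_length[OF assms(1)]
    by (auto simp: in_set_conv_nth split: if_splits intro: less_imp_le order.trans)
  finally show ?thesis .
qed

lemma ev_ehd: "i < 230 \<Longrightarrow> ev x s (ehd i) = nthp x (skip_string x) (s i) 0"
  by (simp add: ehd_def)

lemma tr_epacked:
  assumes vp: "\<And>t i. (\<And>r. r < 140 \<Longrightarrow> t r = s r) \<Longrightarrow> i = 141 \<or> i = 145 \<Longrightarrow> ev x t (vp i) = p (t i)"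
    and v: "\<And>i. p i \<noteq> 0 \<Longrightarrow> codes x (enc_list enc_string) (p i) (v i) \<and> v i \<noteq> []"
  shows "tr x s (epacked vp) \<longleftrightarrow> packed {i. i \<le> length x \<and> p i \<noteq> 0} (\<lambda>i. hd (v i))"
proof -
  have hd: "codes x enc_string (nthp x (skip_string x) (p i) 0) (hd (v i))" if "p i \<noteq> 0" for i
    using nthp_string(2)[of x "p i" "v i" 0] v[OF that] by (simp add: hd_conv_nth)
  have "tr x s (epacked vp) \<longleftrightarrow> (\<forall>i\<le>length x. p i = 0 \<or> True \<in> set (hd (v i)) \<and>
      (\<forall>j\<le>length x. i = j \<or> p j = 0 \<or> \<not> conflict (hd (v i)) (hd (v j))))"
    unfolding epacked_def
  proof (rule tr_eall)
    fix n i
    let ?h = "\<lambda>i. nthp x (skip_string x) (p i) 0"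
    let ?s = "s(140 := n, Suc 140 := i, 142 := p i, 143 := ?h i)"
    have 1: "ev x (s(140 := n, Suc 140 := i)) (vp 141) = p i"
      by (subst vp) auto
    have 2: "tr x ?s (enonempty 143) \<longleftrightarrow> True \<in> set (hd (v i))" if "p i \<noteq> 0"
      using hd[OF that] by (intro tr_enonempty) auto
    have 3: "tr x ?s (eall 144 (eor (eeq (EV 141) (EV 145)) (ELet 146 (vp 145) (eor (enot (EV 146))
       (ELet 147 (ehd 146) (enot (econf 143 147))))))) \<longleftrightarrow>
       (\<forall>j\<le>length x. i = j \<or> p j = 0 \<or> \<not> conflict (hd (v i)) (hd (v j)))" if pi: "p i \<noteq> 0"
    proof (rule tr_eall)
      fix m j
      let ?t = "?s(144 := m, Suc 144 := j)"
      have "ev x ?t (vp 145) = p j" by (subst vp) auto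
      moreover have "tr x (?t(146 := p j, 147 := ?h j)) (econf 143 147) \<longleftrightarrow> conflict (hd (v i)) (hd (v j))"
        if "p j \<noteq> 0"
        using hd[OF pi] hd[OF that] by (intro tr_econf) auto
      ultimately show "tr x ?t (eor (eeq (EV 141) (EV 145)) (ELet 146 (vp 145) (eor (enot (EV 146))
         (ELet 147 (ehd 146) (enot (econf 143 147)))))) \<longleftrightarrow>
         (i = j \<or> p j = 0 \<or> \<not> conflict (hd (v i)) (hd (v j)))"
        by (auto simp: ev_ehd)
    qed
    show "tr x (s(140 := n, Suc 140 := i)) (ELet 142 (vp 141) (eor (enot (EV 142)) (ELet 143 (ehd 142)
        (eand (enonempty 143) (eall 144 (eor (eeq (EV 141) (EV 145)) (ELet 146 (vp 145) (eor (enot (EV 146))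
        (ELet 147 (ehd 146) (enot (econf 143 147))))))))))) \<longleftrightarrow>
        p i = 0 \<or> True \<in> set (hd (v i)) \<and>
        (\<forall>j\<le>length x. i = j \<or> p j = 0 \<or> \<not> conflict (hd (v i)) (hd (v j)))"
      using 2 3 by (cases "p i = 0") (simp_all add: 1[simplified] ev_ehd)
  qed
  moreover have "(\<forall>j\<le>length x. i = j \<or> p j = 0 \<or> \<not> conflict (hd (v i)) (hd (v j))) \<longleftrightarrow>
      (\<forall>j\<in>{j. j \<le> length x \<and> p j \<noteq> 0}. i \<noteq> j \<longrightarrow> \<not> conflict (hd (v i)) (hd (v j)))" for i
    unfolding Ball_def mem_Collect_eq by (intro all_cong1) satx
  moreover have "(\<forall>i\<le>length x. p i = 0 \<or> R i) \<longleftrightarrow> (\<forall>i\<in>{i. i \<le> length x \<and> p i \<noteq> 0}. R i)" for R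
    unfolding Ball_def mem_Collect_eq by (intro all_cong1) satx
  ultimately show ?thesis by (simp only: packed_def)
qed


subsection \<open>Instances\<close>

lemma last_bin_of_nat: "bin_of_nat k = [] \<or> last (bin_of_nat k)"
proof (induction k rule: bin_of_nat.induct)
  case (1 n)
  show ?case
  proof (cases "n = 0")
    case False
    hence "bin_of_nat (n div 2) = [] \<or> last (bin_of_nat (n div 2))" by (rule 1)
    moreover have "bin_of_nat (n div 2) = [] \<Longrightarrow> odd n"
      using False by (subst (asm) bin_of_nat.simps) (auto split: if_splits elim: oddE)
    ultimately show ?thesis using False by (subst (1 2) bin_of_nat.simps) auto
  qed (simp add: bin_of_nat.simps)
qed

fun val :: "bool list \<Rightarrow> nat" where
  "val [] = 0"
| "val (b # bs) = of_bool b + 2 * val bs"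

lemma val_bin_of_nat [simp]: "val (bin_of_nat k) = k"
proof (induction k rule: bin_of_nat.induct)
  case (1 n)
  thus ?case by (subst bin_of_nat.simps) (auto simp: of_bool_def elim: oddE evenE)
qed

lemma bin_of_nat_val: "bs = [] \<or> last bs \<Longrightarrow> bin_of_nat (val bs) = bs"
proof (induction bs)
  case (Cons b bs)
  have IH: "bin_of_nat (val bs) = bs" using Cons by (cases bs) auto
  have "val (b # bs) \<noteq> 0"
  proof (cases bs)
    case Nil
    thus ?thesis using Cons.prems by simp
  next
    case (Cons a as)
    thus ?thesis using IH by (metis bin_of_nat.simps list.discI val.simps(2) add_is_0 mult_is_0 zero_neq_numeral)
  qed
  thus ?case using IH by (subst bin_of_nat.simps) (auto simp: of_bool_def)
qed (simp add: bin_of_nat.simps)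

text \<open>Numerals are exactly the strings that are empty or end in \<open>True\<close>. Thus a
  quantifier over numbers becomes one over strings with a condition that a parser can check.\<close>

lemma ex_enc_nat: "(\<exists>k. R (enc_nat k) k) \<longleftrightarrow> (\<exists>bs. (bs = [] \<or> last bs) \<and> R (enc_string bs) (val bs))"
  unfolding enc_nat_def by (metis bin_of_nat_val last_bin_of_nat val_bin_of_nat)

text \<open>In contrast to \<open>codes\<close> it fixes the whole remaining input, so an instance
  can be peeled off component by component.\<close>

definition suffix_at :: "bool list \<Rightarrow> nat \<Rightarrow> bool list \<Rightarrow> bool" where
  "suffix_at x r w \<longleftrightarrow> 1 \<le> r \<and> r \<le> length x + 1 \<and> drop (r - 1) x = w"

lemma suffix_at_start: "x = w \<longleftrightarrow> suffix_at x 1 w"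
  by (auto simp: suffix_at_def)

lemma suffix_at_append:
  assumes "parses x e sk"
  shows "suffix_at x r (e u @ w) \<longleftrightarrow> codes x e r u \<and> suffix_at x (sk r) w"
proof (cases "1 \<le> r \<and> r \<le> length x + 1")
  case True
  define D where "D = drop (r - 1) x"
  have d: "drop (r + length (e u) - 1) x = drop (length (e u)) D" using True by (simp add: D_def add.commute)
  have "suffix_at x r (e u @ w) \<longleftrightarrow> codes x e r u \<and> drop (r + length (e u) - 1) x = w"
    unfolding d suffix_at_def codes_def D_def[symmetric] using True by auto
  also have "\<dots> \<longleftrightarrow> codes x e r u \<and> suffix_at x (sk r) w"
    using parses_codes[OF assms, of r u] codes_next[of x e r u] True by (auto simp: suffix_at_def)
  finally show ?thesis .
next
  case False
  thus ?thesis by (auto simp: suffix_at_def codes_def)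
qed

lemma suffix_at_end: "codes x e r u \<Longrightarrow> parses x e sk \<Longrightarrow> suffix_at x (sk r) [] \<longleftrightarrow> rd x (sk r) = 0"
  using codes_next[of x e r u] parses_codes[of x e sk r u] by (auto simp: suffix_at_def rd_zero)

lemma tr_ecanonical:
  assumes "codes x enc_string (s i) bs" "s j = s i + length (enc_string bs)"
  shows "tr x s (ecanonical i j) \<longleftrightarrow> bs = [] \<or> last bs"
proof (cases bs rule: rev_cases)
  case Nil
  thus ?thesis using assms(1) codes_list_Nil[of x "\<lambda>b. [b]" "s i"] by (simp add: ecanonical_def enc_string_def)
next
  case (snoc bs' b)
  let ?p = "concat (map (\<lambda>x. [True, x]) bs')"
  have len: "length (enc_string bs) = length ?p + 3" by (simp add: snoc enc_string_def enc_list_def)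
  obtain rest where *: "1 \<le> s i" "drop (s i - 1) x = enc_string bs @ rest"
    using assms(1) by (auto simp: codes_def)
  have "drop (s i - 1) x = (?p @ [True]) @ b # False # rest"
    unfolding *(2) by (simp add: snoc enc_string_def enc_list_def)
  hence "drop (length (?p @ [True])) (drop (s i - 1) x) = b # False # rest" by (metis append_eq_conv_conj)
  hence d: "drop (s i + length ?p) x = b # False # rest" using *(1) by (simp add: add.commute)
  hence "s i + length ?p < length x" by (metis drop_all list.discI not_le)
  hence "rd x (s j - 2) = (if b then 2 else 1)"
    using nth_via_drop[OF d] by (simp add: rd_def assms(2) len)
  moreover have "rd x (s i) \<noteq> 1"
    using assms(1) codes_list_Cons[of x "\<lambda>b. [b]" "s i" "hd bs" "tl bs"] by (simp add: snoc enc_string_def)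
  ultimately show ?thesis by (cases b) (simp_all add: ecanonical_def snoc numeral_2_eq_2)
qed

lemma skip_list_zero [simp]: "skip_list x sk 0 = 0"
  unfolding skip_list_def by (subst adv_pow_end) (simp_all add: rd_def)

text \<open>A failing parser returns \<open>0\<close>, and the later ones pass it on. Hence the one
  test that the last component stops at the end of the input also detects every earlier syntax
  error. As bribery is useless, \<open>winning\<close> is evaluated on the given votes.\<close>

definition ebribery :: ex where
  "ebribery = ELet 10 (ES EZ) (ELet 11 (estrs 10) (ELet 12 (evotes 11) (ELet 13 (estr 12) (ELet 14 (estr 13)
     (eand (eis (EV 14) 0) (eand (ecanonical 12 13) (eand (edistinct 10) (eand (eelection 11 10)
     (eand (emem 13 10) (epacked (enth_vote 11)))))))))))"

lemma tr_epacked_votes: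
  assumes "codes x enc_votes (s q) vs" "[] \<notin> set vs" "q < 140"
  shows "tr x s (epacked (enth_vote q)) \<longleftrightarrow> winning (mset vs)"
proof -
  let ?p = "nthp x (skip_strings x) (s q)"
  have "tr x s (epacked (enth_vote q)) \<longleftrightarrow> packed {i. i \<le> length x \<and> ?p i \<noteq> 0} (\<lambda>i. hd (vs ! i))"
  proof (rule tr_epacked)
    fix i assume "?p i \<noteq> 0"
    hence "i < length vs" using nthp_vote(1)[OF assms(1)] by (meson not_le)
    thus "codes x (enc_list enc_string) (?p i) (vs ! i) \<and> vs ! i \<noteq> []"
      using nthp_vote(2)[OF assms(1)] assms(2) nth_mem by metis
  qed (use assms(3) in auto)
  also have "{i. i \<le> length x \<and> ?p i \<noteq> 0} = {..<length vs}"
    using codes_list_length[OF assms(1)[unfolded enc_votes_def]] nthp_vote(1)[OF assms(1)]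
    by (auto simp: not_le intro: less_imp_le order.trans)
  finally show ?thesis by (simp only: winning_mset)
qed

lemma election_votes_nonempty: "election C (mset vs) \<Longrightarrow> p \<in> C \<Longrightarrow> [] \<notin> set vs"
  by (auto simp: election_def permutations_of_set_def)

lemma conformant_bribery_iff_tr: "x \<in> conformant_bribery packing_rule \<longleftrightarrow> tr x (\<lambda>_. 0) ebribery"
proof -
  define r1 where "r1 = skip_strings x 1"
  define r2 where "r2 = skip_votes x r1"
  define r3 where "r3 = skip_string x r2"
  define r4 where "r4 = skip_string x r3"
  define s :: "nat \<Rightarrow> nat" where "s = (\<lambda>_. 0)(10 := 1, 11 := r1, 12 := r2, 13 := r3, 14 := r4)"
  note r_defs = r1_def r2_def r3_def r4_def
  note ps = parses_strings[of x] parses_votes[of x] parses_string[of x]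
  define Q where "Q = (\<lambda>cs vs bs p. (bs = [] \<or> last bs) \<and> distinct cs \<and> election (set cs) (mset vs) \<and>
    p \<in> set cs \<and> winning (mset vs))"
  define parsed where "parsed = (\<lambda>cs vs bs p. codes x (enc_list enc_string) 1 cs \<and> codes x enc_votes r1 vs \<and>
    codes x enc_string r2 bs \<and> codes x enc_string r3 p \<and> rd x r4 = 0)"
  have tr: "tr x (\<lambda>_. 0) ebribery \<longleftrightarrow> rd x r4 = 0 \<and> tr x s (eand (ecanonical 12 13) (eand (edistinct 10)
      (eand (eelection 11 10) (eand (emem 13 10) (epacked (enth_vote 11))))))"
    by (simp add: ebribery_def s_def r_defs)
  have Q: "tr x (\<lambda>_. 0) ebribery \<longleftrightarrow> Q cs vs bs p" if "parsed cs vs bs p" for cs vs bs p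
  proof -
    have c: "codes x (enc_list enc_string) (s 10) cs" "codes x enc_votes (s 11) vs"
      "codes x enc_string (s 12) bs" "codes x enc_string (s 13) p" "rd x r4 = 0"
      using that by (simp_all add: parsed_def s_def)
    have "s 13 = s 12 + length (enc_string bs)"
      using parses_codes[OF ps(3) c(3)] by (simp add: s_def r3_def)
    hence "tr x s (ecanonical 12 13) \<longleftrightarrow> bs = [] \<or> last bs" by (rule tr_ecanonical[of x s 12 bs 13, OF c(3)])
    moreover have "tr x s (edistinct 10) \<longleftrightarrow> distinct cs" by (rule tr_edistinct[of x s 10 cs, OF c(1)]) simp
    moreover have "tr x s (eelection 11 10) \<longleftrightarrow> election (set cs) (mset vs)" by (rule tr_eelection[of x s 11 vs 10 cs, OF c(2,1)]) simp_all
    moreover have "tr x s (emem 13 10) \<longleftrightarrow> p \<in> set cs" by (rule tr_emem[of x s 13 p 10 cs, OF c(4,1)]) simp_all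
    \<comment> \<open>Top choices can be located only in nonempty votes; a candidate
      \<open>p\<close> in the election makes all votes nonempty.\<close>
    moreover have "tr x s (epacked (enth_vote 11)) \<longleftrightarrow> winning (mset vs)"
      if "election (set cs) (mset vs)" "p \<in> set cs"
      using election_votes_nonempty[OF that] by (intro tr_epacked_votes[of x s 11 vs, OF c(2)]) simp_all
    ultimately show ?thesis unfolding tr tr_eand Q_def using c(5) by blast
  qed
  have "x = enc_list enc_string cs @ enc_votes vs @ enc_string bs @ enc_string p \<longleftrightarrow> parsed cs vs bs p" for cs vs bs p
  proof -
    have "x = enc_list enc_string cs @ enc_votes vs @ enc_string bs @ enc_string p @ [] \<longleftrightarrow>
        codes x (enc_list enc_string) 1 cs \<and> codes x enc_votes r1 vs \<and> codes x enc_string r2 bs \<and>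
        codes x enc_string r3 p \<and> suffix_at x r4 []"
      unfolding r_defs
      by (subst suffix_at_start) (simp only: suffix_at_append[OF ps(1)] suffix_at_append[OF ps(2)] suffix_at_append[OF ps(3)])
    thus ?thesis unfolding parsed_def using suffix_at_end[OF _ ps(3), of r3 p] by (auto simp: r4_def)
  qed
  moreover have "x \<in> conformant_bribery packing_rule \<longleftrightarrow> (\<exists>cs vs p.
      (\<exists>k. x = enc_list enc_string cs @ enc_votes vs @ enc_nat k @ enc_string p) \<and> distinct cs \<and>
      election (set cs) (mset vs) \<and> p \<in> set cs \<and> winning (mset vs))"
    unfolding conformant_bribery_def conformant_bribery_iff by blast
  moreover have "(\<exists>k. x = enc_list enc_string cs @ enc_votes vs @ enc_nat k @ enc_string p) \<longleftrightarrow>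
      (\<exists>bs. (bs = [] \<or> last bs) \<and> x = enc_list enc_string cs @ enc_votes vs @ enc_string bs @ enc_string p)" for cs vs p
    by (rule ex_enc_nat[of "\<lambda>w _. x = enc_list enc_string cs @ enc_votes vs @ w @ enc_string p"])
  ultimately have "x \<in> conformant_bribery packing_rule \<longleftrightarrow> (\<exists>cs vs bs p. parsed cs vs bs p \<and> Q cs vs bs p)"
    unfolding Q_def by auto
  also have "\<dots> \<longleftrightarrow> tr x (\<lambda>_. 0) ebribery"
  proof
    assume "\<exists>cs vs bs p. parsed cs vs bs p \<and> Q cs vs bs p"
    thus "tr x (\<lambda>_. 0) ebribery" using Q by blast
  next
    assume *: "tr x (\<lambda>_. 0) ebribery"
    hence "rd x r4 = 0" by (simp add: tr)
    hence "r4 \<noteq> 0" unfolding rd_zero by simp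
    moreover from this have "r3 \<noteq> 0" by (metis r4_def skip_string_def skip_list_zero)
    moreover from this have "r2 \<noteq> 0" by (metis r3_def skip_string_def skip_list_zero)
    moreover from this have "r1 \<noteq> 0" by (metis r2_def skip_votes_def skip_list_zero)
    ultimately obtain cs vs bs p where "parsed cs vs bs p"
      using parses_exists[OF ps(1), of 1] parses_exists[OF ps(2), of r1] parses_exists[OF ps(3), of r2]
        parses_exists[OF ps(3), of r3] \<open>rd x r4 = 0\<close>
      unfolding parsed_def r1_def[symmetric] r2_def[symmetric] r3_def[symmetric] r4_def[symmetric] by blast
    thus "\<exists>cs vs bs p. parsed cs vs bs p \<and> Q cs vs bs p" using Q * by blast
  qed
  finally show ?thesis .
qed

lemma class_P_tr:
  assumes "\<And>x. x \<in> A \<longleftrightarrow> tr x (\<lambda>_. 0) e"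
  shows "polytime_app (\<lambda>x. [x \<in> A])"
proof -
  have "(\<lambda>x. [x \<in> A]) = (\<lambda>x. oev x (\<lambda>_. 0) (OIf e (OConst [True]) (OConst [False])))"
    using assms by (auto simp: tr_def)
  thus ?thesis by (simp only: polytime_app_out)
qed

lemma class_P_I: "polytime_app (\<lambda>x. [x \<in> A]) \<Longrightarrow> A \<in> class_P"
  by (simp add: class_P_def polytime_app_polytime)

theorem conformant_bribery_class_P: "conformant_bribery packing_rule \<in> class_P"
  by (rule class_P_I, rule class_P_tr, rule conformant_bribery_iff_tr)

subsection \<open>Control by replacing voters is in NP\<close>

lemma enc_string_Cons: "enc_string (b # bs) = True # b # enc_string bs"
  and enc_string_Nil: "enc_string [] = [False]"
  by (simp_all add: enc_string_def enc_list_def)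

lemma enc_string_append_inject: "enc_string a @ u = enc_string b @ v \<longleftrightarrow> a = b \<and> u = v"
proof (induction a arbitrary: b)
  case Nil
  thus ?case by (cases b) (auto simp: enc_string_Nil enc_string_Cons)
next
  case (Cons c a)
  thus ?case by (cases b) (auto simp: enc_string_Nil enc_string_Cons)
qed

lemma oev_OIf: "oev x s (OIf e p q) = (if tr x s e then oev x s p else oev x s q)"
  by (simp add: tr_def)

declare oev.simps(3) [simp del] oev_OIf [simp]

definition obit :: "ex \<Rightarrow> out" where
  "obit e = OIf (eis e 2) (OConst [True]) (OConst [False])"

lemma oev_obit [simp]: "oev x s (obit e) = [rd x (ev x s e) = 2]"
  by (simp add: obit_def)

text \<open>The verifier receives the instance inside \<open>enc_string\<close>, with a marker
  before each of its bits, where the parsers cannot read it. It is unpacked and moved behind the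
  certificate, so that it is again delimited by the end of the input.\<close>

definition oswap :: out where
  "oswap = OLet 20 (ES EZ) (OLet 21 (estr 20) (OLet 22 (estr 21) (OIf (eis (EV 22) 0)
     (OSeq (OFor 23 ETop (OLet 24 (enth_bit 21 23)
        (OIf (enot (EV 24)) (OConst []) (OSeq (OConst [True]) (obit (EV 24))))))
     (OSeq (OConst [False])
       (OFor 23 ETop (OLet 24 (enth_bit 20 23) (OIf (enot (EV 24)) (OConst []) (obit (EV 24)))))))
     (OConst []))))"

lemma concat_map_nth_guard:
  "length y \<le> N \<Longrightarrow> concat (map (\<lambda>i. if i < length y then g (y ! i) else []) [0..<N]) = concat (map g y)"
proof (induction N arbitrary: y)
  case (Suc N)
  show ?case
  proof (cases "length y = Suc N")
    case True
    hence "map (\<lambda>i. if i < length y then g (y ! i) else []) [0..<Suc N] = map (\<lambda>i. g (y ! i)) [0..<length y]" by simp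
    also have "\<dots> = map g y" using map_nth[of y] by (metis (no_types, lifting) map_map comp_def map_eq_conv)
    finally show ?thesis by simp
  next
    case False
    thus ?thesis using Suc by simp
  qed
qed simp

lemma nthp_bit_zero:
  assumes "codes x enc_string q u"
  shows "nthp x (skip_bit x) q i = 0 \<longleftrightarrow> length u \<le> i"
  using nthp_zero[OF parses_bit assms[unfolded enc_string_def]] .

lemma concat_nthp_bit:
  assumes "codes z enc_string q u"
  shows "concat (map (\<lambda>i. if nthp z (skip_bit z) q i = 0 then [] else g (rd z (nthp z (skip_bit z) q i) = 2))
    [0..<Suc (length z)]) = concat (map g u)"
proof -
  have "(\<lambda>i. if nthp z (skip_bit z) q i = 0 then [] else g (rd z (nthp z (skip_bit z) q i) = 2)) =
      (\<lambda>i. if i < length u then g (u ! i) else [])"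
    unfolding nthp_bit_zero[OF assms] rd_nthp_bit[OF assms] by (auto simp: fun_eq_iff)
  thus ?thesis using concat_map_nth_guard[of u "Suc (length z)" g] codes_string_length[OF assms] by simp
qed

lemma oev_oswap:
  assumes "z = enc_string x @ enc_string y"
  shows "oev z (\<lambda>_. 0) oswap = enc_string y @ x"
proof -
  note ps = parses_string[of z]
  have "suffix_at z 1 (enc_string x @ enc_string y @ [])" using suffix_at_start[of z z] assms by simp
  hence c: "codes z enc_string 1 x" "codes z enc_string (skip_string z 1) y"
    "suffix_at z (skip_string z (skip_string z 1)) []"
    by (simp_all only: suffix_at_append[OF ps])
  have "rd z (skip_string z (skip_string z 1)) = 0" using c suffix_at_end[OF c(2) ps] by simp
  moreover have "concat (map (\<lambda>b. [True, b]) y) @ [False] = enc_string y" by (simp add: enc_string_def enc_list_def)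
  ultimately show ?thesis
    using concat_nthp_bit[OF c(2), of "\<lambda>b. [True, b]"] concat_nthp_bit[OF c(1), of "\<lambda>b. [b]"]
    by (simp add: oswap_def del: upt_Suc cong: if_cong)
qed

section \<open>The verifier for control by replacing voters\<close>

fun count_upto :: "(nat \<Rightarrow> bool) \<Rightarrow> nat \<Rightarrow> nat" where
  "count_upto P 0 = 0"
| "count_upto P (Suc n) = (if P n then Suc (count_upto P n) else count_upto P n)"

lemma count_upto_card: "count_upto P n = card {i. i < n \<and> P i}"
proof (induction n)
  case (Suc n)
  have "{i. i < Suc n \<and> P i} = (if P n then insert n {i. i < n \<and> P i} else {i. i < n \<and> P i})"
    by (auto simp: less_Suc_eq)
  thus ?case using Suc by simp
qed simp

definition ecount :: "nat \<Rightarrow> ex \<Rightarrow> ex" where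
  "ecount v e = EIter v ETop EZ (EIf e 3 (EV v) (ES (EV v)))"

lemma ev_ecount:
  assumes "\<And>u i. i \<le> length x \<Longrightarrow> tr x (s(v := u, Suc v := i)) e \<longleftrightarrow> P i"
  shows "ev x s (ecount v e) = card {i. i \<le> length x \<and> P i}"
proof -
  define f where "f = (\<lambda>i u. ev x (s(v := u, Suc v := i)) (EIf e 3 (EV v) (ES (EV v))))"
  have f: "f i u = (if P i then min (Suc u) (length x + 1) else u)" if "i \<le> length x" for i u
    using assms[OF that, of u]
    by (cases "P i"; cases "ev x (s(v := u, Suc v := i)) e = 0") (simp_all add: f_def tr_def rd_three)
  have "n \<le> length x + 1 \<Longrightarrow> iterate f 0 n = count_upto P n \<and> count_upto P n \<le> n" for n
    by (induction n) (auto simp: f)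
  moreover have "ev x s (ecount v e) = iterate f 0 (length x + 1)"
    unfolding ecount_def f_def by (simp only: ev.simps(2,3,8))
  ultimately show ?thesis by (simp add: count_upto_card less_Suc_eq_le del: count_upto.simps iterate.simps)
qed

text \<open>Horner's scheme from the last, most significant bit. The limit may be exponentially
  large, but it is compared with a number of at most \<open>length x + 1\<close>, so the saturated
  value decides correctly.\<close>

definition eval_bits :: "nat \<Rightarrow> nat \<Rightarrow> ex" where
  "eval_bits q l = EIter 40 (EV l) EZ (ELet 42 (EP (esub (EV l) (EV 41))) (ELet 43 (enth_bit q 42)
     (ELet 44 (eadd (EV 40) (EV 40)) (EIf (EV 43) 2 (ES (EV 44)) (EV 44)))))"

lemma ev_eval_bits:
  assumes c: "codes x enc_string (s q) bs" and l: "s l = length bs" and "q < 40" "l < 40"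
  shows "ev x s (eval_bits q l) = min (val bs) (length x + 1)"
proof -
  define f where "f = (\<lambda>i u. ev x (s(40 := u, Suc 40 := i)) (ELet 42 (EP (esub (EV l) (EV 41))) (ELet 43 (enth_bit q 42)
     (ELet 44 (eadd (EV 40) (EV 40)) (EIf (EV 43) 2 (ES (EV 44)) (EV 44))))))"
  have f: "f i u = min (of_bool (bs ! (length bs - 1 - i)) + 2 * u) (length x + 1)"
    if "i < length bs" "u \<le> length x + 1" for i u
    using that assms(3,4) l rd_nthp_bit[OF c, of "length bs - 1 - i"] by (auto simp: f_def min_def)
  have "n \<le> length bs \<Longrightarrow> iterate f 0 n = min (val (drop (length bs - n) bs)) (length x + 1)" for n
  proof (induction n)
    case (Suc n)
    have "length bs - Suc n < length bs" using Suc.prems by simp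
    hence d: "drop (length bs - Suc n) bs = bs ! (length bs - 1 - n) # drop (length bs - n) bs"
      using Cons_nth_drop_Suc[of "length bs - Suc n" bs] Suc.prems by (simp add: Suc_diff_Suc)
    show ?case using Suc by (simp add: f d min_def)
  qed simp
  moreover have "ev x s (eval_bits q l) = iterate f 0 (s l)"
    unfolding eval_bits_def f_def by (simp only: ev.simps(1,2,8))
  ultimately show ?thesis using l by simp
qed

text \<open>Index \<open>i\<close> refers to the registered followed by the unregistered voters:
  where the list at variable \<open>11\<close> has no such entry, \<open>i\<close> minus the number
  of registered voters, kept in variable \<open>16\<close>, is looked up at variable
  \<open>12\<close>.\<close>

definition evote :: "nat \<Rightarrow> ex" where
  "evote i = ELet 150 (enth_vote 11 i)
     (EIf (EV 150) 3 (ELet 151 (esub (EV i) (EV 16)) (enth_vote 12 151)) (EV 150))"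

definition eselected :: "nat \<Rightarrow> ex" where
  "eselected i = EIf (enth_bit 9 i) 2 (evote i) EZ"

text \<open>Variables \<open>9\<close> to \<open>15\<close> are the positions of the certificate,
  the candidates, the registered and the unregistered votes, the limit, the preferred candidate, and
  the end. Variables \<open>16\<close> to \<open>19\<close> count the registered voters, the bits of
  the limit, the selected voters and the selected unregistered voters.\<close>

definition ereplacing :: ex where
  "ereplacing = ELet 9 (ES EZ) (ELet 10 (estr 9) (ELet 11 (estrs 10) (ELet 12 (evotes 11) (ELet 13 (evotes 12)
     (ELet 14 (estr 13) (ELet 15 (estr 14) (eand (eis (EV 15) 0)
     (ELet 16 (ecount 30 (enth_vote 11 31)) (ELet 17 (ecount 30 (enth_bit 13 31))
     (ELet 18 (ecount 30 (eselected 31)) (ELet 19 (ecount 30 (eand (ele (EV 16) (EV 31)) (eselected 31)))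
     (eand (ecanonical 13 14) (eand (edistinct 10) (eand (eelection 11 10) (eand (eelection 12 10)
     (eand (emem 14 10) (eand (eeq (EV 18) (EV 16)) (eand (ele (EV 19) (eval_bits 13 17))
     (epacked eselected)))))))))))))))))))"

lemma ereplacing_parsed:
  assumes c: "codes x enc_string 1 y" "codes x (enc_list enc_string) r0 cs" "codes x enc_votes r1 vs"
      "codes x enc_votes r2 us" "codes x enc_string r3 bs" "codes x enc_string r4 p"
    and r: "r0 = skip_string x 1" "r1 = skip_strings x r0" "r2 = skip_votes x r1" "r3 = skip_votes x r2"
      "r4 = skip_string x r3" and e: "rd x (skip_string x r4) = 0"
  shows "tr x (\<lambda>_. 0) ereplacing \<longleftrightarrow> (bs = [] \<or> last bs) \<and> distinct cs \<and> election (set cs) (mset vs) \<and>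
    election (set cs) (mset us) \<and> p \<in> set cs \<and>
    (let I = {i. i < length vs + length us \<and> i < length y \<and> y ! i} in
       card I = length vs \<and> card {i\<in>I. length vs \<le> i} \<le> val bs \<and> packed I (\<lambda>i. hd ((vs @ us) ! i)))"
proof -
  define I where "I = {i. i < length vs + length us \<and> i < length y \<and> y ! i}"
  define m where "m = length vs"
  \<comment> \<open>The two lists occupy disjoint parts of the input, so all positions in
    \<open>vs @ us\<close> lie in the range of the quantifiers.\<close>
  have len: "length vs + length us \<le> length x"
  proof -
    have l: "length ws \<le> length (enc_votes ws)" for ws
      unfolding enc_votes_def enc_list_def by (induction ws) auto
    have "r3 = r1 + length (enc_votes vs) + length (enc_votes us)"
      using parses_codes[OF parses_votes c(3)] parses_codes[OF parses_votes c(4)] r by simp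
    moreover have "r3 \<le> length x + 1" "1 \<le> r1" using c(3,5) by (auto simp: codes_def)
    ultimately show ?thesis using l[of vs] l[of us] by linarith
  qed
  have vlen: "length vs \<le> length x" "length bs \<le> length x"
    using len codes_string_length[OF c(5)] by simp_all
  \<comment> \<open>The location of the vote with index \<open>i\<close> if the certificate selects
    it, and \<open>0\<close> otherwise: the function that \<open>eselected\<close> computes.\<close>
  define pv where "pv = (\<lambda>i. if i \<in> I then if i < m then nthp x (skip_strings x) r1 i
      else nthp x (skip_strings x) r2 (i - m) else 0)"
  define s0 :: "nat \<Rightarrow> nat" where "s0 = (\<lambda>_. 0)(9 := 1, 10 := r0, 11 := r1, 12 := r2, 13 := r3, 14 := r4,
    15 := skip_string x r4)"
  define s1 where "s1 = s0(16 := m)"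
  define s2 where "s2 = s1(17 := length bs)"
  have sel: "ev x t (eselected i) = pv (t i)"
    if "t 9 = 1" "t 11 = r1" "t 12 = r2" "t 16 = m" "i < 150" for t i
  proof -
    have "ev x t (evote i) = (if t i < m then nthp x (skip_strings x) r1 (t i)
        else nthp x (skip_strings x) r2 (t i - m))"
      using that nthp_vote(1)[OF c(3), of "t i"] by (auto simp: evote_def rd_three m_def)
    moreover have "nthp x (skip_strings x) r2 (t i - m) = 0" if "length vs + length us \<le> t i"
      using nthp_vote(1)[OF c(4)] that by (auto simp: m_def)
    ultimately show ?thesis
      using that rd_nthp_bit[OF c(1), of "t i"] by (auto simp: eselected_def pv_def I_def m_def)
  qed
  have pv: "pv i = 0 \<longleftrightarrow> i \<notin> I" for i
    using nthp_vote(1)[OF c(3), of i] nthp_vote(1)[OF c(4), of "i - m"] by (auto simp: pv_def I_def m_def)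
  have pv': "0 < pv i \<longleftrightarrow> i \<in> I" for i using pv[of i] by auto
  have I: "{i. i \<le> length x \<and> i \<in> I} = I" using len by (auto simp: I_def)
  have m: "ev x s0 (ecount 30 (enth_vote 11 31)) = m"
  proof -
    have "ev x s0 (ecount 30 (enth_vote 11 31)) = card {i. i \<le> length x \<and> i < m}"
      by (rule ev_ecount) (simp add: tr_def s0_def nthp_vote(1)[OF c(3)] m_def not_le)
    also have "{i. i \<le> length x \<and> i < m} = {..<m}" using vlen by (auto simp: m_def)
    finally show ?thesis by simp
  qed
  have l: "ev x s1 (ecount 30 (enth_bit 13 31)) = length bs"
  proof -
    have "ev x s1 (ecount 30 (enth_bit 13 31)) = card {i. i \<le> length x \<and> i < length bs}"
      by (rule ev_ecount) (simp add: tr_def s1_def s0_def nthp_bit_zero[OF c(5)] not_le)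
    also have "{i. i \<le> length x \<and> i < length bs} = {..<length bs}" using vlen by auto
    finally show ?thesis by simp
  qed
  have n1: "ev x s2 (ecount 30 (eselected 31)) = card I"
  proof -
    have "ev x s2 (ecount 30 (eselected 31)) = card {i. i \<le> length x \<and> i \<in> I}"
      by (rule ev_ecount) (simp add: tr_def s2_def s1_def s0_def sel pv')
    thus ?thesis by (simp only: I)
  qed
  define s3 where "s3 = s2(18 := card I)"
  have n2: "ev x s3 (ecount 30 (eand (ele (EV 16) (EV 31)) (eselected 31))) = card {i\<in>I. m \<le> i}"
  proof -
    have t: "tr x t e \<longleftrightarrow> pv i \<noteq> 0" if "ev x t e = pv i" for t e i using that by (simp add: tr_def)
    have "ev x s3 (ecount 30 (eand (ele (EV 16) (EV 31)) (eselected 31))) = card {i. i \<le> length x \<and> m \<le> i \<and> i \<in> I}"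
      by (rule ev_ecount) (simp add: s3_def s2_def s1_def s0_def t[OF sel] pv')
    also have "{i. i \<le> length x \<and> m \<le> i \<and> i \<in> I} = {i\<in>I. m \<le> i}" using I by auto
    finally show ?thesis .
  qed
  define s where "s = s3(19 := card {i\<in>I. m \<le> i})"
  note s_defs = s_def s3_def s2_def s1_def s0_def
  have "tr x (\<lambda>_. 0) ereplacing \<longleftrightarrow> tr x s (eand (ecanonical 13 14) (eand (edistinct 10) (eand (eelection 11 10)
     (eand (eelection 12 10) (eand (emem 14 10) (eand (eeq (EV 18) (EV 16)) (eand (ele (EV 19) (eval_bits 13 17))
     (epacked eselected))))))))"
  proof -
    have 0: "(\<lambda>_. 0)(9 := Suc 0, 10 := r0, 11 := r1, 12 := r2, 13 := r3, 14 := r4, 15 := skip_string x r4) = s0"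
      by (simp add: s0_def)
    have "s 16 = m" "s 18 = card I" "s 19 = card {i\<in>I. m \<le> i}" by (simp_all add: s_defs)
    thus ?thesis unfolding ereplacing_def
      by (simp add: r[symmetric, simplified] 0 e) (simp add: s0_def[THEN fun_cong] e m s1_def[symmetric] l
          s2_def[symmetric] n1 s3_def[symmetric] n2 s_def[symmetric])
  qed
  moreover have sc: "codes x enc_string (s 13) bs" "s 14 = s 13 + length (enc_string bs)"
    "codes x (enc_list enc_string) (s 10) cs" "codes x enc_votes (s 11) vs" "codes x enc_votes (s 12) us"
    "codes x enc_string (s 14) p" "s 17 = length bs"
    using c parses_codes[OF parses_string c(5)] by (simp_all add: s_defs r(5))
  have "tr x s (ecanonical 13 14) \<longleftrightarrow> bs = [] \<or> last bs" by (rule tr_ecanonical[of x s 13 bs 14, OF sc(1,2)])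
  moreover have "tr x s (edistinct 10) \<longleftrightarrow> distinct cs" by (rule tr_edistinct[of x s 10 cs, OF sc(3)]) simp
  moreover have "tr x s (eelection 11 10) \<longleftrightarrow> election (set cs) (mset vs)"
    by (rule tr_eelection[of x s 11 vs 10 cs, OF sc(4,3)]) simp_all
  moreover have "tr x s (eelection 12 10) \<longleftrightarrow> election (set cs) (mset us)"
    by (rule tr_eelection[of x s 12 us 10 cs, OF sc(5,3)]) simp_all
  moreover have "tr x s (emem 14 10) \<longleftrightarrow> p \<in> set cs" by (rule tr_emem[of x s 14 p 10 cs, OF sc(6,3)]) simp_all
  moreover have "tr x s (eeq (EV 18) (EV 16)) \<longleftrightarrow> card I = length vs" by (simp add: s_defs m_def)
  moreover have "tr x s (ele (EV 19) (eval_bits 13 17)) \<longleftrightarrow> card {i\<in>I. length vs \<le> i} \<le> val bs"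
  proof -
    have "ev x s (eval_bits 13 17) = min (val bs) (length x + 1)"
      by (rule ev_eval_bits[of x s 13 bs 17, OF sc(1,7)]) simp_all
    moreover have "card {i\<in>I. m \<le> i} \<le> length x + 1"
      using card_mono[of "{..length x}" "{i\<in>I. m \<le> i}"] len by (fastforce simp: I_def)
    ultimately show ?thesis by (simp add: s_def m_def)
  qed
  moreover have "tr x s (epacked eselected) \<longleftrightarrow> packed I (\<lambda>i. hd ((vs @ us) ! i))"
    if "election (set cs) (mset vs)" "election (set cs) (mset us)" "p \<in> set cs"
  proof -
    have ne: "[] \<notin> set (vs @ us)"
      using election_votes_nonempty[OF that(1,3)] election_votes_nonempty[OF that(2,3)] by simp
    have "tr x s (epacked eselected) \<longleftrightarrow> packed {i. i \<le> length x \<and> pv i \<noteq> 0} (\<lambda>i. hd ((vs @ us) ! i))"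
    proof (rule tr_epacked)
      fix t :: "nat \<Rightarrow> nat" and i :: nat
      assume t: "\<And>r. r < 140 \<Longrightarrow> t r = s r" "i = 141 \<or> i = 145"
      show "ev x t (eselected i) = pv (t i)"
        using t(2) t(1)[of 9] t(1)[of 11] t(1)[of 12] t(1)[of 16] by (intro sel) (auto simp: s_defs)
    next
      fix i assume "pv i \<noteq> 0"
      hence i: "i \<in> I" using pv[of i] by simp
      hence "i < length (vs @ us)" by (simp add: I_def)
      hence "(vs @ us) ! i \<noteq> []" using ne nth_mem by metis
      moreover have "codes x (enc_list enc_string) (pv i) ((vs @ us) ! i)"
        using i nthp_vote(2)[OF c(3), of i] nthp_vote(2)[OF c(4), of "i - m"]
        by (auto simp: pv_def m_def nth_append I_def)
      ultimately show "codes x (enc_list enc_string) (pv i) ((vs @ us) ! i) \<and> (vs @ us) ! i \<noteq> []" by blast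
    qed
    thus ?thesis by (simp only: pv not_not I)
  qed
  ultimately show ?thesis unfolding tr_eand Let_def I_def[symmetric] by blast
qed

lemma mask_index_set:
  "{i. i < n \<and> i < length (map (\<lambda>i. i \<in> I) [0..<n]) \<and> map (\<lambda>i. i \<in> I) [0..<n] ! i} = {i \<in> I. i < n}"
  by auto

lemma tr_ereplacing:
  "tr (enc_string y @ x) (\<lambda>_. 0) ereplacing \<longleftrightarrow> (\<exists>cs vs us k p.
     x = enc_list enc_string cs @ enc_votes vs @ enc_votes us @ enc_nat k @ enc_string p \<and>
     distinct cs \<and> election (set cs) (mset vs) \<and> election (set cs) (mset us) \<and> p \<in> set cs \<and>
     (let I = {i. i < length vs + length us \<and> i < length y \<and> y ! i} in
       card I = length vs \<and> card {i\<in>I. length vs \<le> i} \<le> k \<and> packed I (\<lambda>i. hd ((vs @ us) ! i))))"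
    (is "?L \<longleftrightarrow> ?R")
proof -
  define w where "w = enc_string y @ x"
  note ps = parses_string[of w] parses_strings[of w] parses_votes[of w]
  define r0 where "r0 = skip_string w 1"
  define r1 where "r1 = skip_strings w r0"
  define r2 where "r2 = skip_votes w r1"
  define r3 where "r3 = skip_votes w r2"
  define r4 where "r4 = skip_string w r3"
  note r_defs = r0_def r1_def r2_def r3_def r4_def
  define parsed where "parsed = (\<lambda>y cs vs us bs p. codes w enc_string 1 y \<and> codes w (enc_list enc_string) r0 cs \<and>
    codes w enc_votes r1 vs \<and> codes w enc_votes r2 us \<and> codes w enc_string r3 bs \<and> codes w enc_string r4 p \<and>
    rd w (skip_string w r4) = 0)"
  define Q where "Q = (\<lambda>y cs vs us k p. distinct cs \<and> election (set cs) (mset vs) \<and>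
    election (set cs) (mset us) \<and> p \<in> set cs \<and>
    (let I = {i. i < length vs + length us \<and> i < length y \<and> y ! i} in
       card I = length vs \<and> card {i\<in>I. length vs \<le> i} \<le> k \<and> packed I (\<lambda>i. hd ((vs @ us) ! i))))"
  have Q: "tr w (\<lambda>_. 0) ereplacing \<longleftrightarrow> (bs = [] \<or> last bs) \<and> Q y cs vs us (val bs) p"
    if "parsed y cs vs us bs p" for y cs vs us bs p
    using ereplacing_parsed[of w y r0 cs r1 vs r2 us r3 bs r4 p] that by (simp only: parsed_def r_defs Q_def)
  have split: "w = enc_string y @ enc_list enc_string cs @ enc_votes vs @ enc_votes us @ enc_string bs @ enc_string p
      \<longleftrightarrow> parsed y cs vs us bs p" for y cs vs us bs p
  proof -
    have "w = enc_string y @ enc_list enc_string cs @ enc_votes vs @ enc_votes us @ enc_string bs @ enc_string p @ [] \<longleftrightarrow>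
        codes w enc_string 1 y \<and> codes w (enc_list enc_string) r0 cs \<and> codes w enc_votes r1 vs \<and>
        codes w enc_votes r2 us \<and> codes w enc_string r3 bs \<and> codes w enc_string r4 p \<and>
        suffix_at w (skip_string w r4) []"
      unfolding r_defs
      by (subst suffix_at_start) (simp only: suffix_at_append[OF ps(1)] suffix_at_append[OF ps(2)] suffix_at_append[OF ps(3)])
    thus ?thesis unfolding parsed_def using suffix_at_end[OF _ ps(1), of r4 p] by auto
  qed
  have "tr w (\<lambda>_. 0) ereplacing \<longleftrightarrow>
      (\<exists>y cs vs us bs p. parsed y cs vs us bs p \<and> (bs = [] \<or> last bs) \<and> Q y cs vs us (val bs) p)"
  proof
    assume *: "tr w (\<lambda>_. 0) ereplacing"
    hence "rd w (skip_string w r4) = 0" by (simp add: ereplacing_def r_defs)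
    moreover from this have "skip_string w r4 \<noteq> 0" unfolding rd_zero by simp
    moreover from this have "r4 \<noteq> 0" by (metis skip_string_def skip_list_zero)
    moreover from this have "r3 \<noteq> 0" by (metis r4_def skip_string_def skip_list_zero)
    moreover from this have "r2 \<noteq> 0" by (metis r3_def skip_votes_def skip_list_zero)
    moreover from this have "r1 \<noteq> 0" by (metis r2_def skip_votes_def skip_list_zero)
    moreover from this have "r0 \<noteq> 0" by (metis r1_def skip_strings_def skip_list_zero)
    ultimately obtain y cs vs us bs p where "parsed y cs vs us bs p"
      using parses_exists[OF ps(1), of 1] parses_exists[OF ps(2), of r0] parses_exists[OF ps(3), of r1]
        parses_exists[OF ps(3), of r2] parses_exists[OF ps(1), of r3] parses_exists[OF ps(1), of r4]
      unfolding parsed_def r0_def[symmetric] r1_def[symmetric] r2_def[symmetric] r3_def[symmetric] r4_def[symmetric]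
      by blast
    thus "\<exists>y cs vs us bs p. parsed y cs vs us bs p \<and> (bs = [] \<or> last bs) \<and> Q y cs vs us (val bs) p"
      using Q * by blast
  qed (use Q in blast)
  also have "\<dots> \<longleftrightarrow> (\<exists>cs vs us p. \<exists>bs. (bs = [] \<or> last bs) \<and>
      x = enc_list enc_string cs @ enc_votes vs @ enc_votes us @ enc_string bs @ enc_string p \<and> Q y cs vs us (val bs) p)"
    \<comment> \<open>\<open>enc_string\<close> is self-delimiting, so the certificate found by the
      parser is the given \<open>y\<close>.\<close>
    unfolding split[symmetric] w_def enc_string_append_inject by blast
  finally have w: "tr w (\<lambda>_. 0) ereplacing \<longleftrightarrow> (\<exists>cs vs us p. \<exists>bs. (bs = [] \<or> last bs) \<and>
      x = enc_list enc_string cs @ enc_votes vs @ enc_votes us @ enc_string bs @ enc_string p \<and> Q y cs vs us (val bs) p)" .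
  have k: "(\<exists>bs. (bs = [] \<or> last bs) \<and>
      x = enc_list enc_string cs @ enc_votes vs @ enc_votes us @ enc_string bs @ enc_string p \<and> Q y cs vs us (val bs) p) \<longleftrightarrow>
      (\<exists>k. x = enc_list enc_string cs @ enc_votes vs @ enc_votes us @ enc_nat k @ enc_string p \<and> Q y cs vs us k p)"
    for cs vs us p
    by (rule ex_enc_nat[of "\<lambda>w k. x = enc_list enc_string cs @ enc_votes vs @ enc_votes us @ w @ enc_string p \<and>
        Q y cs vs us k p", symmetric])
  show ?thesis unfolding w_def[symmetric] w k unfolding Q_def by blast
qed

lemma length_le_enc_votes: "length vs \<le> length (enc_votes vs)"
  unfolding enc_votes_def enc_list_def by (induction vs) auto

text \<open>The certificate is the characteristic vector of the index set \<open>I\<close>. It is no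
  longer than \<open>x\<close> because every vote takes at least one bit of the instance.\<close>

lemma control_by_replacing_voters_iff:
  "x \<in> control_by_replacing_voters packing_rule \<longleftrightarrow>
    (\<exists>y. length y \<le> length x \<and> tr (enc_string y @ x) (\<lambda>_. 0) ereplacing)"
proof
  assume "x \<in> control_by_replacing_voters packing_rule"
  then obtain cs vs us k p where x: "x = enc_list enc_string cs @ enc_votes vs @ enc_votes us @ enc_nat k @ enc_string p"
    and *: "distinct cs" "election (set cs) (mset vs)" "election (set cs) (mset us)" "p \<in> set cs"
      "replacing_possible packing_rule (set cs) (mset vs) (mset us) k p"
    unfolding control_by_replacing_voters_def by blast
  obtain I where I: "I \<subseteq> {..<length vs + length us}" "card I = length vs" "card {i\<in>I. length vs \<le> i} \<le> k"
    "packed I (\<lambda>i. hd ((vs @ us) ! i))"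
    using *(5) unfolding replacing_iff by blast
  let ?n = "length vs + length us"
  let ?y = "map (\<lambda>i. i \<in> I) [0..<?n]"
  have "{i. i < ?n \<and> i < length ?y \<and> ?y ! i} = I" using I(1) unfolding mask_index_set by auto
  hence "let I = {i. i < ?n \<and> i < length ?y \<and> ?y ! i} in
      card I = length vs \<and> card {i\<in>I. length vs \<le> i} \<le> k \<and> packed I (\<lambda>i. hd ((vs @ us) ! i))"
    unfolding Let_def using I(2-4) by (simp only:)
  hence "tr (enc_string ?y @ x) (\<lambda>_. 0) ereplacing"
    unfolding tr_ereplacing by (intro exI[of _ cs] exI[of _ vs] exI[of _ us] exI[of _ k] exI[of _ p] conjI x *(1-4))
  moreover have "length ?y \<le> length x"
    using length_le_enc_votes[of vs] length_le_enc_votes[of us] by (simp add: x)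
  ultimately show "\<exists>y. length y \<le> length x \<and> tr (enc_string y @ x) (\<lambda>_. 0) ereplacing" by blast
next
  assume "\<exists>y. length y \<le> length x \<and> tr (enc_string y @ x) (\<lambda>_. 0) ereplacing"
  then obtain y cs vs us k p where x: "x = enc_list enc_string cs @ enc_votes vs @ enc_votes us @ enc_nat k @ enc_string p"
    and *: "distinct cs" "election (set cs) (mset vs)" "election (set cs) (mset us)" "p \<in> set cs"
    and I: "let I = {i. i < length vs + length us \<and> i < length y \<and> y ! i} in
       card I = length vs \<and> card {i\<in>I. length vs \<le> i} \<le> k \<and> packed I (\<lambda>i. hd ((vs @ us) ! i))"
    unfolding tr_ereplacing by blast
  have "{i. i < length vs + length us \<and> i < length y \<and> y ! i} \<subseteq> {..<length vs + length us}" by auto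
  hence "replacing_possible packing_rule (set cs) (mset vs) (mset us) k p"
    unfolding replacing_iff using I *(4) unfolding Let_def by blast
  thus "x \<in> control_by_replacing_voters packing_rule"
    unfolding control_by_replacing_voters_def using x * by blast
qed

theorem control_by_replacing_voters_class_NP: "control_by_replacing_voters packing_rule \<in> class_NP"
proof -
  define A where "A = {w. tr w (\<lambda>_. 0) ereplacing}"
  define B where "B = {z. oev z (\<lambda>_. 0) oswap \<in> A}"
  have "polytime_app (\<lambda>w. [w \<in> A])" by (rule class_P_tr[of _ ereplacing]) (simp add: A_def)
  from polytime_app_comp[OF polytime_app_out[of oswap] this]
  have "B \<in> class_P" by (intro class_P_I) (simp add: B_def comp_def)
  moreover have "enc_string x @ enc_string y \<in> B \<longleftrightarrow> tr (enc_string y @ x) (\<lambda>_. 0) ereplacing" for x y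
    by (simp add: B_def A_def oev_oswap)
  hence "x \<in> control_by_replacing_voters packing_rule \<longleftrightarrow>
      (\<exists>y. length y \<le> poly [:0, 1:] (length x) \<and> enc_string x @ enc_string y \<in> B)" for x
    unfolding control_by_replacing_voters_iff by simp
  ultimately show ?thesis unfolding class_NP_def by blast
qed

section \<open>From tilings to packings\<close>

text \<open>A voter with top choice \<open>[]\<close> prevents victory, so all \<open>N\<close>
  registered voters must leave, which \<open>N \<le> k\<close> allows. As the names in
  \<open>ns\<close> are distinct, sets of positions in \<open>us\<close> correspond to sets of
  names.\<close>

lemma replacing_iff_packed:
  fixes ns :: "bool list list"
  defines "cs \<equiv> [] # ns"
  assumes ns: "distinct ns" "\<And>c. c \<in> set ns \<Longrightarrow> True \<in> set c" and "N \<le> k"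
    and us: "length us = length ns" "\<And>i. i < length ns \<Longrightarrow> hd (us ! i) = ns ! i"
  shows "replacing_possible packing_rule (set cs) (mset (replicate N cs)) (mset us) k [] \<longleftrightarrow>
    (\<exists>T\<subseteq>set ns. card T = N \<and> packed T (\<lambda>c. c))"
proof -
  let ?l = "length ns"
  let ?f = "\<lambda>i. hd ((replicate N cs @ us) ! i)"
  have f: "?f i = []" if "i < N" for i using that by (simp add: nth_append cs_def)
  have f': "?f (N + i) = ns ! i" if "i < ?l" for i using that us by (simp add: nth_append)
  have pk: "packed ((\<lambda>i. N + i) ` J) ?f \<longleftrightarrow> packed (nth ns ` J) (\<lambda>c. c)" if "J \<subseteq> {..<?l}" for J
  proof -
    have "ns ! i \<noteq> ns ! j \<longleftrightarrow> i \<noteq> j" if "i \<in> J" "j \<in> J" for i j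
      using \<open>J \<subseteq> {..<?l}\<close> that ns(1) nth_eq_iff_index_eq by (metis lessThan_iff subsetD)
    moreover have "?f (N + i) = ns ! i" if "i \<in> J" for i using \<open>J \<subseteq> {..<?l}\<close> that f' by auto
    ultimately show ?thesis unfolding packed_def by (simp add: ball_simps cong: ball_cong)
  qed
  have inj: "inj_on (nth ns) J" if "J \<subseteq> {..<?l}" for J
    using ns(1) that by (auto intro!: inj_on_nth)
  show ?thesis unfolding replacing_iff
  proof
    assume "[] \<in> set cs \<and> (\<exists>I\<subseteq>{..<length (replicate N cs) + length us}. card I = length (replicate N cs) \<and>
      card {i \<in> I. length (replicate N cs) \<le> i} \<le> k \<and> packed I ?f)"
    then obtain I where I: "I \<subseteq> {..<N + ?l}" "card I = N" "packed I ?f" using us by auto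
    have ge: "N \<le> i" if "i \<in> I" for i
    proof (rule ccontr)
      assume "\<not> N \<le> i"
      hence "?f i = []" by (intro f) simp
      moreover have "True \<in> set (?f i)" using I(3) that unfolding packed_def by blast
      ultimately show False by simp
    qed
    define J where "J = {i. N + i \<in> I}"
    have J: "I = (\<lambda>i. N + i) ` J" using ge by (force simp: J_def image_iff le_iff_add)
    have sub: "J \<subseteq> {..<?l}" using I(1) by (auto simp: J_def)
    have "card (nth ns ` J) = N"
      using I(2) card_image[OF inj[OF sub]] by (simp add: J card_image)
    moreover have "packed (nth ns ` J) (\<lambda>c. c)" using I(3) pk[OF sub] J by simp
    moreover have "nth ns ` J \<subseteq> set ns" using sub by auto
    ultimately show "\<exists>T\<subseteq>set ns. card T = N \<and> packed T (\<lambda>c. c)" by blast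
  next
    assume "\<exists>T\<subseteq>set ns. card T = N \<and> packed T (\<lambda>c. c)"
    then obtain T where T: "T \<subseteq> set ns" "card T = N" "packed T (\<lambda>c. c)" by blast
    define J where "J = {i. i < ?l \<and> ns ! i \<in> T}"
    have sub: "J \<subseteq> {..<?l}" by (auto simp: J_def)
    have TJ: "T = nth ns ` J" using T(1) by (force simp: J_def in_set_conv_nth)
    let ?I = "(\<lambda>i. N + i) ` J"
    have c: "card ?I = N" using T(2) card_image[OF inj[OF sub]] by (simp add: TJ card_image)
    have "{i \<in> ?I. N \<le> i} = ?I" by auto
    moreover have "packed ?I ?f" using T(3) pk[OF sub] TJ by simp
    moreover have "?I \<subseteq> {..<N + ?l}" using sub by auto
    ultimately show "[] \<in> set cs \<and> (\<exists>I\<subseteq>{..<length (replicate N cs) + length us}. card I = length (replicate N cs) \<and>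
      card {i \<in> I. length (replicate N cs) \<le> i} \<le> k \<and> packed I ?f)"
      using c us(1) \<open>N \<le> k\<close> by (intro conjI exI[of _ ?I]) (simp_all add: cs_def)
  qed
qed

section \<open>Tiles and the sets that represent them\<close>

text \<open>
  A tile has colours on its west, east, south and north edges; an edge without a colour matches
  everything. The cells of a grid of width \<open>D\<close> are numbered row by row, so that the neighbours of the
  cell \<open>i\<close> in the east and the north are \<open>i + 1\<close> and \<open>i + D\<close>.
\<close>

type_synonym tile = "nat option \<times> nat \<times> nat option \<times> nat"

fun west :: "tile \<Rightarrow> nat option" where "west (w, e, s, n) = w"
fun east :: "tile \<Rightarrow> nat" where "east (w, e, s, n) = e"
fun south :: "tile \<Rightarrow> nat option" where "south (w, e, s, n) = s"
fun north :: "tile \<Rightarrow> nat" where "north (w, e, s, n) = n"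

definition colours_below :: "nat \<Rightarrow> tile \<Rightarrow> bool" where
  "colours_below G t \<longleftrightarrow> east t < G \<and> north t < G \<and> (\<forall>g. west t = Some g \<longrightarrow> g < G) \<and>
    (\<forall>g. south t = Some g \<longrightarrow> g < G)"

text \<open>
  The set of a tile in the cell \<open>i\<close> has, in the block of the cell \<open>i\<close>, an element for the cell itself
  and those of its own west and south colours, and in the blocks of the two neighbours the elements
  of all colours that do not match. So two sets are disjoint iff the tiles fit together.
\<close>

definition block_own :: "nat \<Rightarrow> tile \<Rightarrow> bool list" where
  "block_own G t = True # map (\<lambda>g. west t = Some g) [0..<G] @ map (\<lambda>g. south t = Some g) [0..<G]"

definition block_east :: "nat \<Rightarrow> tile \<Rightarrow> bool list" where
  "block_east G t = False # map (\<lambda>g. g \<noteq> east t) [0..<G] @ replicate G False"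

definition block_north :: "nat \<Rightarrow> tile \<Rightarrow> bool list" where
  "block_north G t = False # replicate G False @ map (\<lambda>g. g \<noteq> north t) [0..<G]"

definition tile_set :: "nat \<Rightarrow> nat \<Rightarrow> nat \<Rightarrow> tile \<Rightarrow> bool list" where
  "tile_set G D i t = replicate (i * (1 + 2 * G)) False @ block_own G t @ block_east G t @
     replicate ((D - 2) * (1 + 2 * G)) False @ block_north G t"

definition in_block :: "nat \<Rightarrow> nat \<Rightarrow> nat \<Rightarrow> tile \<Rightarrow> nat \<Rightarrow> nat \<Rightarrow> bool" where
  "in_block G D i t q r \<longleftrightarrow> q = i \<and> block_own G t ! r \<or> q = i + 1 \<and> block_east G t ! r \<or>
     q = i + D \<and> block_north G t ! r"

lemma concat_blocks_nth:
  assumes "\<And>b. b \<in> set bs \<Longrightarrow> length b = K" "r < K"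
  shows "q * K + r < length (concat bs) \<and> concat bs ! (q * K + r) \<longleftrightarrow> q < length bs \<and> bs ! q ! r"
  using assms(1)
proof (induction bs arbitrary: q)
  case (Cons b bs)
  have b: "length b = K" using Cons.prems by simp
  show ?case
  proof (cases q)
    case 0
    thus ?thesis using b assms(2) by (simp add: nth_append)
  next
    case (Suc p)
    have "\<not> q * K + r < K" "q * K + r - K = p * K + r" by (simp_all add: Suc)
    hence "q * K + r < length (concat (b # bs)) \<and> concat (b # bs) ! (q * K + r) \<longleftrightarrow>
        p * K + r < length (concat bs) \<and> concat bs ! (p * K + r)"
      using b by (auto simp: nth_append Suc)
    thus ?thesis using Cons.IH[of p] Cons.prems by (simp add: Suc)
  qed
qed simp

lemma length_blocks [simp]:
  "length (block_own G t) = 1 + 2 * G" "length (block_east G t) = 1 + 2 * G" "length (block_north G t) = 1 + 2 * G"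
  by (simp_all add: block_own_def block_east_def block_north_def)

lemma tile_set_nth:
  assumes "r < 1 + 2 * G" "D \<ge> 2"
  shows "q * (1 + 2 * G) + r < length (tile_set G D i t) \<and> tile_set G D i t ! (q * (1 + 2 * G) + r) \<longleftrightarrow>
    in_block G D i t q r"
proof -
  define K where "K = 1 + 2 * G"
  define z where "z = replicate K False"
  define bs where "bs = replicate i z @ [block_own G t, block_east G t] @ replicate (D - 2) z @ [block_north G t]"
  have "replicate (n * K) False = concat (replicate n z)" for n
    by (induction n) (auto simp: z_def replicate_add)
  moreover have "tile_set G D i t = replicate (i * K) False @ block_own G t @ block_east G t @
      replicate ((D - 2) * K) False @ block_north G t" by (simp only: tile_set_def K_def)
  ultimately have "tile_set G D i t = concat bs" by (simp add: bs_def)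
  moreover have "length b = K" if "b \<in> set bs" for b
    using that by (auto simp: bs_def z_def K_def)
  ultimately have "q * K + r < length (tile_set G D i t) \<and> tile_set G D i t ! (q * K + r) \<longleftrightarrow>
      q < length bs \<and> bs ! q ! r"
    using concat_blocks_nth[of bs K r q] assms(1) by (simp add: K_def)
  also have "\<dots> \<longleftrightarrow> in_block G D i t q r"
  proof -
    have z: "\<not> z ! r" using assms(1) unfolding z_def K_def by (simp only: nth_replicate not_False_eq_True)
    consider "q < i" | "q = i" | "q = i + 1" | "i + 1 < q" "q < i + D" | "q = i + D" | "q > i + D" by linarith
    thus ?thesis
    proof cases
      case 4
      hence "bs ! q = z" by (auto simp: bs_def nth_append nth_Cons split: nat.split)
      thus ?thesis using 4 z by (simp add: in_block_def)
    next
      case 5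
      moreover from 5 have "bs ! q = block_north G t" "q < length bs" using assms(2)
        by (auto simp: bs_def nth_append)
      ultimately show ?thesis using assms(2) by (auto simp: in_block_def)
    qed (use z assms(2) in \<open>auto simp: bs_def in_block_def nth_append\<close>)
  qed
  finally show ?thesis by (simp add: K_def)
qed

lemma conflict_in_block:
  assumes "D \<ge> 2"
  shows "conflict (tile_set G D i t) (tile_set G D j u) \<longleftrightarrow>
    (\<exists>q r. r < 1 + 2 * G \<and> in_block G D i t q r \<and> in_block G D j u q r)"
proof
  assume "conflict (tile_set G D i t) (tile_set G D j u)"
  then obtain m where m: "m < length (tile_set G D i t)" "m < length (tile_set G D j u)"
    "tile_set G D i t ! m" "tile_set G D j u ! m" by (auto simp: conflict_def)
  define q where "q = m div (1 + 2 * G)"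
  define r where "r = m mod (1 + 2 * G)"
  have mq: "m = q * (1 + 2 * G) + r" unfolding q_def r_def by (rule div_mult_mod_eq[symmetric])
  have r: "r < 1 + 2 * G" by (simp add: r_def)
  have "in_block G D i t q r \<and> in_block G D j u q r"
    using m tile_set_nth[OF r assms, of q i t] tile_set_nth[OF r assms, of q j u] unfolding mq by blast
  thus "\<exists>q r. r < 1 + 2 * G \<and> in_block G D i t q r \<and> in_block G D j u q r" using r by blast
next
  assume "\<exists>q r. r < 1 + 2 * G \<and> in_block G D i t q r \<and> in_block G D j u q r"
  then obtain q r where r: "r < 1 + 2 * G" and b: "in_block G D i t q r" "in_block G D j u q r" by blast
  show "conflict (tile_set G D i t) (tile_set G D j u)"
    using b tile_set_nth[OF r assms, of q i t] tile_set_nth[OF r assms, of q j u] unfolding conflict_def by blast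
qed

lemma block_nth:
  "block_own G t ! 0" "\<not> block_east G t ! 0" "\<not> block_north G t ! 0"
  "g < G \<Longrightarrow> block_own G t ! (1 + g) \<longleftrightarrow> west t = Some g"
  "g < G \<Longrightarrow> block_east G t ! (1 + g) \<longleftrightarrow> g \<noteq> east t"
  "g < G \<Longrightarrow> \<not> block_north G t ! (1 + g)"
  "g < G \<Longrightarrow> block_own G t ! (1 + G + g) \<longleftrightarrow> south t = Some g"
  "g < G \<Longrightarrow> \<not> block_east G t ! (1 + G + g)"
  "g < G \<Longrightarrow> block_north G t ! (1 + G + g) \<longleftrightarrow> g \<noteq> north t"
  by (simp_all add: block_own_def block_east_def block_north_def nth_append)

lemma ex_block_index:
  "(\<exists>r<1 + 2 * G. P r) \<longleftrightarrow> P 0 \<or> (\<exists>g<G. P (1 + g)) \<or> (\<exists>g<G. P (1 + G + (g :: nat)))"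
proof
  assume "\<exists>r<1 + 2 * G. P r"
  then obtain r where r: "r < 1 + 2 * G" "P r" by blast
  consider "r = 0" | g where "r = 1 + g" "g < G" | g where "r = 1 + G + g" "g < G"
  proof (cases "r = 0 \<or> r - 1 < G")
    case True
    thus thesis using that(1) that(2)[of "r - 1"] by (cases r) auto
  next
    case False
    show thesis by (rule that(3)[of "r - (1 + G)"]) (use False r(1) in linarith)+
  qed
  thus "P 0 \<or> (\<exists>g<G. P (1 + g)) \<or> (\<exists>g<G. P (1 + G + g))" using r(2) by cases auto
next
  assume "P 0 \<or> (\<exists>g<G. P (1 + g)) \<or> (\<exists>g<G. P (1 + G + g))"
  then consider "P 0" | g where "g < G" "P (1 + g)" | g where "g < G" "P (1 + G + g)" by blast
  thus "\<exists>r<1 + 2 * G. P r"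
  proof cases
    case 1
    thus ?thesis by (intro exI[of _ 0]) simp
  next
    case (2 g)
    thus ?thesis by (intro exI[of _ "1 + g"]) simp
  next
    case (3 g)
    thus ?thesis by (intro exI[of _ "1 + G + g"]) simp
  qed
qed

definition fits :: "nat \<Rightarrow> nat \<Rightarrow> tile \<Rightarrow> nat \<Rightarrow> tile \<Rightarrow> bool" where
  "fits D i t j u \<longleftrightarrow> (j = i + 1 \<longrightarrow> west u = None \<or> west u = Some (east t)) \<and>
     (j = i + D \<longrightarrow> south u = None \<or> south u = Some (north t))"

text \<open>Sets of the same cell share the element of the cell. For \<open>i < j\<close> the own
  block of \<open>j\<close> meets an east or north block of \<open>i\<close> only if the cells are
  neighbours, and there the common elements are exactly the mismatches. The one further coincidence
  is \<open>j + 1 = i + D\<close>, where an east block meets a north block; west and south colours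
  have separate halves of a block, so that these two are disjoint.\<close>

lemma conflict_tile_set:
  assumes "D \<ge> 2" "colours_below G t" "colours_below G u"
  shows "conflict (tile_set G D i t) (tile_set G D i u)"
    and "i < j \<Longrightarrow> conflict (tile_set G D i t) (tile_set G D j u) \<longleftrightarrow> \<not> fits D i t j u"
proof -
  show "conflict (tile_set G D i t) (tile_set G D i u)"
    unfolding conflict_in_block[OF assms(1)]
    by (intro exI[of _ i] exI[of _ 0]) (simp add: in_block_def block_nth)
  assume ij: "i < j"
  have "conflict (tile_set G D i t) (tile_set G D j u) \<longleftrightarrow>
      (\<exists>q. \<exists>r<1 + 2 * G. in_block G D i t q r \<and> in_block G D j u q r)"
    using conflict_in_block[OF assms(1), of G i t j u] by blast
  also have "\<dots> \<longleftrightarrow> (\<exists>r<1 + 2 * G. block_own G u ! r \<and> (j = i + 1 \<and> block_east G t ! r \<or> j = i + D \<and> block_north G t ! r)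
      \<or> j + 1 = i + D \<and> block_east G u ! r \<and> block_north G t ! r)"
    using ij assms(1) by (auto simp: in_block_def)
  also have "\<dots> \<longleftrightarrow> (\<exists>g<G. west u = Some g \<and> j = i + 1 \<and> g \<noteq> east t) \<or> (\<exists>g<G. south u = Some g \<and> j = i + D \<and> g \<noteq> north t)"
    unfolding ex_block_index using assms(1) by (auto simp: block_nth simp del: One_nat_def plus_1_eq_Suc)
  also have "\<dots> \<longleftrightarrow> \<not> fits D i t j u"
    using assms(2,3) by (auto simp: fits_def colours_below_def)
  finally show "conflict (tile_set G D i t) (tile_set G D j u) \<longleftrightarrow> \<not> fits D i t j u" .
qed

text \<open>All colours can be read off: west and south are the elements present in the own block,
  east and north the elements missing in the other two. This makes the candidates of an instance
  distinct.\<close>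

lemma tile_set_inject:
  assumes "D \<ge> 2" "colours_below G t" "colours_below G u" "tile_set G D i t = tile_set G D j u"
  shows "i = j \<and> t = u"
proof -
  have eq: "in_block G D i t q r \<longleftrightarrow> in_block G D j u q r" if "r < 1 + 2 * G" for q r
    using tile_set_nth[OF that assms(1), of q i t] tile_set_nth[OF that assms(1), of q j u] assms(4) by simp
  have ij: "i = j" using eq[of 0 i] by (auto simp: in_block_def block_nth)
  have own: "block_own G t ! r \<longleftrightarrow> block_own G u ! r" and east: "block_east G t ! r \<longleftrightarrow> block_east G u ! r"
    and north: "block_north G t ! r \<longleftrightarrow> block_north G u ! r" if "r < 1 + 2 * G" for r
    using eq[OF that, of i] eq[OF that, of "i + 1"] eq[OF that, of "i + D"] assms(1) by (auto simp: in_block_def ij)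
  have lt: "1 + g < 1 + 2 * G" "1 + G + g < 1 + 2 * G" if "g < G" for g using that by auto
  have 1: "west t = Some g \<longleftrightarrow> west u = Some g" "g = east t \<longleftrightarrow> g = east u"
    "south t = Some g \<longleftrightarrow> south u = Some g" "g = north t \<longleftrightarrow> g = north u" if "g < G" for g
    using own[OF lt(1)[OF that]] east[OF lt(1)[OF that]] own[OF lt(2)[OF that]] north[OF lt(2)[OF that]]
    by (simp_all only: block_nth(4,5,7,9)[OF that]) blast+
  have "west t = west u" using 1(1) assms(2,3) by (metis colours_below_def not_None_eq)
  moreover have "south t = south u" using 1(3) assms(2,3) by (metis colours_below_def not_None_eq)
  moreover have "east t = east u" "north t = north u" using 1(2,4) assms(2) by (auto simp: colours_below_def)
  ultimately show ?thesis using ij by (cases t; cases u) auto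
qed

text \<open>Sets of the same cell conflict, so \<open>N\<close> pairwise disjoint sets belong to
  \<open>N\<close> different cells, that is, to all of them. Disjointness of all pairs is then the
  matching of all neighbours.\<close>

lemma packing_iff_tiling:
  assumes "D \<ge> 2" "\<And>i t. i < N \<Longrightarrow> t \<in> opts i \<Longrightarrow> colours_below G t"
  shows "(\<exists>T\<subseteq>{tile_set G D i t | i t. i < N \<and> t \<in> opts i}. card T = N \<and> packed T (\<lambda>c. c)) \<longleftrightarrow>
    (\<exists>\<tau>. \<forall>i<N. \<tau> i \<in> opts i \<and> (\<forall>j<N. fits D i (\<tau> i) j (\<tau> j)))"
proof
  assume "\<exists>T\<subseteq>{tile_set G D i t | i t. i < N \<and> t \<in> opts i}. card T = N \<and> packed T (\<lambda>c. c)"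
  then obtain T where T: "T \<subseteq> {tile_set G D i t | i t. i < N \<and> t \<in> opts i}" "card T = N" "packed T (\<lambda>c. c)" by blast
  have "\<forall>c\<in>T. \<exists>p. fst p < N \<and> snd p \<in> opts (fst p) \<and> c = tile_set G D (fst p) (snd p)" using T(1) by fastforce
  then obtain p where p: "\<And>c. c \<in> T \<Longrightarrow> fst (p c) < N \<and> snd (p c) \<in> opts (fst (p c)) \<and> c = tile_set G D (fst (p c)) (snd (p c))"
    by metis
  have cb: "colours_below G (snd (p c))" if "c \<in> T" for c using p[OF that] assms(2) by blast
  have inj: "inj_on (\<lambda>c. fst (p c)) T"
  proof (rule inj_onI, rule ccontr)
    fix c d assume cd: "c \<in> T" "d \<in> T" "fst (p c) = fst (p d)" "c \<noteq> d"
    have "conflict c d"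
      using conflict_tile_set(1)[OF assms(1) cb[OF cd(1)] cb[OF cd(2)], of "fst (p c)"] p[OF cd(1)] p[OF cd(2)] cd(3) by metis
    thus False using T(3) cd unfolding packed_def by blast
  qed
  have img: "(\<lambda>c. fst (p c)) ` T = {..<N}"
    by (rule card_subset_eq) (use p in \<open>auto simp: card_image[OF inj] T(2)\<close>)
  have "\<exists>c. i < N \<longrightarrow> c \<in> T \<and> fst (p c) = i" for i
  proof (cases "i < N")
    case True
    hence "i \<in> (\<lambda>c. fst (p c)) ` T" unfolding img by simp
    thus ?thesis by auto
  qed simp
  then obtain c where c: "\<And>i. i < N \<Longrightarrow> c i \<in> T \<and> fst (p (c i)) = i" by metis
  have "fits D i (snd (p (c i))) j (snd (p (c j)))" if ij: "i < N" "j < N" for i j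
  proof (cases "i < j")
    case True
    have ne: "c i \<noteq> c j" using c[OF ij(1)] c[OF ij(2)] True by auto
    hence "\<not> conflict (c i) (c j)" using T(3) c ij unfolding packed_def by blast
    thus ?thesis
      using conflict_tile_set(2)[OF assms(1) cb[of "c i"] cb[of "c j"] True] c[OF ij(1)] c[OF ij(2)] p[of "c i"] p[of "c j"]
      by simp
  next
    case False
    thus ?thesis using assms(1) by (simp add: fits_def)
  qed
  moreover have "snd (p (c i)) \<in> opts i" if "i < N" for i using c[OF that] p by metis
  ultimately show "\<exists>\<tau>. \<forall>i<N. \<tau> i \<in> opts i \<and> (\<forall>j<N. fits D i (\<tau> i) j (\<tau> j))"
    by (intro exI[of _ "\<lambda>i. snd (p (c i))"]) blast
next
  assume "\<exists>\<tau>. \<forall>i<N. \<tau> i \<in> opts i \<and> (\<forall>j<N. fits D i (\<tau> i) j (\<tau> j))"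
  then obtain \<tau> where \<tau>: "\<And>i. i < N \<Longrightarrow> \<tau> i \<in> opts i" "\<And>i j. i < N \<Longrightarrow> j < N \<Longrightarrow> fits D i (\<tau> i) j (\<tau> j)" by blast
  let ?c = "\<lambda>i. tile_set G D i (\<tau> i)"
  have cb: "colours_below G (\<tau> i)" if "i < N" for i by (rule assms(2)[OF that \<tau>(1)[OF that]])
  have inj: "inj_on ?c {..<N}"
  proof (rule inj_onI)
    fix i j assume "i \<in> {..<N}" "j \<in> {..<N}" "?c i = ?c j"
    thus "i = j" using tile_set_inject[OF assms(1) cb[of i] cb[of j], of i j] by simp
  qed
  have nc: "\<not> conflict (?c i) (?c j)" if "i < j" "j < N" for i j
    using conflict_tile_set(2)[OF assms(1) cb[of i] cb[of j] that(1)] \<tau>(2)[of i j] that by simp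
  have comm: "conflict a b \<longleftrightarrow> conflict b a" for a b unfolding conflict_def by blast
  have "packed (?c ` {..<N}) (\<lambda>c. c)"
    unfolding packed_def
  proof (intro ballI conjI impI)
    fix c assume "c \<in> ?c ` {..<N}"
    thus "True \<in> set c" by (auto simp: tile_set_def block_own_def)
  next
    fix c d assume "c \<in> ?c ` {..<N}" "d \<in> ?c ` {..<N}" "c \<noteq> d"
    then obtain i j where "c = ?c i" "d = ?c j" "i < N" "j < N" "i \<noteq> j" by auto
    thus "\<not> conflict c d" using nc[of i j] nc[of j i] comm[of c d] by (metis nat_neq_iff)
  qed
  moreover have "card (?c ` {..<N}) = N" by (simp add: card_image[OF inj])
  moreover have "?c ` {..<N} \<subseteq> {tile_set G D i t | i t. i < N \<and> t \<in> opts i}" using \<tau>(1) by blast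
  ultimately show "\<exists>T\<subseteq>{tile_set G D i t | i t. i < N \<and> t \<in> opts i}. card T = N \<and> packed T (\<lambda>c. c)" by blast
qed

section \<open>From Turing machines to tilings\<close>

type_synonym column = "nat \<times> nat list \<times> bool list"

definition heads :: "config \<Rightarrow> int \<Rightarrow> bool list" where
  "heads c p = map (\<lambda>t. snd t = p) (snd c)"

definition reads :: "config \<Rightarrow> nat list" where
  "reads c = map read_tape (snd c)"

text \<open>All tapes are superposed: a column shows, for one position, the symbols of every tape
  and the heads standing there. The state is repeated in every column, so that each one can compute
  its successor.\<close>

definition column :: "config \<Rightarrow> int \<Rightarrow> column" where
  "column c p = (fst c, map (\<lambda>t. fst t p) (snd c), heads c p)"

text \<open>
  The column at a position after a step is determined by the column before, the symbols \<open>rs\<close> read by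
  all heads and the heads \<open>hl\<close>, \<open>hr\<close> at the two neighbouring positions.
\<close>

definition next_column :: "tm \<Rightarrow> nat list \<Rightarrow> bool list \<Rightarrow> bool list \<Rightarrow> column \<Rightarrow> column" where
  "next_column M rs hl hr c = (case c of (q, sy, h) \<Rightarrow>
     if q = num_states M then c
     else (case trans M q rs of (q', as) \<Rightarrow>
       (q', map (\<lambda>i. if h ! i then fst (as ! i) else sy ! i) [0..<num_tapes M],
        map (\<lambda>i. h ! i \<and> snd (as ! i) = 0 \<or> hl ! i \<and> snd (as ! i) = 1 \<or> hr ! i \<and> snd (as ! i) = -1)
          [0..<num_tapes M])))"

lemma column_step:
  assumes M: "turing_machine M" and v: "valid_tapes (num_tapes M) (num_syms M) ts" and q: "q \<le> num_states M"
  shows "column (step M (q, ts)) p =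
    next_column M (reads (q, ts)) (heads (q, ts) (p - 1)) (heads (q, ts) (p + 1)) (column (q, ts) p)"
proof (cases "q = num_states M")
  case True
  thus ?thesis by (simp add: step_def next_column_def column_def)
next
  case False
  obtain q' as where d: "trans M q (map read_tape ts) = (q', as)" by fastforce
  have as: "length as = num_tapes M" "set as \<subseteq> {..<num_syms M} \<times> {-1, 0, 1}"
    using valid_trans[OF M _ False valid_reads[OF v]] q d by (auto simp: valid_move_def)
  have ts: "length ts = num_tapes M" using v by (simp add: valid_tapes_def)
  have mv: "snd (as ! i) \<in> {-1, 0, 1}" if "i < num_tapes M" for i
    using subsetD[OF as(2) nth_mem[of i as]] that as(1) by (auto simp: mem_Times_iff)
  have move: "snd (ts ! i) + snd (as ! i) = p \<longleftrightarrow> snd (ts ! i) = p \<and> snd (as ! i) = 0 \<or>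
      snd (ts ! i) = p - 1 \<and> snd (as ! i) = 1 \<or> snd (ts ! i) = p + 1 \<and> snd (as ! i) = -1"
    if "i < num_tapes M" for i using mv[OF that] by auto
  have "step M (q, ts) = (q', map2 act as ts)" using False d by (simp add: step_def)
  moreover have "map (\<lambda>t. fst t p) (map2 act as ts) =
      map (\<lambda>i. if map (\<lambda>t. snd t = p) ts ! i then fst (as ! i) else map (\<lambda>t. fst t p) ts ! i) [0..<num_tapes M]"
    using as(1) ts by (intro nth_equalityI) (auto simp: act_def)
  moreover have "map (\<lambda>t. snd t = p) (map2 act as ts) = map (\<lambda>i. map (\<lambda>t. snd t = p) ts ! i \<and> snd (as ! i) = 0 \<or>
      map (\<lambda>t. snd t = p - 1) ts ! i \<and> snd (as ! i) = 1 \<or>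
      map (\<lambda>t. snd t = p + 1) ts ! i \<and> snd (as ! i) = -1) [0..<num_tapes M]"
    using as(1) ts by (intro nth_equalityI) (simp_all add: act_def move)
  ultimately show ?thesis using False d by (simp add: next_column_def column_def heads_def reads_def)
qed

definition syms_lists :: "tm \<Rightarrow> nat list set" where
  "syms_lists M = {xs. set xs \<subseteq> {..<num_syms M} \<and> length xs = num_tapes M}"

definition head_lists :: "tm \<Rightarrow> bool list set" where
  "head_lists M = {xs. set xs \<subseteq> UNIV \<and> length xs = num_tapes M}"

text \<open>A vertical edge carries the guessed read symbols and the heads in the two columns it
  separates. Matching thus spreads one guess over the row and forces \<open>hl\<close> and
  \<open>hr\<close> to be the heads of the actual neighbours. South and north are the column before
  and after the step.\<close>

definition step_tile :: "tm \<Rightarrow> bool \<Rightarrow> column \<times> nat list \<times> bool list \<times> bool list \<Rightarrow> tile" where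
  "step_tile M fst_col = (\<lambda>(c, rs, hl, hr).
     (if fst_col then None else Some (to_nat (rs, hl, snd (snd c))), to_nat (rs, snd (snd c), hr),
      Some (to_nat c), to_nat (next_column M rs hl hr c)))"

text \<open>Where a head stands, the guess for its tape must agree with the symbol in the column. No
  heads may be guessed outside the two borders. \<open>acc\<close> demands that after the step the
  machine has halted with the bit \<open>True\<close> on the output tape.\<close>

definition local_views :: "tm \<Rightarrow> bool \<Rightarrow> bool \<Rightarrow> bool \<Rightarrow> (column \<times> nat list \<times> bool list \<times> bool list) set" where
  "local_views M fst_col lst_col acc = {((q, sy, h), rs, hl, hr).
     q \<in> {..num_states M} \<and> sy \<in> syms_lists M \<and> h \<in> head_lists M \<and> rs \<in> syms_lists M \<and>
     hl \<in> head_lists M \<and> hr \<in> head_lists M \<and> (\<forall>i<num_tapes M. h ! i \<longrightarrow> sy ! i = rs ! i) \<and>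
     (fst_col \<longrightarrow> True \<notin> set hl) \<and> (lst_col \<longrightarrow> True \<notin> set hr) \<and>
     (acc \<longrightarrow> (case next_column M rs hl hr (q, sy, h) of (q', sy', h') \<Rightarrow> q' = num_states M \<and> sy' ! 1 = 2))}"

definition step_tiles :: "tm \<Rightarrow> bool \<Rightarrow> bool \<Rightarrow> bool \<Rightarrow> tile set" where
  "step_tiles M fst_col lst_col acc = step_tile M fst_col ` local_views M fst_col lst_col acc"

text \<open>
  The tiles of row \<open>0\<close> guess the input: their horizontal colours are the states of an automaton that
  checks the format of the certificate, where \<open>0\<close> expects a marker, \<open>1\<close> expects a bit and \<open>2\<close> expects
  blanks. A transition \<open>(s, s', a)\<close> goes from \<open>s\<close> to \<open>s'\<close> and writes the symbol \<open>a\<close>.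
\<close>

definition init_tiles :: "tm \<Rightarrow> bool \<Rightarrow> (nat \<times> nat \<times> nat) set \<Rightarrow> bool \<Rightarrow> tile set" where
  "init_tiles M fst_col A hb = (\<lambda>(s, s', a).
     (if fst_col then None else Some s, s', None,
      to_nat (0 :: nat, a # replicate (num_tapes M - 1) 0, replicate (num_tapes M) hb))) ` A"

definition any_trs :: "(nat \<times> nat \<times> nat) set" where
  "any_trs = {(0, 1, 2), (0, 2, 1), (1, 0, 1), (1, 0, 2), (2, 2, 0)}"

definition last_trs :: "(nat \<times> nat \<times> nat) set" where
  "last_trs = {(0, 2, 1), (2, 2, 0)}"

definition end_trs :: "(nat \<times> nat \<times> nat) set" where
  "end_trs = {(2, 2, 0)}"

text \<open>The code of a string of length \<open>n\<close> has its final \<open>False\<close> at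
  offset \<open>2 * n\<close>. Admitting at offset \<open>2 * P\<close> only this end mark or a
  blank, and blanks afterwards, limits the certificate to length \<open>P\<close>.\<close>

definition cert_trs :: "nat \<Rightarrow> nat \<Rightarrow> (nat \<times> nat \<times> nat) set" where
  "cert_trs P i = (if i < 2 * P then any_trs else if i = 2 * P then last_trs else end_trs)"

text \<open>Tapes are infinite in both directions, so position \<open>0\<close> is placed in column
  \<open>T\<close>, with \<open>T\<close> blank columns to its left. The automaton stays in state
  \<open>0\<close> until the certificate begins behind \<open>w\<close>.\<close>

definition row0_trs :: "bool list \<Rightarrow> nat \<Rightarrow> nat \<Rightarrow> nat \<Rightarrow> (nat \<times> nat \<times> nat) set" where
  "row0_trs w P T j = (if j < T then {(0, 0, 0)}
     else if j < T + length w then {(0, 0, if w ! (j - T) then 2 else 1)}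
     else cert_trs P (j - (T + length w)))"

text \<open>The columns are the positions from \<open>-T\<close> to \<open>T + 1\<close>, which no
  head can leave in \<open>T\<close> steps. Tiles in column \<open>0\<close> have no west colour,
  since in the numbering of the cells they follow the last cell of the previous row. Acceptance is
  tested once, in the last row at position \<open>0\<close>.\<close>

definition grid_tiles :: "tm \<Rightarrow> bool list \<Rightarrow> nat \<Rightarrow> nat \<Rightarrow> nat \<Rightarrow> nat \<Rightarrow> tile set" where
  "grid_tiles M w P T r j = (if r = 0 then init_tiles M (j = 0) (row0_trs w P T j) (j = T)
     else step_tiles M (j = 0) (j = 2 * T + 1) (r = T \<and> j = T))"

section \<open>The guessed certificate in row 0\<close>

lemma contents_Cons:
  "contents (b # v) 0 = (if b then 2 else 1)" "contents (b # v) (int (Suc i)) = contents v (int i)"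
  by (auto simp: contents_def nat_add_distrib)

lemma contents_Nil: "contents [] p = 0"
  by (simp add: contents_def)

lemma contents_append_right: "contents (w @ v) (int (length w + i)) = contents v (int i)"
  by (induction w) (auto simp: contents_Cons simp del: of_nat_Suc)

lemma contents_append_left: "i < length w \<Longrightarrow> contents (w @ v) (int i) = (if w ! i then 2 else 1)"
  by (simp add: contents_def nth_append)

lemma cert_trs_mem:
  "(s, s', a) \<in> cert_trs P i \<Longrightarrow> s = 2 \<Longrightarrow> s' = 2 \<and> a = 0"
  "(2, 2, 0) \<in> cert_trs P i"
  by (auto simp: cert_trs_def any_trs_def last_trs_def end_trs_def split: if_splits)

lemma cert_stop:
  assumes tr: "\<And>i. i < n \<Longrightarrow> (\<sigma> i, \<sigma> (Suc i), a i) \<in> cert_trs P i" and s: "\<sigma> (Suc 0) = 2" "a 0 = 1"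
  shows "\<exists>y. length y \<le> P \<and> (\<forall>i<n. a i = contents (enc_string y) (int i))"
proof -
  have st: "i \<le> n \<longrightarrow> 1 \<le> i \<longrightarrow> \<sigma> i = 2" for i
  proof (induction i)
    case (Suc i)
    thus ?case using s(1) cert_trs_mem(1)[OF tr[of i]] by (cases i) auto
  qed simp
  have "a i = contents (enc_string []) (int i)" if "i < n" for i
  proof (cases i)
    case 0
    thus ?thesis using s(2) contents_Cons(1)[of False "[]"] by (simp add: enc_string_Nil)
  next
    case (Suc j)
    thus ?thesis using cert_trs_mem(1)[OF tr[OF that]] st[of i] that
      by (simp only: enc_string_Nil contents_Cons contents_Nil)
  qed
  thus ?thesis by (intro exI[of _ "[]"]) simp
qed

text \<open>Induction on \<open>P\<close>: stripping off a marker and its bit shifts the offsets by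
  two, which turns \<open>cert_trs (Suc P)\<close> into \<open>cert_trs P\<close>.\<close>

lemma cert_sound:
  assumes "\<And>i. i < n \<Longrightarrow> (\<sigma> i, \<sigma> (Suc i), a i) \<in> cert_trs P i" "\<sigma> 0 = 0" "2 * P < n"
  shows "\<exists>y. length y \<le> P \<and> (\<forall>i<n. a i = contents (enc_string y) (int i))"
  using assms
proof (induction P arbitrary: \<sigma> a n)
  case 0
    hence "(\<sigma> 0, \<sigma> (Suc 0), a 0) \<in> last_trs" using 0(1)[of 0] by (simp add: cert_trs_def)
    hence "\<sigma> (Suc 0) = 2" "a 0 = 1" using 0(2) by (auto simp: last_trs_def)
    thus ?case using cert_stop[of n \<sigma> a 0] 0(1) by blast
  next
    case (Suc P)
    have "(\<sigma> 0, \<sigma> (Suc 0), a 0) \<in> any_trs" using Suc.prems(1)[of 0] Suc.prems(3) by (simp add: cert_trs_def)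
    then consider "\<sigma> (Suc 0) = 2" "a 0 = 1" | "\<sigma> (Suc 0) = 1" "a 0 = 2"
      using Suc.prems(2) by (auto simp: any_trs_def)
    thus ?case
    proof cases
      case 1
      thus ?thesis using cert_stop[of n \<sigma> a "Suc P"] Suc.prems(1) by blast
    next
      case 2
      have "(\<sigma> 1, \<sigma> (Suc 1), a 1) \<in> any_trs"
        using Suc.prems(1)[of 1] Suc.prems(3) by (simp add: cert_trs_def)
      then obtain b where b: "\<sigma> (Suc (Suc 0)) = 0" "a (Suc 0) = (if b then 2 else 1)"
        using 2 by (auto simp: any_trs_def intro: that[of True] that[of False])
      have "\<exists>y. length y \<le> P \<and> (\<forall>i<n - 2. a (Suc (Suc i)) = contents (enc_string y) (int i))"
      proof (rule Suc.IH[of "n - 2" "\<lambda>i. \<sigma> (Suc (Suc i))"])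
        fix i assume "i < n - 2"
        thus "(\<sigma> (Suc (Suc i)), \<sigma> (Suc (Suc (Suc i))), a (Suc (Suc i))) \<in> cert_trs P i"
          using Suc.prems(1)[of "Suc (Suc i)"] by (auto simp: cert_trs_def split: if_splits)
      qed (use b Suc.prems(3) in auto)
      then obtain y where y: "length y \<le> P" "\<And>i. i < n - 2 \<Longrightarrow> a (Suc (Suc i)) = contents (enc_string y) (int i)"
        by blast
      have "a i = contents (enc_string (b # y)) (int i)" if "i < n" for i
      proof -
        consider "i = 0" | "i = Suc 0" | j where "i = Suc (Suc j)" by (metis not0_implies_Suc)
        thus ?thesis
        proof cases
          case 3
          thus ?thesis using y(2)[of j] that by (simp only: enc_string_Cons contents_Cons)
        next
          case 2
          thus ?thesis using b(2) contents_Cons(2)[of True "b # enc_string y" 0]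
            by (simp add: enc_string_Cons contents_Cons)
        qed (use 2 in \<open>simp add: enc_string_Cons contents_Cons\<close>)
      qed
      thus ?thesis using y(1) by (intro exI[of _ "b # y"]) simp
    qed
qed

lemma cert_complete:
  assumes "length y \<le> P"
  shows "\<exists>\<sigma>. \<sigma> 0 = 0 \<and> (\<forall>i. (\<sigma> i, \<sigma> (Suc i), contents (enc_string y) (int i)) \<in> cert_trs P i)"
  using assms
proof (induction y arbitrary: P)
  case Nil
  let ?\<sigma> = "\<lambda>i :: nat. if i = 0 then 0 else 2"
  have "(?\<sigma> i, ?\<sigma> (Suc i), contents (enc_string []) (int i)) \<in> cert_trs P i" for i
  proof (cases i)
    case 0
    have "contents [False] 0 = 1" using contents_Cons(1)[of False "[]"] by simp
    thus ?thesis using 0 by (simp add: enc_string_Nil cert_trs_def any_trs_def last_trs_def)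
  next
    case (Suc j)
    have "contents (enc_string []) (int i) = 0" unfolding Suc enc_string_Nil contents_Cons contents_Nil ..
    thus ?thesis using cert_trs_mem(2) Suc by simp
  qed
  thus ?case by (intro exI[of _ ?\<sigma>]) simp
next
  case (Cons b y)
  then obtain P' where P: "P = Suc P'" "length y \<le> P'" by (cases P) auto
  obtain \<sigma> where \<sigma>: "\<sigma> 0 = 0" "\<And>i. (\<sigma> i, \<sigma> (Suc i), contents (enc_string y) (int i)) \<in> cert_trs P' i"
    using Cons.IH[OF P(2)] by blast
  let ?\<sigma> = "\<lambda>i. case i of 0 \<Rightarrow> 0 | Suc 0 \<Rightarrow> 1 | Suc (Suc j) \<Rightarrow> \<sigma> j"
  have "(?\<sigma> i, ?\<sigma> (Suc i), contents (enc_string (b # y)) (int i)) \<in> cert_trs P i" for i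
  proof -
    consider "i = 0" | "i = Suc 0" | j where "i = Suc (Suc j)" by (metis not0_implies_Suc)
    thus ?thesis
    proof cases
      case 1
      thus ?thesis using P(1) by (simp add: enc_string_Cons contents_Cons cert_trs_def any_trs_def)
    next
      case 2
      have "contents (enc_string (b # y)) (int i) = (if b then 2 else 1)"
        unfolding 2 enc_string_Cons contents_Cons(2) using contents_Cons(1) by simp
      thus ?thesis using P(1) 2 \<sigma>(1) by (simp add: cert_trs_def any_trs_def)
    next
      case 3
      have "contents (enc_string (b # y)) (int i) = contents (enc_string y) (int j)"
        unfolding 3 enc_string_Cons contents_Cons ..
      thus ?thesis using \<sigma>(2)[of j] P(1) 3 by (auto simp: cert_trs_def split: if_splits)
    qed
  qed
  thus ?case by (intro exI[of _ ?\<sigma>]) simp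
qed


section \<open>Grids of tiles and runs of a machine\<close>

lemma column_start:
  assumes "num_tapes M \<ge> 1"
  shows "column (start_config M u) p = (0, contents u p # replicate (num_tapes M - 1) 0, replicate (num_tapes M) (p = 0))"
proof -
  have "replicate (num_tapes M) (p = 0) = (p = 0) # replicate (num_tapes M - 1) (p = 0)"
    using assms by (metis Suc_diff_1 Suc_le_eq One_nat_def replicate_Suc)
  thus ?thesis by (auto simp: column_def heads_def start_config_def contents_Nil)
qed

definition run :: "tm \<Rightarrow> bool list \<Rightarrow> nat \<Rightarrow> config" where
  "run M u r = (step M ^^ r) (start_config M u)"

lemma run_valid:
  assumes "turing_machine M"
  shows "fst (run M u r) \<le> num_states M" "valid_tapes (num_tapes M) (num_syms M) (snd (run M u r))"
  using valid_steps[OF assms valid_start[OF assms, of u], of 0 r] by (simp_all add: run_def start_config_def)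

lemma run_column_Suc:
  assumes "turing_machine M"
  shows "column (run M u (Suc r)) p = next_column M (reads (run M u r)) (heads (run M u r) (p - 1))
    (heads (run M u r) (p + 1)) (column (run M u r) p)"
  using column_step[OF assms run_valid(2)[OF assms, of u r] run_valid(1)[OF assms, of u r], of p]
  by (simp add: run_def)

lemma run_heads_far:
  assumes "turing_machine M" "\<bar>p\<bar> > int r"
  shows "True \<notin> set (heads (run M u r) p)"
proof
  assume "True \<in> set (heads (run M u r) p)"
  then obtain t where t: "t < length (snd (run M u r))" "snd (snd (run M u r) ! t) = p"
    by (auto simp: heads_def in_set_conv_nth)
  hence "t < num_tapes M" using run_valid(2)[OF assms(1), of u r] by (simp add: valid_tapes_def)
  thus False using head_bound[OF assms(1), of t r u] t(2) assms(2) by (simp add: run_def)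
qed

lemma run_views:
  assumes "turing_machine M"
  shows "fst (column (run M u r) p) \<in> {..num_states M}" "fst (snd (column (run M u r) p)) \<in> syms_lists M"
    "heads (run M u r) p \<in> head_lists M" "reads (run M u r) \<in> syms_lists M"
  using run_valid[OF assms, of u r]
  by (auto simp: column_def heads_def reads_def syms_lists_def head_lists_def valid_tapes_def read_tape_def)

lemma all_false_eq: "length xs = length ys \<Longrightarrow> True \<notin> set xs \<Longrightarrow> True \<notin> set ys \<Longrightarrow> xs = ys"
  by (metis (full_types) nth_equalityI nth_mem)

text \<open>Row \<open>0\<close> spells some \<open>w @ enc_string y\<close>. By induction the north
  colours of row \<open>r\<close> are then the columns after \<open>r\<close> steps: the horizontal
  colours supply the heads next to a column, and the guessed symbols are right because every head is
  in some column of the grid, where its entry is checked.\<close>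

lemma grid_sound:
  fixes g :: "nat \<Rightarrow> nat \<Rightarrow> tile"
  assumes M: "turing_machine M" and T: "length w + 2 * P \<le> T" "1 \<le> T"
    and mem: "\<And>r j. r \<le> T \<Longrightarrow> j < 2 * T + 2 \<Longrightarrow> g r j \<in> grid_tiles M w P T r j"
    and ew: "\<And>r j. r \<le> T \<Longrightarrow> j < 2 * T + 1 \<Longrightarrow> west (g r (Suc j)) \<in> {None, Some (east (g r j))}"
    and ns: "\<And>r j. r < T \<Longrightarrow> j < 2 * T + 2 \<Longrightarrow> south (g (Suc r) j) \<in> {None, Some (north (g r j))}"
  shows "\<exists>y. length y \<le> P \<and> fst (run M (w @ enc_string y) T) = num_states M \<and>
    fst (snd (run M (w @ enc_string y) T) ! 1) 0 = 2"
proof -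
  let ?k = "num_tapes M"
  let ?D = "2 * T + 2"
  have k: "?k \<ge> 2" using M by (simp add: turing_machine_def)
  have "\<exists>s s' a. j < ?D \<longrightarrow> (s, s', a) \<in> row0_trs w P T j \<and>
      g 0 j = (if j = 0 then None else Some s, s', None, to_nat (0 :: nat, a # replicate (?k - 1) (0 :: nat), replicate ?k (j = T)))" for j
  proof (cases "j < ?D")
    case True
    thus ?thesis using mem[of 0 j] unfolding grid_tiles_def init_tiles_def by auto
  qed simp
  then obtain s s' a where row0: "\<And>j. j < ?D \<Longrightarrow> (s j, s' j, a j) \<in> row0_trs w P T j"
    "\<And>j. j < ?D \<Longrightarrow> g 0 j = (if j = 0 then None else Some (s j), s' j, None,
       to_nat (0 :: nat, a j # replicate (?k - 1) (0 :: nat), replicate ?k (j = T)))" by metis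
  \<comment> \<open>\<open>\<sigma> j\<close> is the state in which column \<open>j\<close> is
    entered; beyond the last column it is the state in which that column is left.\<close>
  define \<sigma> where "\<sigma> = (\<lambda>j. if j < ?D then s j else s' (?D - 1))"
  have chain: "s' j = \<sigma> (Suc j)" if "j < ?D" for j
  proof (cases "Suc j < ?D")
    case True
    hence "j < 2 * T + 1" by simp
    thus ?thesis using ew[of 0 j] row0(2)[of j] row0(2)[of "Suc j"] True that by (auto simp: \<sigma>_def)
  next
    case False
    hence "j = ?D - 1" using that by simp
    thus ?thesis by (simp add: \<sigma>_def)
  qed
  have tr: "(\<sigma> j, \<sigma> (Suc j), a j) \<in> row0_trs w P T j" if "j < ?D" for j
    using row0(1)[OF that] chain[OF that] that by (simp add: \<sigma>_def)
  let ?o = "T + length w"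
  \<comment> \<open>\<open>1 \<le> T\<close> provides a column in front of the certificate, and all
    transitions of that column end in state \<open>0\<close>.\<close>
  have "\<sigma> ?o = 0"
  proof -
    obtain j where j: "?o = Suc j" using T(2) by (cases ?o) auto
    hence "j < ?D" "j < ?o" using T(1) by simp_all
    thus ?thesis using tr[of j] unfolding j by (auto simp: row0_trs_def j[symmetric] split: if_splits)
  qed
  have "\<exists>y. length y \<le> P \<and> (\<forall>i<?D - ?o. a (?o + i) = contents (enc_string y) (int i))"
  proof (rule cert_sound[where \<sigma> = "\<lambda>i. \<sigma> (?o + i)"])
    fix i assume "i < ?D - ?o"
    thus "(\<sigma> (?o + i), \<sigma> (?o + Suc i), a (?o + i)) \<in> cert_trs P i"
      using tr[of "?o + i"] by (simp add: row0_trs_def)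
  qed (use \<open>\<sigma> ?o = 0\<close> T(1) in auto)
  then obtain y where y: "length y \<le> P" "\<And>i. i < ?D - ?o \<Longrightarrow> a (?o + i) = contents (enc_string y) (int i)" by blast
  let ?u = "w @ enc_string y"
  have a: "a j = contents ?u (int j - int T)" if "j < ?D" for j
  proof -
    consider "j < T" | "T \<le> j" "j < ?o" | i where "j = ?o + i" "i < ?D - ?o"
    proof (cases "j < ?o")
      case False
      thus thesis using that that(3)[of "j - ?o"] \<open>j < ?D\<close> by simp
    qed (use that in \<open>cases "j < T"; simp\<close>)
    thus ?thesis
    proof cases
      case 1
      thus ?thesis using tr[OF that] by (simp add: row0_trs_def contents_def)
    next
      case 2
      hence "int j - int T = int (j - T)" "j - T < length w" by auto
      thus ?thesis using tr[OF that] 2 contents_append_left[of "j - T" w "enc_string y"] by (simp add: row0_trs_def)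
    next
      case 3
      have "int j - int T = int (length w + i)" using 3 by simp
      thus ?thesis using y(2)[OF 3(2)] 3(1) contents_append_right[of w "enc_string y" i] by simp
    qed
  qed
  define c where "c = run M ?u"
  have "r \<le> T \<Longrightarrow> \<forall>j<?D. north (g r j) = to_nat (column (c r) (int j - int T))" for r
  proof (induction r)
    case 0
    have "c 0 = start_config M ?u" by (simp add: c_def run_def)
    thus ?case using row0(2) a column_start[of M ?u] k by auto
  next
    case (Suc r)
    hence r: "r < T" and IH: "\<And>j. j < ?D \<Longrightarrow> north (g r j) = to_nat (column (c r) (int j - int T))" by auto
    let ?p = "\<lambda>j. int j - int T"
    have "\<exists>v. j < ?D \<longrightarrow> v \<in> local_views M (j = 0) (j = 2 * T + 1) (Suc r = T \<and> j = T) \<and>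
        g (Suc r) j = step_tile M (j = 0) v" for j
    proof (cases "j < ?D")
      case True
      hence "g (Suc r) j \<in> step_tile M (j = 0) ` local_views M (j = 0) (j = 2 * T + 1) (Suc r = T \<and> j = T)"
        using mem[of "Suc r" j] r by (simp add: grid_tiles_def step_tiles_def)
      thus ?thesis by blast
    qed simp
    then obtain v where v: "\<And>j. j < ?D \<Longrightarrow> v j \<in> local_views M (j = 0) (j = 2 * T + 1) (Suc r = T \<and> j = T) \<and>
        g (Suc r) j = step_tile M (j = 0) (v j)" by metis
    define cl where "cl = (\<lambda>j. fst (v j))"
    define rs where "rs = (\<lambda>j. fst (snd (v j)))"
    define hl where "hl = (\<lambda>j. fst (snd (snd (v j))))"
    define hr where "hr = (\<lambda>j. snd (snd (snd (v j))))"
    have vj: "v j = (cl j, rs j, hl j, hr j)" for j by (simp add: cl_def rs_def hl_def hr_def)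
    have cl: "cl j = column (c r) (?p j)" if "j < ?D" for j
      using ns[OF r that] IH[OF that] v[OF that] by (auto simp: vj step_tile_def)
    have h: "snd (snd (cl j)) = heads (c r) (?p j)" if "j < ?D" for j using cl[OF that] by (simp add: column_def)
    have nb: "rs (Suc j) = rs j \<and> hl (Suc j) = heads (c r) (?p j) \<and> hr j = heads (c r) (?p (Suc j))"
      if "Suc j < ?D" for j
      using ew[of "Suc r" j] r that v[of j] v[of "Suc j"] h[of j] h[of "Suc j"] by (auto simp: vj step_tile_def)
    have lens: "length (hl j) = ?k" "length (hr j) = ?k" "length (rs j) = ?k" if "j < ?D" for j
      using v[OF that] by (auto simp: vj local_views_def head_lists_def syms_lists_def)
    have len: "length (heads (c r) p) = ?k" for p
      using run_views(3)[OF M, of ?u r p] by (simp add: c_def head_lists_def)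
    have hl: "hl j = heads (c r) (?p j - 1)" if "j < ?D" for j
    proof (cases j)
      case 0
      have "True \<notin> set (hl j)" using v[OF that] 0 by (auto simp: vj local_views_def)
      moreover have "True \<notin> set (heads (c r) (?p j - 1))"
        unfolding c_def using r 0 by (intro run_heads_far[OF M]) simp
      ultimately show ?thesis using lens[OF that] len by (intro all_false_eq) simp_all
    next
      case (Suc i)
      have "?p i = ?p j - 1" by (simp add: Suc)
      thus ?thesis using nb[of i] that unfolding Suc by simp
    qed
    have hr: "hr j = heads (c r) (?p j + 1)" if "j < ?D" for j
    proof (cases "Suc j < ?D")
      case False
      hence j: "j = 2 * T + 1" using that by simp
      have "True \<notin> set (hr j)" using v[OF that] j by (auto simp: vj local_views_def)
      moreover have "True \<notin> set (heads (c r) (?p j + 1))"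
        unfolding c_def using r j by (intro run_heads_far[OF M]) simp
      ultimately show ?thesis using lens[OF that] len by (intro all_false_eq) simp_all
    next
      case True
      have "?p (Suc j) = ?p j + 1" by simp
      thus ?thesis using nb[OF True] by metis
    qed
    have rs0: "rs j = rs 0" if "j < ?D" for j
      using that by (induction j) (use nb in auto)
    have rs: "rs 0 = reads (c r)"
    proof (rule nth_equalityI)
      show "length (rs 0) = length (reads (c r))"
        using lens(3)[of 0] run_views(4)[OF M, of ?u r] by (simp add: c_def syms_lists_def)
      fix t assume "t < length (rs 0)"
      hence t: "t < ?k" using lens(3)[of 0] by simp
      have ts: "length (snd (c r)) = ?k" using run_valid(2)[OF M, of ?u r] by (simp add: c_def valid_tapes_def)
      \<comment> \<open>The column \<open>j\<close> in which the head of tape \<open>t\<close>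
        stands. The check there fixes entry \<open>t\<close> of the guess, which \<open>rs0\<close>
        carries to the whole row.\<close>
      define p where "p = snd (snd (c r) ! t)"
      have p: "\<bar>p\<bar> \<le> int r" using head_bound[OF M t, of r ?u] by (simp add: p_def c_def run_def)
      define j where "j = nat (p + int T)"
      have j: "j < ?D" "?p j = p" using p r by (auto simp: j_def)
      have "heads (c r) p ! t" using t ts by (simp add: heads_def p_def)
      hence "fst (snd (cl j)) ! t = rs j ! t"
        using v[OF j(1)] t h[OF j(1)] j(2) by (auto simp: vj local_views_def)
      thus "rs 0 ! t = reads (c r) ! t"
        using rs0[OF j(1)] cl[OF j(1)] j(2) t ts by (simp add: column_def reads_def read_tape_def p_def)
    qed
    have "north (g (Suc r) j) = to_nat (column (c (Suc r)) (?p j))" if "j < ?D" for j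
      using v[OF that] run_column_Suc[OF M, of ?u r "?p j"] rs rs0[OF that] hl[OF that] hr[OF that] cl[OF that]
      by (simp add: vj step_tile_def c_def)
    thus ?case by blast
  qed
  hence "north (g T T) = to_nat (column (c T) 0)" by simp
  moreover have "g T T \<in> step_tiles M (T = 0) (T = 2 * T + 1) True"
    using mem[of T T] T(2) by (simp add: grid_tiles_def)
  moreover obtain q' sy' h' where C: "column (c T) 0 = (q', sy', h')" by (cases "column (c T) 0")
  ultimately have "fst (column (c T) 0) = num_states M \<and> fst (snd (column (c T) 0)) ! 1 = 2"
    unfolding C by (auto simp: step_tiles_def local_views_def step_tile_def)
  hence "fst (c T) = num_states M \<and> fst (snd (c T) ! 1) 0 = 2"
    using run_valid(2)[OF M, of ?u T] k by (simp add: column_def c_def valid_tapes_def)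
  thus ?thesis using y(1) c_def by blast
qed

text \<open>The tiles are cut out of the actual run. The border conditions hold because the heads
  cannot get that far, and row \<open>0\<close> follows a path of the certificate automaton for
  \<open>y\<close>.\<close>

lemma grid_complete:
  assumes M: "turing_machine M" and T: "length w + 2 * P \<le> T" "1 \<le> T" and y: "length y \<le> P"
    and acc: "fst (run M (w @ enc_string y) T) = num_states M" "fst (snd (run M (w @ enc_string y) T) ! 1) 0 = 2"
  obtains g :: "nat \<Rightarrow> nat \<Rightarrow> tile" where
    "\<And>r j. r \<le> T \<Longrightarrow> j < 2 * T + 2 \<Longrightarrow> g r j \<in> grid_tiles M w P T r j"
    "\<And>r j. west (g r (Suc j)) = Some (east (g r j))" "\<And>r. west (g r 0) = None"
    "\<And>r j. south (g (Suc r) j) = Some (north (g r j))" "\<And>j. south (g 0 j) = None"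
proof -
  let ?k = "num_tapes M"
  let ?D = "2 * T + 2"
  let ?u = "w @ enc_string y"
  have k: "?k \<ge> 2" using M by (simp add: turing_machine_def)
  define c where "c = run M ?u"
  let ?p = "\<lambda>j. int j - int T"
  obtain \<sigma> where \<sigma>: "\<sigma> 0 = 0" "\<And>i. (\<sigma> i, \<sigma> (Suc i), contents (enc_string y) (int i)) \<in> cert_trs P i"
    using cert_complete[OF y] by blast
  define st where "st = (\<lambda>j. if j \<le> T + length w then 0 else \<sigma> (j - (T + length w)))"
  define view where "view = (\<lambda>r j. (column (c r) (?p j), reads (c r), heads (c r) (?p j - 1), heads (c r) (?p j + 1)))"
  define g where "g = (\<lambda>r j. case r of
      0 \<Rightarrow> (if j = 0 then None else Some (st j), st (Suc j), None, to_nat (column (c 0) (?p j)))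
    | Suc r \<Rightarrow> step_tile M (j = 0) (view r j))"
  have row0: "(st j, st (Suc j), contents ?u (?p j)) \<in> row0_trs w P T j" for j
  proof -
    consider "j < T" | "T \<le> j" "j < T + length w" | i where "j = T + length w + i"
      by (metis le_add_diff_inverse not_le)
    thus ?thesis
    proof cases
      case 1
      thus ?thesis by (simp add: row0_trs_def st_def contents_def)
    next
      case 2
      hence "?p j = int (j - T)" "j - T < length w" by auto
      thus ?thesis using 2 contents_append_left[of "j - T" w "enc_string y"] by (simp add: row0_trs_def st_def)
    next
      case 3
      have "?p j = int (length w + i)" using 3 by simp
      hence "contents ?u (?p j) = contents (enc_string y) (int i)" by (simp only: contents_append_right)
      moreover have "st j = \<sigma> i" "st (Suc j) = \<sigma> (Suc i)" using 3 \<sigma>(1) by (auto simp: st_def)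
      ultimately show ?thesis using \<sigma>(2)[of i] 3 by (simp add: row0_trs_def)
    qed
  qed
  have north: "north (g r j) = to_nat (column (c r) (?p j))" for r j
    using run_column_Suc[OF M, of ?u _ "?p j"] by (cases r) (simp_all add: g_def step_tile_def view_def c_def)
  show thesis
  proof (rule that)
    fix r j assume rj: "r \<le> T" "j < ?D"
    show "g r j \<in> grid_tiles M w P T r j"
    proof (cases r)
      case 0
      have "column (c 0) (?p j) = (0, contents ?u (?p j) # replicate (?k - 1) 0, replicate ?k (j = T))"
        using column_start[of M ?u "?p j"] k by (simp add: c_def run_def)
      thus ?thesis using row0[of j] 0 unfolding grid_tiles_def init_tiles_def
        by (auto simp: g_def intro!: image_eqI[where x = "(st j, st (Suc j), contents ?u (?p j))"])
    next
      case (Suc q)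
      have "view q j \<in> local_views M (j = 0) (j = 2 * T + 1) (r = T \<and> j = T)"
      proof -
        define cl where "cl = column (c q) (?p j)"
        obtain q' sy h where cl': "cl = (q', sy, h)" by (cases cl)
        have views: "q' \<in> {..num_states M}" "sy \<in> syms_lists M" "h = heads (c q) (?p j)"
          using run_views(1,2)[OF M, of ?u q "?p j"] cl' by (simp_all add: cl_def c_def) (simp add: column_def)
        have "h ! i \<longrightarrow> sy ! i = reads (c q) ! i" if "i < ?k" for i
          using cl' that run_valid(2)[OF M, of ?u q]
          by (auto simp: cl_def column_def heads_def reads_def read_tape_def c_def valid_tapes_def)
        moreover have "j = 0 \<longrightarrow> True \<notin> set (heads (c q) (?p j - 1))"
          "j = 2 * T + 1 \<longrightarrow> True \<notin> set (heads (c q) (?p j + 1))"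
          using rj(1) Suc unfolding c_def by (auto intro!: run_heads_far[OF M])
        moreover have "case next_column M (reads (c q)) (heads (c q) (?p j - 1)) (heads (c q) (?p j + 1)) cl of
            (q', sy', h') \<Rightarrow> q' = num_states M \<and> sy' ! 1 = 2" if "r = T" "j = T"
          using run_column_Suc[OF M, of ?u q "?p j"] that Suc acc run_valid(2)[OF M, of ?u T] k
          by (auto simp: cl_def c_def column_def valid_tapes_def)
        ultimately show ?thesis
          using views run_views(3)[OF M, of ?u q] run_views(4)[OF M, of ?u q] cl'
          unfolding view_def cl_def[symmetric] local_views_def by (simp add: c_def)
      qed
      thus ?thesis using Suc by (auto simp: grid_tiles_def step_tiles_def g_def)
    qed
  next
    fix r j
    show "west (g r (Suc j)) = Some (east (g r j))"
      by (cases r) (auto simp: g_def step_tile_def view_def column_def add.commute intro!: arg_cong[where f = "heads _"])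
    show "west (g r 0) = None" by (cases r) (auto simp: g_def step_tile_def view_def)
    show "south (g (Suc r) j) = Some (north (g r j))"
      unfolding north by (simp add: g_def step_tile_def view_def)
    show "south (g 0 j) = None" by (simp add: g_def)
  qed
qed

lemma tiling_iff_accepting:
  assumes M: "turing_machine M" and T: "length w + 2 * P \<le> T" "1 \<le> T"
  defines "D \<equiv> 2 * T + 2" and "N \<equiv> (T + 1) * (2 * T + 2)"
  shows "(\<exists>\<tau>. \<forall>i<N. \<tau> i \<in> grid_tiles M w P T (i div D) (i mod D) \<and> (\<forall>j<N. fits D i (\<tau> i) j (\<tau> j))) \<longleftrightarrow>
    (\<exists>y. length y \<le> P \<and> fst (run M (w @ enc_string y) T) = num_states M \<and>
       fst (snd (run M (w @ enc_string y) T) ! 1) 0 = 2)"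
proof
  assume "\<exists>\<tau>. \<forall>i<N. \<tau> i \<in> grid_tiles M w P T (i div D) (i mod D) \<and> (\<forall>j<N. fits D i (\<tau> i) j (\<tau> j))"
  then obtain \<tau> where \<tau>: "\<And>i. i < N \<Longrightarrow> \<tau> i \<in> grid_tiles M w P T (i div D) (i mod D)"
    "\<And>i j. i < N \<Longrightarrow> j < N \<Longrightarrow> fits D i (\<tau> i) j (\<tau> j)" by blast
  have lt: "r * D + j < N" if "r \<le> T" "j < D" for r j
  proof -
    have "r * D + j < (r + 1) * D" using that(2) by simp
    also have "\<dots> \<le> N" unfolding N_def D_def[symmetric] using that(1) by (intro mult_right_mono) auto
    finally show ?thesis .
  qed
  show "\<exists>y. length y \<le> P \<and> fst (run M (w @ enc_string y) T) = num_states M \<and>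
       fst (snd (run M (w @ enc_string y) T) ! 1) 0 = 2"
  proof (rule grid_sound[OF M T, where g = "\<lambda>r j. \<tau> (r * D + j)"])
    fix r j assume rj: "r \<le> T" "j < 2 * T + 2"
    hence "j < D" by (simp add: D_def)
    thus "\<tau> (r * D + j) \<in> grid_tiles M w P T r j"
      using rj(1) \<tau>(1)[OF lt[of r j]] by simp
  next
    fix r j assume "r \<le> T" "j < 2 * T + 1"
    thus "west (\<tau> (r * D + Suc j)) \<in> {None, Some (east (\<tau> (r * D + j)))}"
      using \<tau>(2)[OF lt[of r j] lt[of r "Suc j"]] by (auto simp: fits_def D_def)
  next
    fix r j assume rj: "r < T" "j < 2 * T + 2"
    have "Suc r * D + j = r * D + j + D" "j < D" using rj by (simp_all add: D_def)
    thus "south (\<tau> (Suc r * D + j)) \<in> {None, Some (north (\<tau> (r * D + j)))}"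
      using \<tau>(2)[OF lt[of r j] lt[of "Suc r" j]] rj by (auto simp: fits_def D_def[symmetric] simp del: mult_Suc)
  qed
next
  assume "\<exists>y. length y \<le> P \<and> fst (run M (w @ enc_string y) T) = num_states M \<and>
       fst (snd (run M (w @ enc_string y) T) ! 1) 0 = 2"
  then obtain y where y: "length y \<le> P" "fst (run M (w @ enc_string y) T) = num_states M"
    "fst (snd (run M (w @ enc_string y) T) ! 1) 0 = 2" by blast
  obtain g :: "nat \<Rightarrow> nat \<Rightarrow> tile" where g: "\<And>r j. r \<le> T \<Longrightarrow> j < 2 * T + 2 \<Longrightarrow> g r j \<in> grid_tiles M w P T r j"
    "\<And>r j. west (g r (Suc j)) = Some (east (g r j))" "\<And>r. west (g r 0) = None"
    "\<And>r j. south (g (Suc r) j) = Some (north (g r j))" "\<And>j. south (g 0 j) = None"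
    using grid_complete[OF M T y] by blast
  have D: "D > 0" by (simp add: D_def)
  have "g (i div D) (i mod D) \<in> grid_tiles M w P T (i div D) (i mod D)" if "i < N" for i
  proof -
    have "i div D < T + 1" using that unfolding N_def D_def[symmetric] by (simp add: less_mult_imp_div_less)
    thus ?thesis using g(1) D by (simp add: D_def)
  qed
  moreover have "fits D i (g (i div D) (i mod D)) j (g (j div D) (j mod D))" for i j
    unfolding fits_def
  proof (intro conjI impI)
    assume j: "j = i + 1"
    show "west (g (j div D) (j mod D)) = None \<or> west (g (j div D) (j mod D)) = Some (east (g (i div D) (i mod D)))"
    \<comment> \<open>The successor of a cell in the last column is the first cell of the next row.
      It has no west colour, so nothing has to match across the line break.\<close>
    proof (cases "Suc (i mod D) = D")
      case True
      hence "j mod D = 0" by (simp add: j mod_Suc)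
      thus ?thesis using g(3) by simp
    next
      case False
      hence "j mod D = Suc (i mod D)" "j div D = i div D" by (simp_all add: j mod_Suc div_Suc)
      thus ?thesis using g(2) by simp
    qed
  next
    assume j: "j = i + D"
    have "j mod D = i mod D" "j div D = Suc (i div D)" using D by (simp_all add: j)
    thus "south (g (j div D) (j mod D)) = None \<or> south (g (j div D) (j mod D)) = Some (north (g (i div D) (i mod D)))"
      using g(4) by simp
  qed
  ultimately show "\<exists>\<tau>. \<forall>i<N. \<tau> i \<in> grid_tiles M w P T (i div D) (i mod D) \<and> (\<forall>j<N. fits D i (\<tau> i) j (\<tau> j))"
    by (intro exI[of _ "\<lambda>i. g (i div D) (i mod D)"]) blast
qed

section \<open>The reduction\<close>

definition ebits :: "bool list \<Rightarrow> bool list" where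
  "ebits bs = concat (map (\<lambda>b. [True, b]) bs)"

lemma enc_string_ebits: "enc_string bs = ebits bs @ [False]"
  by (simp add: enc_string_def enc_list_def ebits_def)

lemma ebits_append: "ebits (a @ b) = ebits a @ ebits b"
  by (simp add: ebits_def)

text \<open>A loop that is unrolled when the program is written: the tiles depend on the machine
  alone, only the cells depend on the input.\<close>

definition oseq :: "('a \<Rightarrow> out) \<Rightarrow> 'a list \<Rightarrow> out" where
  "oseq F ts = foldr (\<lambda>t. OSeq (F t)) ts (OConst [])"

lemma oev_oseq [simp]: "oev x s (oseq F ts) = concat (map (\<lambda>t. oev x s (F t)) ts)"
  by (induction ts) (auto simp: oseq_def)

text \<open>Makes a truth value that is computed at run time available to the text of the program,
  namely as an argument of the lists of tiles.\<close>

definition obranch :: "ex \<Rightarrow> (bool \<Rightarrow> out) \<Rightarrow> out" where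
  "obranch e F = OIf e (F True) (F False)"

lemma oev_obranch [simp]: "oev x s (obranch e F) = oev x s (F (tr x s e))"
  by (simp add: obranch_def)

lemma concat_map_const: "concat (map (\<lambda>_. concat (replicate k xs)) [0..<n]) = concat (replicate (n * k) xs)"
proof (induction n)
  case (Suc n)
  have "concat (replicate (n * k + k) xs) = concat (replicate (n * k) xs) @ concat (replicate k xs)"
    by (simp only: replicate_add concat_append)
  thus ?case using Suc by (simp add: add.commute)
qed simp

lemma concat_map_concat: "concat (map f (concat xss)) = concat (map (\<lambda>xs. concat (map f xs)) xss)"
  by (induction xss) auto

text \<open>The two lists are finite data built into the printing program, whose output is
  determined for arbitrary lists. That they enumerate the tiles of \<open>M\<close> is assumed in
  \<open>tiling_reduction\<close>.\<close>

locale tiling_program =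
  fixes M :: tm and G :: nat
    and init_list :: "bool \<Rightarrow> (nat \<times> nat \<times> nat) set \<Rightarrow> bool \<Rightarrow> tile list"
    and step_list :: "bool \<Rightarrow> bool \<Rightarrow> bool \<Rightarrow> tile list"
begin

definition tile_list :: "bool list \<Rightarrow> nat \<Rightarrow> nat \<Rightarrow> nat \<Rightarrow> nat \<Rightarrow> tile list" where
  "tile_list w P T r j = (if r = 0 then init_list (j = 0) (row0_trs w P T j) (j = T)
     else step_list (j = 0) (j = 2 * T + 1) (r = T \<and> j = T))"

definition cells :: "bool list \<Rightarrow> nat \<Rightarrow> nat \<Rightarrow> (nat \<times> nat \<times> tile) list" where
  "cells w P T = concat (map (\<lambda>r. concat (map (\<lambda>j. map (\<lambda>t. (r, j, t)) (tile_list w P T r j))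
     [0..<2 * T + 2])) [0..<T + 1])"

definition cell_name :: "nat \<Rightarrow> nat \<times> nat \<times> tile \<Rightarrow> bool list" where
  "cell_name T = (\<lambda>(r, j, t). tile_set G (2 * T + 2) (r * (2 * T + 2) + j) t)"

text \<open>A vote has to rank every candidate, but the rule looks only at the top choice; so the
  name of \<open>c\<close> comes first and the others follow in the order of the cells.\<close>

definition cell_vote :: "bool list \<Rightarrow> nat \<Rightarrow> nat \<Rightarrow> nat \<times> nat \<times> tile \<Rightarrow> vote" where
  "cell_vote w P T c = cell_name T c # [] # map (cell_name T) (filter (\<lambda>d. d \<noteq> c) (cells w P T))"

text \<open>The limit has to be at least the number \<open>N\<close> of registered voters.
  \<open>2 ^ N - 1\<close> is convenient since its binary representation consists of
  \<open>N\<close> ones and is printed by a loop.\<close>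

definition grid_instance :: "bool list \<Rightarrow> nat \<Rightarrow> nat \<Rightarrow> bool list" where
  "grid_instance w P T = (let cs = [] # map (cell_name T) (cells w P T); N = (T + 1) * (2 * T + 2) in
     enc_list enc_string cs @ enc_votes (replicate N cs) @ enc_votes (map (cell_vote w P T) (cells w P T)) @
     enc_nat (2 ^ N - 1) @ enc_string [])"

text \<open>
  The variables \<open>3\<close> to \<open>9\<close> hold the parameters of the grid, the variables from \<open>20\<close> on are the loop
  counters, \<open>i\<close> for the rows and \<open>j\<close> for the columns.
\<close>

definition params :: "bool list \<Rightarrow> (nat \<Rightarrow> nat) \<Rightarrow> bool list \<Rightarrow> nat \<Rightarrow> nat \<Rightarrow> bool" where
  "params z s w P T \<longleftrightarrow> s 3 = T \<and> s 4 = 2 * T + 2 \<and> s 5 = T + 1 \<and> s 6 = T + length w \<and> s 7 = 2 * T \<and>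
     s 8 = T + length w + 2 * P \<and> s 9 = 2 * T + 1 \<and> take (length w) z = w \<and> 2 * T + 2 \<le> length z"

definition block_size :: nat where
  "block_size = 1 + 2 * G"

definition zero_block :: "bool list" where
  "zero_block = concat (replicate block_size [True, False])"

text \<open>The number of empty blocks in front may exceed the range of a variable, so it is never
  computed: a nested loop prints the blocks of the full rows, another one those of the current row.
  Variable \<open>7\<close> is the width minus two, the number of blocks between the east and the
  north block.\<close>

definition oname :: "nat \<Rightarrow> nat \<Rightarrow> tile \<Rightarrow> out" where
  "oname i j t = OSeq (OFor 24 (EV i) (OFor 25 (EV 4) (OConst zero_block))) (OSeq (OFor 24 (EV j) (OConst zero_block))
     (OSeq (OConst (ebits (block_own G t @ block_east G t))) (OSeq (OFor 24 (EV 7) (OConst zero_block))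
     (OConst (ebits (block_north G t) @ [False])))))"

text \<open>The input begins with \<open>w\<close>, so bit \<open>j - T\<close> of \<open>w\<close>
  is read directly from position \<open>j - T + 1\<close>.\<close>

definition otiles :: "nat \<Rightarrow> nat \<Rightarrow> (tile \<Rightarrow> out) \<Rightarrow> out" where
  "otiles i j F = OIf (eeq (EV i) EZ)
     (obranch (eeq (EV j) EZ) (\<lambda>fc. obranch (eeq (EV j) (EV 3)) (\<lambda>hb.
       let X = (\<lambda>A. oseq F (init_list fc A hb)) in
       OIf (esub (EV 3) (EV j)) (X {(0, 0, 0)})
       (OIf (esub (EV 6) (EV j)) (OIf (eis (ES (esub (EV j) (EV 3))) 2) (X {(0, 0, 2)}) (X {(0, 0, 1)}))
       (OIf (esub (EV 8) (EV j)) (X any_trs) (OIf (eeq (EV j) (EV 8)) (X last_trs) (X end_trs)))))))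
     (obranch (eeq (EV j) EZ) (\<lambda>fc. obranch (eeq (EV j) (EV 9)) (\<lambda>lc.
       obranch (eand (eeq (EV i) (EV 3)) (eeq (EV j) (EV 3))) (\<lambda>ac. oseq F (step_list fc lc ac)))))"

definition oall :: "nat \<Rightarrow> nat \<Rightarrow> (tile \<Rightarrow> out) \<Rightarrow> out" where
  "oall i j F = OFor i (EV 5) (OFor j (EV 4) (otiles i j F))"

definition ocand :: "nat \<Rightarrow> nat \<Rightarrow> tile \<Rightarrow> out" where
  "ocand i j t = OSeq (OConst [True]) (oname i j t)"

definition ocands :: "nat \<Rightarrow> nat \<Rightarrow> out" where
  "ocands i j = OSeq (OConst [True, False]) (OSeq (oall i j (ocand i j)) (OConst [False]))"

text \<open>The top choice must not be repeated further down. Whether the tiles agree is decided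
  when the program is written, whether the cells agree when it runs.\<close>

definition ovote :: "tile \<Rightarrow> out" where
  "ovote t = OSeq (OConst [True, True]) (OSeq (oname 20 21 t) (OSeq (OConst [True, False])
     (OSeq (oall 22 23 (\<lambda>u. if u = t
         then OIf (eand (eeq (EV 22) (EV 20)) (eeq (EV 23) (EV 21))) (OConst []) (ocand 22 23 u)
         else ocand 22 23 u)) (OConst [False]))))"

definition ogrid :: out where
  "ogrid = OSeq (ocands 20 21)
     (OSeq (OFor 20 (EV 5) (OFor 21 (EV 4) (OSeq (OConst [True]) (ocands 22 23))))
     (OSeq (OConst [False]) (OSeq (oall 20 21 ovote) (OSeq (OConst [False])
     (OSeq (OFor 20 (EV 5) (OFor 21 (EV 4) (OConst [True, True]))) (OConst [False, False]))))))"

lemma params_upd [simp]: "v \<ge> 20 \<Longrightarrow> params z (s(v := a)) w P T \<longleftrightarrow> params z s w P T"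
  by (simp add: params_def)

lemma oev_oname:
  assumes "params z s w P T"
  shows "oev z s (oname i j t) = enc_string (cell_name T (s i, s j, t))"
proof -
  let ?K = block_size
  have z: "ebits (replicate m False) = concat (replicate m [True, False])" for m by (simp add: ebits_def)
  have s: "s 4 = 2 * T + 2" "s 7 = 2 * T + 2 - 2" using assms(1) by (simp_all add: params_def)
  have l: "concat (map (\<lambda>_. zero_block) [0..<n]) = concat (replicate (n * ?K) [True, False])" for n
    unfolding zero_block_def by (rule concat_map_const)
  have "oev z s (oname i j t) = concat (replicate (s i * (s 4 * ?K)) [True, False]) @ concat (replicate (s j * ?K) [True, False]) @
      ebits (block_own G t @ block_east G t) @ concat (replicate (s 7 * ?K) [True, False]) @ ebits (block_north G t) @ [False]"
    by (simp add: oname_def l concat_map_const del: concat_replicate_trivial)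
  also have "\<dots> = ebits (replicate (s i * (s 4 * ?K) + s j * ?K) False @ block_own G t @ block_east G t @
      replicate (s 7 * ?K) False @ block_north G t) @ [False]"
    by (simp only: ebits_append z[symmetric] replicate_add append_assoc)
  also have "s i * (s 4 * ?K) + s j * ?K = (s i * (2 * T + 2) + s j) * ?K" by (simp only: s(1) mult.assoc add_mult_distrib)
  finally show ?thesis by (simp only: enc_string_ebits cell_name_def tile_set_def prod.case s(2) block_size_def)
qed

lemma oev_otiles:
  assumes p: "params z s w P T" and ij: "i \<ge> 20" "j \<ge> 20" "s j < 2 * T + 2"
  shows "oev z s (otiles i j F) = concat (map (\<lambda>t. oev z s (F t)) (tile_list w P T (s i) (s j)))"
proof (cases "s i = 0")
  case False
  thus ?thesis using p by (simp add: otiles_def tile_list_def params_def)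
next
  case True
  have s: "s 3 = T" "s 6 = T + length w" "s 8 = T + length w + 2 * P" using p by (simp_all add: params_def)
  have "row0_trs w P T (s j) = (if s j < T then {(0, 0, 0)} else if s j < T + length w
      then (if rd z (ev z s (ES (esub (EV j) (EV 3)))) = 2 then {(0, 0, 2)} else {(0, 0, 1)})
      else if s j < T + length w + 2 * P then any_trs else if s j = T + length w + 2 * P then last_trs else end_trs)"
  proof -
    have "rd z (ev z s (ES (esub (EV j) (EV 3)))) = 2 \<longleftrightarrow> w ! (s j - T)" if "T \<le> s j" "s j < T + length w"
    proof -
      have "s j - T < length w" using that by simp
      hence "w ! (s j - T) = z ! (s j - T)" using p by (metis params_def nth_take)
      moreover have "s j - T < length z" using p ij(3) unfolding params_def by linarith
      ultimately show ?thesis by (simp add: s rd_def)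
    qed
    thus ?thesis by (auto simp: row0_trs_def cert_trs_def)
  qed
  thus ?thesis using True s by (simp add: otiles_def tile_list_def Let_def del: ev.simps(4) cong: if_cong)
qed

lemma oev_oall:
  assumes p: "params z s w P T" and ij: "i \<ge> 20" "j \<ge> 20" "i \<noteq> j"
  shows "oev z s (oall i j F) = concat (map (\<lambda>(r, c, t). oev z (s(i := r, j := c)) (F t)) (cells w P T))"
proof -
  have s: "s 5 = T + 1" "s 4 = 2 * T + 2" using p by (simp_all add: params_def)
  have "oev z s (oall i j F) = concat (map (\<lambda>r. concat (map (\<lambda>c. oev z (s(i := r, j := c)) (otiles i j F))
      [0..<2 * T + 2])) [0..<T + 1])"
    using ij by (simp only: oall_def oev.simps ev.simps s fun_upd_apply) (simp add: s)
  also have "\<dots> = concat (map (\<lambda>r. concat (map (\<lambda>c. concat (map (\<lambda>t. oev z (s(i := r, j := c)) (F t)) (tile_list w P T r c)))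
      [0..<2 * T + 2])) [0..<T + 1])"
    using p ij by (intro arg_cong[where f = concat] map_cong refl) (subst oev_otiles, auto)
  finally show ?thesis by (simp add: cells_def concat_map_concat comp_def del: upt_Suc)
qed

lemma oev_ocand:
  "params z s w P T \<Longrightarrow> oev z s (ocand i j t) = True # enc_string (cell_name T (s i, s j, t))"
  by (simp add: ocand_def oev_oname)

lemma enc_cands:
  "enc_list enc_string ([] # map f xs) = [True, False] @ concat (map (\<lambda>x. True # enc_string (f x)) xs) @ [False]"
  by (simp add: enc_list_def enc_string_Nil comp_def)

lemma oev_ocands:
  assumes p: "params z s w P T" and ij: "i \<ge> 20" "j \<ge> 20" "i \<noteq> j"
  shows "oev z s (ocands i j) = enc_list enc_string ([] # map (cell_name T) (cells w P T))"
proof -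
  have "(\<lambda>(r, c, t). oev z (s(i := r, j := c)) (ocand i j t)) = (\<lambda>c. True # enc_string (cell_name T c))"
    using p ij by (auto simp: oev_ocand fun_eq_iff)
  thus ?thesis by (simp only: ocands_def oev.simps oev_oall[OF assms] enc_cands)
qed

lemma concat_map_if: "concat (map (\<lambda>x. if P x then [] else f x) xs) = concat (map f (filter (\<lambda>x. \<not> P x) xs))"
  by (induction xs) auto

lemma oev_ovote:
  assumes p: "params z s w P T"
  shows "oev z s (ovote t) = True # enc_list enc_string (cell_vote w P T (s 20, s 21, t))"
proof -
  let ?c = "(s 20, s 21, t)"
  have "(\<lambda>(r, c, u). oev z (s(22 := r, 23 := c)) (if u = t
         then OIf (eand (eeq (EV 22) (EV 20)) (eeq (EV 23) (EV 21))) (OConst []) (ocand 22 23 u)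
         else ocand 22 23 u)) = (\<lambda>d. if d = ?c then [] else True # enc_string (cell_name T d))"
    using p by (auto simp: oev_ocand fun_eq_iff)
  hence "oev z s (oall 22 23 (\<lambda>u. if u = t
         then OIf (eand (eeq (EV 22) (EV 20)) (eeq (EV 23) (EV 21))) (OConst []) (ocand 22 23 u)
         else ocand 22 23 u)) =
       concat (map (\<lambda>d. True # enc_string (cell_name T d)) (filter (\<lambda>d. d \<noteq> ?c) (cells w P T)))"
    by (subst oev_oall[OF p]) (simp_all add: concat_map_if)
  thus ?thesis unfolding ovote_def
    by (simp add: oev_oname[OF p] cell_vote_def enc_list_def enc_string_Nil comp_def)
qed

lemma enc_nat_ones: "enc_nat (2 ^ n - 1) = concat (replicate n [True, True]) @ [False]"
proof -
  have "bin_of_nat (2 ^ n - 1) = replicate n True"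
  proof (induction n)
    case (Suc n)
    obtain m where m: "2 ^ n = Suc m" using not0_implies_Suc[of "2 ^ n"] by auto
    hence "2 ^ Suc n - 1 = Suc (2 * m)" by simp
    thus ?case using Suc m by (subst bin_of_nat.simps) simp
  qed (simp add: bin_of_nat.simps)
  thus ?thesis by (simp add: enc_nat_def enc_string_ebits ebits_def)
qed

lemma oev_ogrid:
  assumes p: "params z s w P T"
  shows "oev z s ogrid = grid_instance w P T"
proof -
  let ?cs = "[] # map (cell_name T) (cells w P T)"
  let ?D = "2 * T + 2"
  have s: "s 5 = T + 1" "s 4 = ?D" using p by (simp_all add: params_def)
  have rep: "oev z s (OFor 20 (EV 5) (OFor 21 (EV 4) q)) = concat (replicate ((T + 1) * ?D) xs)"
    if "\<And>a b. oev z (s(20 := a, 21 := b)) q = xs" for q xs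
  proof -
    have "oev z s (OFor 20 (EV 5) (OFor 21 (EV 4) q)) =
        concat (map (\<lambda>_. concat (map (\<lambda>_. xs) [0..<?D])) [0..<T + 1])"
      by (simp add: that s)
    also have "\<dots> = concat (map (\<lambda>_. concat (replicate ?D xs)) [0..<T + 1])"
      by (simp only: map_replicate_const length_upt diff_zero)
    finally show ?thesis by (simp only: concat_map_const)
  qed
  have "oev z (s(20 := a, 21 := b)) (OSeq (OConst [True]) (ocands 22 23)) = True # enc_list enc_string ?cs" for a b
    using p by (simp add: oev_ocands[of z _ w P T])
  note vs = rep[OF this]
  have ks: "oev z s (OFor 20 (EV 5) (OFor 21 (EV 4) (OConst [True, True]))) = concat (replicate ((T + 1) * ?D) [True, True])"
    by (rule rep) simp
  have "(\<lambda>(r, c, t). oev z (s(20 := r, 21 := c)) (ovote t)) = (\<lambda>c. True # enc_list enc_string (cell_vote w P T c))"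
    using p by (auto simp: oev_ovote fun_eq_iff)
  hence us: "oev z s (oall 20 21 ovote) = concat (map (\<lambda>c. True # enc_list enc_string (cell_vote w P T c)) (cells w P T))"
    using oev_oall[OF p, of 20 21 ovote] by simp
  show ?thesis
    unfolding ogrid_def grid_instance_def Let_def oev.simps(1,2) oev_ocands[OF p] vs us ks enc_nat_ones
    by (simp add: oev_ocands[OF p] enc_votes_def enc_list_def[of "enc_list enc_string"] comp_def map_replicate enc_string_Nil)
qed

end

section \<open>Correctness of the printed instance\<close>

definition prefix_free :: "('a \<Rightarrow> bool list) \<Rightarrow> bool" where
  "prefix_free e \<longleftrightarrow> (\<forall>a b u v. e a @ u = e b @ v \<longleftrightarrow> a = b \<and> u = v)"

lemma prefix_free_enc_list:
  assumes "prefix_free e"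
  shows "prefix_free (enc_list e)"
proof -
  have "enc_list e a @ u = enc_list e b @ v \<longleftrightarrow> a = b \<and> u = v" for a b u v
  proof (induction a arbitrary: b)
    case Nil
    thus ?case by (cases b) (auto simp: enc_list_def)
  next
    case (Cons c a)
    have eq: "enc_list e (d # xs) @ v = True # e d @ enc_list e xs @ v" for d xs v by (simp add: enc_list_def)
    show ?case
    proof (cases b)
      case Nil
      thus ?thesis by (simp add: eq) (simp add: enc_list_def)
    next
      case (Cons d b')
      thus ?thesis using assms Cons.IH[of b'] unfolding Cons eq prefix_free_def by auto
    qed
  qed
  thus ?thesis by (simp add: prefix_free_def)
qed

lemma prefix_free_enc_string: "prefix_free enc_string"
  by (simp add: prefix_free_def enc_string_append_inject)

lemma prefix_free_enc_nat: "prefix_free enc_nat"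
  using prefix_free_enc_string unfolding prefix_free_def enc_nat_def by (metis val_bin_of_nat)

text \<open>The components are prefix-free codes, so a string is an instance in at most one way and
  the existential quantifiers of the language disappear.\<close>

lemma control_by_replacing_voters_instance:
  "enc_list enc_string cs @ enc_votes vs @ enc_votes us @ enc_nat k @ enc_string p \<in> control_by_replacing_voters E \<longleftrightarrow>
    distinct cs \<and> election (set cs) (mset vs) \<and> election (set cs) (mset us) \<and> p \<in> set cs \<and>
    replacing_possible E (set cs) (mset vs) (mset us) k p"
proof -
  have "prefix_free (enc_list enc_string)" "prefix_free enc_votes"
    unfolding enc_votes_def by (intro prefix_free_enc_list prefix_free_enc_string)+
  moreover have "enc_string p = enc_string q \<longleftrightarrow> p = q" for p q
    using enc_string_append_inject[of p "[]" q "[]"] by simp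
  ultimately have "enc_list enc_string cs @ enc_votes vs @ enc_votes us @ enc_nat k @ enc_string p =
      enc_list enc_string cs' @ enc_votes vs' @ enc_votes us' @ enc_nat k' @ enc_string p' \<longleftrightarrow>
      cs = cs' \<and> vs = vs' \<and> us = us' \<and> k = k' \<and> p = p'" for cs' vs' us' k' p'
    using prefix_free_enc_nat unfolding prefix_free_def by simp
  thus ?thesis unfolding control_by_replacing_voters_def by auto
qed

lemma distinct_concat_upt:
  assumes "\<And>i. i < n \<Longrightarrow> distinct (f i)" "\<And>i j. i < j \<Longrightarrow> j < n \<Longrightarrow> set (f i) \<inter> set (f j) = {}"
  shows "distinct (concat (map f [0..<n]))"
  using assms
proof (induction n)
  case (Suc n)
  have "distinct (concat (map f [0..<n]))" using Suc.prems by (intro Suc.IH) auto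
  moreover have "x \<notin> set (f n)" if "x \<in> set (f i)" "i < n" for i x using Suc.prems(2)[of i n] that by auto
  ultimately show ?case using Suc.prems(1)[of n] by auto
qed simp

locale tiling_reduction = tiling_program +
  assumes M: "turing_machine M"
    and init_list: "finite A \<Longrightarrow> distinct (init_list fc A hb) \<and> set (init_list fc A hb) = init_tiles M fc A hb"
    and step_list: "distinct (step_list fc lc ac) \<and> set (step_list fc lc ac) = step_tiles M fc lc ac"
    and colours: "t \<in> grid_tiles M w P T r j \<Longrightarrow> colours_below G t"
begin

lemma tile_list: "distinct (tile_list w P T r j)" "set (tile_list w P T r j) = grid_tiles M w P T r j"
proof -
  have "finite (row0_trs w P T j)"
    by (simp add: row0_trs_def cert_trs_def any_trs_def last_trs_def end_trs_def)
  thus "distinct (tile_list w P T r j)" "set (tile_list w P T r j) = grid_tiles M w P T r j"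
    using init_list step_list by (simp_all add: tile_list_def grid_tiles_def)
qed

lemma set_cells: "set (cells w P T) = {(r, j, t). r < T + 1 \<and> j < 2 * T + 2 \<and> t \<in> grid_tiles M w P T r j}"
  by (force simp: cells_def tile_list simp del: upt_Suc)

lemma distinct_cells: "distinct (cells w P T)"
  unfolding cells_def by (intro distinct_concat_upt) (auto simp: distinct_map tile_list(1) inj_on_def simp del: upt_Suc)

lemma inj_on_cell_name: "inj_on (cell_name T) (set (cells w P T))"
proof (rule inj_onI)
  fix c d assume c: "c \<in> set (cells w P T)" and d: "d \<in> set (cells w P T)" and eq: "cell_name T c = cell_name T d"
  obtain r j t r' j' t' where cd: "c = (r, j, t)" "d = (r', j', t')" by (metis prod_cases3)
  have j: "j < 2 * T + 2" "j' < 2 * T + 2" and t: "t \<in> grid_tiles M w P T r j" "t' \<in> grid_tiles M w P T r' j'"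
    using c d by (auto simp: set_cells cd)
  have "r * (2 * T + 2) + j = r' * (2 * T + 2) + j' \<and> t = t'"
    using eq by (intro tile_set_inject[of "2 * T + 2" G]) (auto simp: cd cell_name_def intro: colours t)
  moreover have "(q * D + i) div D = q" if "i < D" for q i D :: nat using that by simp
  hence "r = r'" using j calculation by metis
  ultimately show "c = d" by (simp add: cd)
qed

lemma cell_names:
  fixes T :: nat
  defines "D \<equiv> 2 * T + 2"
  shows "cell_name T ` set (cells w P T) =
    {tile_set G D i t | i t. i < (T + 1) * D \<and> t \<in> grid_tiles M w P T (i div D) (i mod D)}"
proof (intro equalityI subsetI)
  fix c assume "c \<in> cell_name T ` set (cells w P T)"
  then obtain r j t where c: "c = tile_set G D (r * D + j) t" "r < T + 1" "j < D" "t \<in> grid_tiles M w P T r j"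
    by (auto simp: set_cells cell_name_def D_def)
  have "r * D + j < Suc r * D" using c(3) by simp
  also have "\<dots> \<le> (T + 1) * D" using c(2) by (intro mult_le_mono1) simp
  finally show "c \<in> {tile_set G D i t | i t. i < (T + 1) * D \<and> t \<in> grid_tiles M w P T (i div D) (i mod D)}"
    using c by (intro CollectI exI[of _ "r * D + j"] exI[of _ t]) simp
next
  fix c assume "c \<in> {tile_set G D i t | i t. i < (T + 1) * D \<and> t \<in> grid_tiles M w P T (i div D) (i mod D)}"
  then obtain i t where c: "c = tile_set G D i t" "i < (T + 1) * D" "t \<in> grid_tiles M w P T (i div D) (i mod D)" by blast
  have "i div D < T + 1" "i mod D < D" using c(2) by (simp_all add: less_mult_imp_div_less D_def)
  hence "(i div D, i mod D, t) \<in> set (cells w P T)" using c(3) by (simp add: set_cells D_def)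
  moreover have "c = cell_name T (i div D, i mod D, t)"
    by (simp only: c(1) cell_name_def prod.case D_def[symmetric] div_mult_mod_eq)
  ultimately show "c \<in> cell_name T ` set (cells w P T)" by blast
qed

theorem grid_instance_iff:
  assumes "length w + 2 * P \<le> T" "1 \<le> T"
  shows "grid_instance w P T \<in> control_by_replacing_voters packing_rule \<longleftrightarrow>
    (\<exists>y. length y \<le> P \<and> fst (run M (w @ enc_string y) T) = num_states M \<and>
       fst (snd (run M (w @ enc_string y) T) ! 1) 0 = 2)"
proof -
  define D where "D = 2 * T + 2"
  define N where "N = (T + 1) * D"
  define cells' where "cells' = cells w P T"
  define ns where "ns = map (cell_name T) cells'"
  define us where "us = map (cell_vote w P T) cells'"
  have dc: "distinct cells'" and inj: "inj_on (cell_name T) (set cells')"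
    by (simp_all add: cells'_def distinct_cells inj_on_cell_name)
  have T: "True \<in> set c" if "c \<in> set ns" for c
    using that by (auto simp: ns_def cell_name_def tile_set_def block_own_def split: prod.splits)
  have "[] \<notin> set ns" using T[of "[]"] by auto
  hence dn: "distinct ([] # ns)" using dc inj by (simp add: ns_def distinct_map)
  have d: "distinct (cell_vote w P T c) \<and> set (cell_vote w P T c) = set ([] # ns)" if "c \<in> set cells'" for c
  proof -
    let ?cs = "filter (\<lambda>d. d \<noteq> c) cells'"
    have "cell_name T d \<noteq> cell_name T c" if "d \<in> set ?cs" for d
      using inj_onD[OF inj, of d c] that \<open>c \<in> set cells'\<close> by auto
    hence "cell_name T c \<notin> set (map (cell_name T) ?cs)" by (metis (no_types, lifting) imageE set_map)
    moreover have ne: "cell_name T d \<noteq> []" if "d \<in> set cells'" for d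
      using \<open>[] \<notin> set ns\<close> that by (metis ns_def image_eqI set_map)
    moreover have "[] \<notin> set (map (cell_name T) ?cs)" by (auto simp: image_iff ne ne[symmetric])
    moreover have "cell_name T c \<noteq> []" by (rule ne[OF that])
    moreover have "distinct (map (cell_name T) ?cs)" using dn by (simp add: ns_def distinct_map_filter)
    ultimately have "distinct (cell_vote w P T c)"
      unfolding cell_vote_def cells'_def[symmetric] by simp
    moreover have "set (cell_vote w P T c) = set ([] # ns)"
      using that by (auto simp: cell_vote_def cells'_def[symmetric] ns_def)
    ultimately show ?thesis by blast
  qed
  have el: "election (set ([] # ns)) (mset (replicate N ([] # ns)))" "election (set ([] # ns)) (mset us)"
    using dn d by (auto simp: election_def permutations_of_set_def us_def set_replicate_conv_if split: if_splits)
  have "N < 2 ^ N" by (rule less_exp)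
  hence N: "N \<le> 2 ^ N - 1" by linarith
  have "grid_instance w P T = enc_list enc_string ([] # ns) @ enc_votes (replicate N ([] # ns)) @ enc_votes us @
      enc_nat (2 ^ N - 1) @ enc_string []"
    unfolding grid_instance_def Let_def ns_def us_def cells'_def N_def D_def ..
  hence "grid_instance w P T \<in> control_by_replacing_voters packing_rule \<longleftrightarrow>
      replacing_possible packing_rule (set ([] # ns)) (mset (replicate N ([] # ns))) (mset us) (2 ^ N - 1) []"
    using dn el by (simp only: control_by_replacing_voters_instance) simp
  also have "\<dots> \<longleftrightarrow> (\<exists>T\<subseteq>set ns. card T = N \<and> packed T (\<lambda>c. c))"
    using dn T N by (intro replacing_iff_packed) (auto simp: us_def ns_def cell_vote_def)
  also have "set ns = {tile_set G D i t | i t. i < N \<and> t \<in> grid_tiles M w P T (i div D) (i mod D)}"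
    unfolding ns_def cells'_def set_map N_def D_def by (rule cell_names)
  also have "(\<exists>X\<subseteq>{tile_set G D i t | i t. i < N \<and> t \<in> grid_tiles M w P T (i div D) (i mod D)}. card X = N \<and> packed X (\<lambda>c. c)) \<longleftrightarrow>
      (\<exists>\<tau>. \<forall>i<N. \<tau> i \<in> grid_tiles M w P T (i div D) (i mod D) \<and> (\<forall>j<N. fits D i (\<tau> i) j (\<tau> j)))"
    by (rule packing_iff_tiling) (auto simp: D_def intro: colours)
  also have "\<dots> \<longleftrightarrow> (\<exists>y. length y \<le> P \<and> fst (run M (w @ enc_string y) T) = num_states M \<and>
       fst (snd (run M (w @ enc_string y) T) ! 1) 0 = 2)"
    unfolding N_def D_def by (rule tiling_iff_accepting[OF M assms])
  finally show ?thesis .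
qed

end

lemma ex_colours_below: "finite S \<Longrightarrow> \<exists>G. \<forall>t\<in>S. colours_below G t"
proof (induction rule: finite_induct)
  case (insert t S)
  then obtain G where G: "\<forall>t\<in>S. colours_below G t" by blast
  have ex: "\<exists>m. \<forall>g. x = Some g \<longrightarrow> g < m" for x :: "nat option" by (cases x) auto
  obtain m1 where m1: "\<forall>g. west t = Some g \<longrightarrow> g < m1" using ex by blast
  obtain m2 where m2: "\<forall>g. south t = Some g \<longrightarrow> g < m2" using ex by blast
  have "colours_below (G + m1 + m2 + Suc (east t) + Suc (north t)) u" if "u \<in> insert t S" for u
    using that G m1 m2 unfolding colours_below_def by fastforce
  thus ?case by blast
qed simp

lemma finite_step_tiles: "finite (step_tiles M fc lc ac)"
proof -
  have "finite (syms_lists M)" "finite (head_lists M)"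
    unfolding syms_lists_def head_lists_def by (rule finite_lists_length_eq; simp)+
  hence "finite (({..num_states M} \<times> syms_lists M \<times> head_lists M) \<times> syms_lists M \<times> head_lists M \<times> head_lists M)"
    by (intro finite_cartesian_product) auto
  moreover have "local_views M fc lc ac \<subseteq> ({..num_states M} \<times> syms_lists M \<times> head_lists M) \<times> syms_lists M \<times> head_lists M \<times> head_lists M"
    by (auto simp: local_views_def)
  ultimately show ?thesis unfolding step_tiles_def by (metis finite_subset finite_imageI)
qed

text \<open>Row \<open>0\<close> uses six sets of transitions and the other rows do not depend on
  \<open>w\<close> and \<open>P\<close>. So the tiles of all grids lie in a finite set determined by
  \<open>M\<close>; one bound \<open>G\<close> and one fixed enumeration serve every input.\<close>

lemma ex_tiling_reduction:
  assumes "turing_machine M"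
  shows "\<exists>G init_list step_list. tiling_reduction M G init_list step_list"
proof -
  define S where "S = (\<Union>fc. \<Union>hb. \<Union>A\<in>{{(0, 0, 0)}, {(0, 0, 1)}, {(0, 0, 2)}, any_trs, last_trs, end_trs}.
      init_tiles M fc A hb) \<union> (\<Union>fc. \<Union>lc. \<Union>ac. step_tiles M fc lc ac)"
  have fi: "finite (init_tiles M fc A hb)" if "finite A" for fc A hb using that by (simp add: init_tiles_def)
  have "finite S" unfolding S_def using finite_step_tiles
    by (auto intro!: fi simp: any_trs_def last_trs_def end_trs_def)
  then obtain G where G: "\<forall>t\<in>S. colours_below G t" using ex_colours_below by blast
  have sub: "grid_tiles M w P T r j \<subseteq> S" for w P T r j
    unfolding grid_tiles_def S_def row0_trs_def cert_trs_def by auto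
  define lst where "lst = (\<lambda>S :: tile set. SOME xs. distinct xs \<and> set xs = S)"
  have lst: "distinct (lst S) \<and> set (lst S) = S" if "finite S" for S
    unfolding lst_def using finite_distinct_list[OF that] by (intro someI_ex[of "\<lambda>xs. distinct xs \<and> set xs = S"]) blast
  have "tiling_reduction M G (\<lambda>fc A hb. lst (init_tiles M fc A hb)) (\<lambda>fc lc ac. lst (step_tiles M fc lc ac))"
    using assms by unfold_locales (simp_all add: lst fi finite_step_tiles bspec[OF G subsetD[OF sub]])
  thus ?thesis by blast
qed

text \<open>Recovers \<open>length x\<close> from the padded input \<open>enc_string x @ v\<close>.
  The marker in front of bit \<open>u\<close> is at position \<open>u + (u + 1)\<close>, so
  \<open>u\<close> grows as long as a \<open>True\<close> is found there and stops at the end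
  mark.\<close>

definition elength :: ex where
  "elength = EIter 60 ETop EZ (EIf (eadd (EV 60) (ES (EV 60))) 2 (ES (EV 60)) (EV 60))"

lemma enc_string_nth:
  "i < length x \<Longrightarrow> (enc_string x @ v) ! (2 * i)" "\<not> (enc_string x @ v) ! (2 * length x)"
proof -
  have *: "(enc_string x @ v) ! (2 * i) \<longleftrightarrow> i < length x" if "i \<le> length x" for i
    using that
  proof (induction x arbitrary: i)
    case (Cons b x)
    thus ?case by (cases i) (auto simp: enc_string_Cons)
  qed (simp add: enc_string_Nil)
  show "i < length x \<Longrightarrow> (enc_string x @ v) ! (2 * i)" "\<not> (enc_string x @ v) ! (2 * length x)"
    using *[of i] *[of "length x"] by simp_all
qed

lemma length_enc_string: "length (enc_string x) = 2 * length x + 1"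
  by (induction x) (auto simp: enc_string_Nil enc_string_Cons)

lemma ev_elength: "ev (enc_string x @ v) s elength = length x"
proof -
  define z where "z = enc_string x @ v"
  define f where "f = (\<lambda>i u. ev z (s(60 := u, Suc 60 := i)) (EIf (eadd (EV 60) (ES (EV 60))) 2 (ES (EV 60)) (EV 60)))"
  have z: "2 * length x < length z" by (simp add: z_def length_enc_string)
  have f: "f i u = (if u < length x then Suc u else u)" if "u \<le> length x" for i u
  proof -
    have "rd z (Suc (2 * u)) = 2 \<longleftrightarrow> u < length x"
      using that z enc_string_nth(1)[of u x v] enc_string_nth(2)[of x v]
      by (cases "u = length x") (auto simp: rd_def z_def[symmetric])
    moreover have "min (u + min (Suc u) (length z + 1)) (length z + 1) = Suc (2 * u)" using that z by linarith
    moreover have "min (Suc u) (length z + 1) = Suc u" using that z by linarith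
    ultimately show ?thesis using that z by (cases "u = length x") (auto simp: f_def mult_2)
  qed
  have "iterate f 0 n = min n (length x)" for n by (induction n) (auto simp: f)
  moreover have "ev z s elength = iterate f 0 (length z + 1)" by (simp only: elength_def f_def ev.simps)
  moreover have "min (length z + 1) (length x) = length x" using z by linarith
  ultimately show ?thesis by (simp only: z_def)
qed

text \<open>Horner's scheme, with the multiplication as an iterated saturating addition and the
  coefficient \<open>a\<close> as \<open>a\<close> increments written into the expression. The
  argument is kept in variable \<open>1\<close>.\<close>

lemma ex_epoly: "\<exists>e. \<forall>z s. ev z s e = min (poly p (s 1)) (length z + 1)" for p :: "nat poly"
proof (induction p)
  case 0
  show ?case by (intro exI[of _ EZ]) simp
next
  case (pCons a p)
  then obtain e where e: "\<And>z s. ev z s e = min (poly p (s 1)) (length z + 1)" by blast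
  define m where "m = EIter 62 e EZ (eadd (EV 62) (EV 1))"
  have m: "ev z s m = min (s 1 * poly p (s 1)) (length z + 1)" for z s
  proof -
    define f where "f = (\<lambda>i u. ev z (s(62 := u, Suc 62 := i)) (eadd (EV 62) (EV 1)))"
    have "iterate f 0 n = min (n * s 1) (length z + 1)" for n
      by (induction n) (auto simp: f_def)
    moreover have "ev z s m = iterate f 0 (min (poly p (s 1)) (length z + 1))" by (simp only: m_def f_def ev.simps e)
    ultimately have "ev z s m = min (min (poly p (s 1)) (length z + 1) * s 1) (length z + 1)" by (simp only:)
    \<comment> \<open>If \<open>s 1\<close> is positive, a factor that was cut off at
      \<open>length z + 1\<close> still gives a product of at least that size; if \<open>s 1\<close>
      is \<open>0\<close>, both sides vanish.\<close>
    also have "\<dots> = min (s 1 * poly p (s 1)) (length z + 1)"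
      by (cases "s 1") (auto simp: min_def mult.commute)
    finally show ?thesis .
  qed
  have "ev z s ((ES ^^ k) m) = min (k + ev z s m) (length z + 1)" for k z s
    by (induction k) (auto simp: m)
  hence "ev z s ((ES ^^ a) m) = min (poly (pCons a p) (s 1)) (length z + 1)" for z s by (simp add: m)
  thus ?case by blast
qed

text \<open>With \<open>n\<close> in variable \<open>1\<close> and \<open>w = enc_string x\<close>,
  the length of \<open>w\<close> is \<open>2 * n + 1\<close>; this is the summand in variable
  \<open>6\<close>.\<close>

definition oparams :: "ex \<Rightarrow> ex \<Rightarrow> out \<Rightarrow> out" where
  "oparams eP eT q = OLet 1 elength (OLet 2 eP (OLet 3 eT (OLet 4 (ES (ES (eadd (EV 3) (EV 3))))
     (OLet 5 (ES (EV 3)) (OLet 6 (eadd (EV 3) (ES (eadd (EV 1) (EV 1)))) (OLet 7 (eadd (EV 3) (EV 3))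
     (OLet 8 (eadd (EV 6) (eadd (EV 2) (EV 2))) (OLet 9 (ES (EV 7)) q))))))))"

context tiling_program
begin

lemma oev_oparams:
  assumes eP: "\<And>z s. ev z s eP = min (poly p (s 1)) (length z + 1)"
    and eT: "\<And>z s. ev z s eT = min (poly t (s 1)) (length z + 1)"
    and T: "2 * length x + 1 + 2 * poly p (length x) \<le> poly t (length x)"
    and z: "z = enc_string x @ v" "2 * poly t (length x) + 2 \<le> length z"
  shows "oev z (\<lambda>_. 0) (oparams eP eT ogrid) = grid_instance (enc_string x) (poly p (length x)) (poly t (length x))"
proof -
  define P where "P = poly p (length x)"
  define T where "T = poly t (length x)"
  define n where "n = length x"
  have b: "2 * n + 1 + 2 * P \<le> T" "2 * T + 2 \<le> length z" using T z(2) by (simp_all add: P_def T_def n_def)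
  have n: "ev z s elength = n" for s by (simp add: ev_elength z(1) n_def)
  define s where "s = (\<lambda>_ :: nat. 0 :: nat)(1 := n, 2 := P, 3 := T, 4 := 2 * T + 2, 5 := T + 1, 6 := T + (2 * n + 1),
    7 := 2 * T, 8 := T + (2 * n + 1) + 2 * P, 9 := 2 * T + 1)"
  have "oev z (\<lambda>_. 0) (oparams eP eT ogrid) = oev z s ogrid"
  proof -
    have p: "poly p n = P" "poly t n = T" by (simp_all add: P_def T_def n_def)
    have m: "min P (length z + 1) = P" "min T (length z + 1) = T" "min (T + T) (length z + 1) = 2 * T"
      "min (Suc (2 * T)) (length z + 1) = 2 * T + 1" "min (Suc (2 * T + 1)) (length z + 1) = 2 * T + 2"
      "min (Suc T) (length z + 1) = T + 1" "min (n + n) (length z + 1) = 2 * n"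
      "min (Suc (2 * n)) (length z + 1) = 2 * n + 1" "min (T + (2 * n + 1)) (length z + 1) = T + (2 * n + 1)"
      "min (P + P) (length z + 1) = 2 * P"
      "min (T + (2 * n + 1) + 2 * P) (length z + 1) = T + (2 * n + 1) + 2 * P"
      using b by linarith+
    have le: "T \<le> length z + 1" "n \<le> length z + 1" "P \<le> length z + 1" "T + (2 * n + 1) \<le> length z + 1" using b by linarith+
    show ?thesis unfolding oparams_def s_def oev.simps(4)
      by (simp only: n eP eT ev_eadd ev.simps fun_upd_apply p m le if_True if_False num.distinct
          one_eq_numeral_iff numeral_eq_one_iff numeral_eq_iff num.inject refl simp_thms)
  qed
  also have "\<dots> = grid_instance (enc_string x) P T"
    using b by (intro oev_ogrid) (simp add: params_def s_def length_enc_string z(1) n_def)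
  finally show ?thesis by (simp add: P_def T_def)
qed

end

section \<open>Padding the input\<close>

lemma oev_input:
  "oev z s (OFor 20 (EP ETop) (OSeq (OConst bs) (obit (ES (EV 20))))) = concat (map (\<lambda>b. bs @ [b]) z)"
proof -
  have "map (\<lambda>i. bs @ [rd z (ev z (s(20 := i)) (ES (EV 20))) = 2]) [0..<length z] = map (\<lambda>b. bs @ [b]) z"
    by (intro nth_equalityI) (auto simp: rd_def min_def)
  thus ?thesis by simp
qed

lemma polytime_app_square: "polytime_app (\<lambda>z. z @ replicate (length z ^ 2) True)"
proof -
  have "oev z (\<lambda>_. 0) (OSeq (OFor 20 (EP ETop) (OSeq (OConst []) (obit (ES (EV 20)))))
      (OFor 20 (EP ETop) (OFor 21 (EP ETop) (OConst [True])))) = z @ replicate (length z ^ 2) True" for z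
    unfolding oev.simps(2)[of _ _ "OFor _ _ _" "OFor _ _ _"] oev_input
    using concat_map_const[of "length z" "[True]" "length z"] by (simp add: power2_eq_square map_replicate_const)
  thus ?thesis using polytime_app_out by (metis (no_types, lifting) ext)
qed

text \<open>The extra bit makes the length \<open>2 * length x + 2\<close>, which is at least
  \<open>2\<close> even for an empty \<open>x\<close>, so that its powers grow with the
  exponent.\<close>

lemma polytime_app_mark: "polytime_app (\<lambda>x. enc_string x @ [True])"
proof -
  have "oev x (\<lambda>_. 0) (OSeq (OFor 20 (EP ETop) (OSeq (OConst [True]) (obit (ES (EV 20))))) (OConst [False, True])) =
      enc_string x @ [True]" for x
    unfolding oev.simps(2)[of _ _ "OFor _ _ _" "OConst _"] oev_input by (simp add: enc_string_ebits ebits_def)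
  thus ?thesis using polytime_app_out by (metis (no_types, lifting) ext)
qed

lemma poly_nat_le_power: "\<exists>j. \<forall>n. poly q n \<le> (n + 2) ^ j" for q :: "nat poly"
proof (induction q)
  case (pCons a q)
  then obtain j where j: "\<And>n. poly q n \<le> (n + 2) ^ j" by blast
  have "poly (pCons a q) n \<le> (n + 2) ^ (a + j + 1)" for n
  proof -
    have "a \<le> 2 ^ a" by (rule less_imp_le) (rule less_exp)
    also have "\<dots> \<le> (n + 2) ^ a" by (rule power_mono) auto
    also have "\<dots> \<le> (n + 2) ^ (a + j)" by (rule power_increasing) auto
    finally have "a \<le> (n + 2) ^ (a + j)" .
    moreover have "(n + 2) ^ j \<le> (n + 2) ^ (a + j)" by (rule power_increasing) auto
    hence "n * poly q n \<le> n * (n + 2) ^ (a + j)" using j[of n] by (intro mult_le_mono2) (rule order_trans)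
    ultimately have "a + n * poly q n \<le> (n + 2) ^ (a + j) + n * (n + 2) ^ (a + j)" by (rule add_mono)
    also have "\<dots> = (n + 1) * (n + 2) ^ (a + j)" by simp
    finally have "poly (pCons a q) n \<le> (n + 1) * (n + 2) ^ (a + j)" by (simp only: poly_pCons)
    also have "\<dots> \<le> (n + 2) ^ (a + j + 1)" by simp
    finally show ?thesis .
  qed
  thus ?case by blast
qed simp

text \<open>A polynomial is at most \<open>(n + 2) ^ j\<close>, and \<open>j\<close> squarings raise
  the length to the power \<open>2 ^ j \<ge> j\<close>. Their number depends on \<open>q\<close>
  alone, so the composition is a single machine. \<open>enc_string x\<close> stays a prefix, from
  which \<open>x\<close> can be recovered.\<close>

lemma ex_padding:
  fixes q :: "nat poly"
  shows "\<exists>h. polytime_app h \<and> (\<forall>x. \<exists>v. h x = enc_string x @ v \<and> poly q (length x) \<le> length (h x))"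
proof -
  obtain j where j: "\<And>n. poly q n \<le> (n + 2) ^ j" using poly_nat_le_power by blast
  have "\<exists>h. polytime_app h \<and> (\<forall>x. \<exists>v. h x = enc_string x @ v \<and> (2 * length x + 2) ^ (2 ^ k) \<le> length (h x))" for k
  proof (induction k)
    case 0
    show ?case by (intro exI[of _ "\<lambda>x. enc_string x @ [True]"]) (simp add: polytime_app_mark length_enc_string)
  next
    case (Suc k)
    then obtain h where h: "polytime_app h" "\<And>x. \<exists>v. h x = enc_string x @ v \<and> (2 * length x + 2) ^ (2 ^ k) \<le> length (h x)" by blast
    let ?h = "(\<lambda>z. z @ replicate (length z ^ 2) True) \<circ> h"
    have "\<exists>v. ?h x = enc_string x @ v \<and> (2 * length x + 2) ^ (2 ^ Suc k) \<le> length (?h x)" for x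
    proof -
      obtain v where v: "h x = enc_string x @ v" "(2 * length x + 2) ^ (2 ^ k) \<le> length (h x)" using h(2) by blast
      have "(2 * length x + 2) ^ (2 ^ Suc k) = ((2 * length x + 2) ^ (2 ^ k)) ^ 2" by (simp only: power_mult[symmetric] power_Suc mult.commute)
      also have "\<dots> \<le> length (h x) ^ 2" using v(2) by (rule power_mono) simp
      also have "\<dots> \<le> length (?h x)" by simp
      finally show ?thesis using v(1) by (intro exI[of _ "v @ replicate (length (h x) ^ 2) True"]) simp
    qed
    thus ?case using polytime_app_comp[OF h(1) polytime_app_square] by blast
  qed
  then obtain h where h: "polytime_app h" "\<And>x. \<exists>v. h x = enc_string x @ v \<and> (2 * length x + 2) ^ (2 ^ j) \<le> length (h x)" by blast
  have "poly q n \<le> (2 * n + 2) ^ (2 ^ j)" for n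
  proof -
    note j[of n]
    also have "(n + 2) ^ j \<le> (2 * n + 2) ^ j" by (rule power_mono) auto
    also have "\<dots> \<le> (2 * n + 2) ^ (2 ^ j)" by (rule power_increasing) (auto simp: less_imp_le)
    finally show ?thesis .
  qed
  thus ?thesis using h by (metis order_trans)
qed

section \<open>Hardness of control by replacing voters\<close>

theorem control_by_replacing_voters_hard:
  assumes "A \<in> class_NP"
  shows "poly_many_one_reducible A (control_by_replacing_voters packing_rule)"
proof -
  obtain B and p :: "nat poly" where B: "B \<in> class_P"
    "\<And>x. x \<in> A \<longleftrightarrow> (\<exists>y. length y \<le> poly p (length x) \<and> enc_string x @ enc_string y \<in> B)"
    using assms unfolding class_NP_def by blast
  obtain M and b :: "nat poly" where M: "turing_machine M"
    "\<And>u. case (step M ^^ poly b (length u)) (start_config M u) of (q, ts) \<Rightarrow>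
      q = num_states M \<and> fst (ts ! 1) = contents [u \<in> B]"
    using B(1) unfolding class_P_def polytime_def by blast
  \<comment> \<open>A halted machine stays halted, so one number \<open>T\<close> of rows serves all
    certificates.\<close>
  have run: "fst (run M u T) = num_states M \<and> (fst (snd (run M u T) ! 1) 0 = 2 \<longleftrightarrow> u \<in> B)"
    if T: "poly b (length u) \<le> T" for u T
  proof -
    obtain ts where ts: "(step M ^^ poly b (length u)) (start_config M u) = (num_states M, ts)"
      "fst (ts ! 1) = contents [u \<in> B]" using M(2)[of u] by (auto split: prod.splits)
    have *: "(step M ^^ k) (num_states M, ts) = (num_states M, ts)" for k by (induction k) (auto simp: step_def)
    obtain k where k: "T = k + poly b (length u)" using le_Suc_ex[OF T] by (auto simp: add.commute)
    have "run M u T = (num_states M, ts)" by (simp only: run_def k funpow_add comp_apply ts(1) *)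
    thus ?thesis using ts(2) by (simp add: contents_def)
  qed
  \<comment> \<open>\<open>2 * n + 1\<close> symbols for the input and at most
    \<open>2 * poly p n + 1\<close> for the certificate: the greatest length of an input of the
    verifier.\<close>
  define l where "l = [:2, 2:] + smult 2 p"
  \<comment> \<open>The first summand covers the running time of the verifier on all these inputs,
    the second makes the grid wide enough for the input and the certificate.\<close>
  define t where "t = pcompose b l + l"
  have l: "poly l n = 2 + 2 * n + 2 * poly p n" for n by (simp add: l_def)
  have t: "poly t n = poly b (poly l n) + poly l n" for n by (simp add: t_def poly_pcompose)
  obtain G init_list step_list where "tiling_reduction M G init_list step_list"
    using ex_tiling_reduction[OF M(1)] by blast
  then interpret tiling_reduction M G init_list step_list .
  obtain eP where eP: "\<And>z s. ev z s eP = min (poly p (s 1)) (length z + 1)" using ex_epoly by blast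
  obtain eT where eT: "\<And>z s. ev z s eT = min (poly t (s 1)) (length z + 1)" using ex_epoly by blast
  obtain h where h: "polytime_app h"
    "\<And>x. \<exists>v. h x = enc_string x @ v \<and> poly (smult 2 t + [:2:]) (length x) \<le> length (h x)" using ex_padding by blast
  define f where "f = (\<lambda>z. oev z (\<lambda>_. 0) (oparams eP eT ogrid)) \<circ> h"
  have "polytime f" unfolding f_def
    by (intro polytime_app_polytime polytime_app_comp[OF h(1)] polytime_app_out)
  moreover have "x \<in> A \<longleftrightarrow> f x \<in> control_by_replacing_voters packing_rule" for x
  proof -
    let ?P = "poly p (length x)" and ?T = "poly t (length x)"
    obtain v where v: "h x = enc_string x @ v" "2 * ?T + 2 \<le> length (h x)" using h(2)[of x] by auto
    have T: "2 * length x + 1 + 2 * ?P \<le> ?T" "1 \<le> ?T" by (simp_all add: t l)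
    have "f x = grid_instance (enc_string x) ?P ?T"
      using oev_oparams[OF eP eT T(1) v] by (simp add: f_def)
    moreover have "poly b (length (enc_string x @ enc_string y)) \<le> ?T" if "length y \<le> ?P" for y
    proof -
      have "poly b (length (enc_string x @ enc_string y)) \<le> poly b (poly l (length x))"
        using that by (intro poly_nat_mono) (simp add: length_enc_string l)
      thus ?thesis by (simp add: t)
    qed
    ultimately show ?thesis
      using grid_instance_iff[of "enc_string x" ?P ?T] T run unfolding B(2) length_enc_string by auto
  qed
  ultimately show ?thesis unfolding poly_many_one_reducible_def by blast
qed

theorem theorem12:
  "\<exists>E. voting_rule E \<and> NP_complete (control_by_replacing_voters E) \<and> conformant_bribery E \<in> class_P"
  using voting_rule_packing_rule control_by_replacing_voters_class_NP control_by_replacing_voters_hard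
    conformant_bribery_class_P unfolding NP_complete_def by blast

end
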